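(* For every $\mu\in\mathrm{Prob}([-R,R]^n)$ with marginals $\mu_1,\dots,\mu_n$, $$H(\mu)=-\mathcal{I}_\mathrm{sym}(\mu)+\sum_{i=1}^nH(\mu_i).$$ Moreover, if $H(\mu_i)>-\infty$ for all $i$, then $\mathcal{I}_\mathrm{sym}(\mu)=I_\mathrm{sym}(\mu)=S(\mu\,\|\,\mu_1\otimes\cdots\otimes\mu_n)$, and $\mathcal{I}_\mathrm{sym}(\mu)=0$ if and only if $\mu=\mu_1\otimes\cdots\otimes\mu_n$.
   Context: Fix $R>0$ and $n\in\mathbb{N}$. $\mathrm{Prob}([-R,R]^k)$ denotes Borel probability measures on $[-R,R]^k$; $C_\mathbb{R}([-R,R]^n)$ real continuous functions with sup-norm; $\mu(h)=\int h\,d\mu$; $\mu_i$ is the $i$th marginal of $\mu$. The Boltzmann–Gibbs entropy is $H(\mu)=-\int p\log p\,d\mathbf{x}$ if $\mu$ has Lebesgue density $p$, else $H(\mu)=-\infty$; $S(\cdot\,\|\,\cdot)$ is relative entropy (Kullback–Leibler divergence). For $\mathbf{x}\in\mathbb{R}^N$ let $\kappa_N(\mathbf{x})=\frac1N\sum_jx_j$, with products and powers of vectors coordinatewise. $[-R,R]_\le^N$ is the set of vectors in $[-R,R]^N$ with nondecreasing coordinates; $S_N$ acts by $\sigma(\mathbf{x})=(x_{\sigma^{-1}(1)},\dots,x_{\sigma^{-1}(N)})$; $\gamma_{S_N}$ is the uniform probability on $S_N$. An approximating sequence for $(\mu_1,\dots,\mu_n)$ is $\Xi(N)=(\xi_1(N),\dots,\xi_n(N))$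 with $\xi_i(N)\in[-R,R]_\le^N$ and $\kappa_N(\xi_i(N)^k)\to\int x^k\,d\mu_i$ for all $k$. $\Delta_R(\mu;N,m,\delta)$ is the set of $(\mathbf{x}_1,\dots,\mathbf{x}_n)\in([-R,R]^N)^n$ with $|\kappa_N(\mathbf{x}_{i_1}\cdots\mathbf{x}_{i_k})-\int x_{i_1}\cdots x_{i_k}\,d\mu|<\delta$ for all $i_1,\dots,i_k\in\{1,\dots,n\}$, $1\le k\le m$; $\Delta_\mathrm{sym}(\mu:\Xi(N);N,m,\delta)$ is the set of $(\sigma_1,\dots,\sigma_n)\in S_N^n$ with $(\sigma_1(\xi_1(N)),\dots,\sigma_n(\xi_n(N)))\in\Delta_R(\mu;N,m,\delta)$; and $I_\mathrm{sym}(\mu)=-\lim_{m\to\infty,\delta\searrow0}\limsup_{N\to\infty}\frac1N\log\gamma_{S_N}^{\otimes n}(\Delta_\mathrm{sym}(\mu:\Xi(N);N,m,\delta))$. For $h\in C_\mathbb{R}([-R,R]^n)$, $\kappa_N(h(\mathbf{x}_1,\dots,\mathbf{x}_n))=\frac1N\sum_{j=1}^Nh(x_{1j},\dots,x_{nj})$, the mutual pressure is $$P_\mathrm{sym}(h:\mu_1,\dots,\mu_n)=\limsup_{N\to\infty}\frac1N\log\Biggl[\frac1{(N!)^n}\sum_{\sigma_1,\dots,\sigma_n\in S_N}\exp\bigl(N\kappa_N(h(\sigma_1(\xi_1(N)),\dots,\sigma_n(\xi_n(N))))\bigr)\Biggr],$$ and $\mathcal{I}_\mathrm{sym}(\mu)=\sup\{\mu(h)-P_\mathrm{sym}(h:\mu_1,\dots,\mu_n):h\in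 C_\mathbb{R}([-R,R]^n)\}\in[0,\infty]$. These quantities are independent of the approximating sequence. *)

theory Defs
  imports "HOL-Probability.Probability"
begin

text \<open>Points of R^n are extensional functions nat => real supported on {..<n}
  (indices 0..n-1 play the role of 1..n).\<close>

definition cube :: "real \<Rightarrow> nat \<Rightarrow> (nat \<Rightarrow> real) set" where
  "cube R n = PiE {..<n} (\<lambda>_. {-R..R})"

definition lebn :: "nat \<Rightarrow> (nat \<Rightarrow> real) measure" where
  "lebn n = PiM {..<n} (\<lambda>_. lborel)"

definition Prob_cube :: "real \<Rightarrow> nat \<Rightarrow> (nat \<Rightarrow> real) measure set" where
  "Prob_cube R n = {\<mu>. prob_space \<mu> \<and> sets \<mu> = sets (lebn n) \<and> emeasure \<mu> (cube R n) = 1}"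

definition marg :: "(nat \<Rightarrow> real) measure \<Rightarrow> nat \<Rightarrow> real measure" where
  "marg \<mu> i = distr \<mu> lborel (\<lambda>x. x i)"

text \<open>Boltzmann-Gibbs entropy w.r.t. the Lebesgue measure L:
  -int p log p if mu has a density p, and -infinity otherwise (for compactly supported
  measures the positive part of -p log p is integrable, so non-integrability means -infinity).\<close>
definition bg_entropy :: "'a measure \<Rightarrow> 'a measure \<Rightarrow> ereal" where
  "bg_entropy L \<mu> =
    (if \<exists>p. p \<in> borel_measurable L \<and> (\<forall>x. 0 \<le> p x) \<and> \<mu> = density L (\<lambda>x. ennreal (p x))
     then (let p = (SOME p. p \<in> borel_measurable L \<and> (\<forall>x. 0 \<le> p x) \<and>
                         \<mu> = density L (\<lambda>x. ennreal (p x)))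
           in if integrable L (\<lambda>x. p x * ln (p x))
              then ereal (- (\<integral>x. p x * ln (p x) \<partial>L)) else -\<infinity>)
     else -\<infinity>)"

definition rel_entropy :: "'a measure \<Rightarrow> 'a measure \<Rightarrow> ereal" where
  "rel_entropy \<mu> \<nu> =
    (if sets \<mu> = sets \<nu> \<and> absolutely_continuous \<nu> \<mu>
     then (let f = (\<lambda>x. enn2real (RN_deriv \<nu> \<mu> x))
           in if integrable \<nu> (\<lambda>x. f x * ln (f x))
              then ereal (\<integral>x. f x * ln (f x) \<partial>\<nu>) else \<infinity>)
     else \<infinity>)"

definition elog :: "real \<Rightarrow> ereal" where
  "elog x = (if x \<le> 0 then -\<infinity> else ereal (ln x))"

definition kappa :: "nat \<Rightarrow> (nat \<Rightarrow> real) \<Rightarrow> real" where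
  "kappa N x = (\<Sum>j<N. x j) / real N"

definition perms :: "nat \<Rightarrow> (nat \<Rightarrow> nat) set" where
  "perms N = {\<sigma>. \<sigma> permutes {..<N}}"

definition act :: "(nat \<Rightarrow> nat) \<Rightarrow> (nat \<Rightarrow> real) \<Rightarrow> (nat \<Rightarrow> real)" where
  "act \<sigma> x = (\<lambda>j. x (inv \<sigma> j))"

text \<open>Xi i N j is the j-th coordinate of xi_i(N).\<close>
definition xi_vec :: "(nat \<Rightarrow> nat \<Rightarrow> nat \<Rightarrow> real) \<Rightarrow> nat \<Rightarrow> nat \<Rightarrow> (nat \<Rightarrow> real)" where
  "xi_vec \<Xi> i N = restrict (\<Xi> i N) {..<N}"

definition approx_seq :: "real \<Rightarrow> nat \<Rightarrow> (nat \<Rightarrow> real) measure \<Rightarrow> (nat \<Rightarrow> nat \<Rightarrow> nat \<Rightarrow> real) \<Rightarrow> bool" where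
  "approx_seq R n \<mu> \<Xi> \<longleftrightarrow>
     (\<forall>i<n. \<forall>N. (\<forall>j<N. \<Xi> i N j \<in> {-R..R}) \<and> (\<forall>j k. j \<le> k \<and> k < N \<longrightarrow> \<Xi> i N j \<le> \<Xi> i N k)) \<and>
     (\<forall>i<n. \<forall>k::nat. (\<lambda>N. kappa N (\<lambda>j. (\<Xi> i N j) ^ k)) \<longlonglongrightarrow> (\<integral>x. x ^ k \<partial>(marg \<mu> i)))"

definition Delta_R :: "real \<Rightarrow> (nat \<Rightarrow> real) measure \<Rightarrow> nat \<Rightarrow> nat \<Rightarrow> nat \<Rightarrow> real \<Rightarrow> (nat \<Rightarrow> nat \<Rightarrow> real) set" where
  "Delta_R R \<mu> n N m \<delta> =
    {X \<in> PiE {..<n} (\<lambda>_. PiE {..<N} (\<lambda>_. {-R..R})).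
       \<forall>is. set is \<subseteq> {..<n} \<and> 1 \<le> length is \<and> length is \<le> m \<longrightarrow>
         \<bar>kappa N (\<lambda>j. prod_list (map (\<lambda>i. X i j) is)) - (\<integral>y. prod_list (map (\<lambda>i. y i) is) \<partial>\<mu>)\<bar> < \<delta>}"

definition Delta_sym :: "real \<Rightarrow> (nat \<Rightarrow> real) measure \<Rightarrow> (nat \<Rightarrow> nat \<Rightarrow> nat \<Rightarrow> real) \<Rightarrow> nat \<Rightarrow> nat \<Rightarrow> nat \<Rightarrow> real \<Rightarrow> (nat \<Rightarrow> nat \<Rightarrow> nat) set" where
  "Delta_sym R \<mu> \<Xi> n N m \<delta> =
    {s \<in> PiE {..<n} (\<lambda>_. perms N). (\<lambda>i\<in>{..<n}. act (s i) (xi_vec \<Xi> i N)) \<in> Delta_R R \<mu> n N m \<delta>}"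

text \<open>I_sym(mu); gamma^{(x)n}(Delta) = card Delta / (N!)^n. The limit over m -> infinity,
  delta -> 0 is monotone (Delta_sym shrinks), hence equals the infimum.\<close>
definition Isym :: "real \<Rightarrow> nat \<Rightarrow> (nat \<Rightarrow> real) measure \<Rightarrow> (nat \<Rightarrow> nat \<Rightarrow> nat \<Rightarrow> real) \<Rightarrow> ereal" where
  "Isym R n \<mu> \<Xi> =
    - (INF m. INF \<delta>\<in>{0<..}.
         limsup (\<lambda>N. ereal (1 / real N) *
           elog (real (card (Delta_sym R \<mu> \<Xi> n N m \<delta>)) / (fact N) ^ n)))"

definition Psym :: "nat \<Rightarrow> (nat \<Rightarrow> nat \<Rightarrow> nat \<Rightarrow> real) \<Rightarrow> ((nat \<Rightarrow> real) \<Rightarrow> real) \<Rightarrow> ereal" where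
  "Psym n \<Xi> h =
    limsup (\<lambda>N. ereal (1 / real N) *
      elog ((\<Sum>s\<in>PiE {..<n} (\<lambda>_. perms N).
               exp (\<Sum>j<N. h (\<lambda>i\<in>{..<n}. act (s i) (xi_vec \<Xi> i N) j))) / (fact N) ^ n))"

definition Isym_cal :: "real \<Rightarrow> nat \<Rightarrow> (nat \<Rightarrow> real) measure \<Rightarrow> (nat \<Rightarrow> nat \<Rightarrow> nat \<Rightarrow> real) \<Rightarrow> ereal" where
  "Isym_cal R n \<mu> \<Xi> =
    (SUP h\<in>{h. continuous_on (cube R n) h}.
       ereal (LINT x:cube R n|\<mu>. h x) - Psym n \<Xi> h)"

end

theory Submission
  imports Defs "HOL-Real_Asymp.Real_Asymp"
begin

text \<open>
  Let \<open>\<nu>\<close> be the product of the marginals of \<open>\<mu>\<close> and \<open>S = S(\<mu> \<parallel> \<nu>)\<close>. The proof closes the cycle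
  \<open>S \<le> \<I>\<^sub>s\<^sub>y\<^sub>m(\<mu>) \<le> I\<^sub>s\<^sub>y\<^sub>m(\<mu>) \<le> S\<close>.

  \<^item> After rounding coordinates to a finite grid, averaging over permutations is dominated, up to a
    polynomial factor, by averaging over all maps \<open>[N] \<rightarrow> [N]\<close>, where the sum factorises. Hence
    \<open>P\<^sub>s\<^sub>y\<^sub>m(h) \<le> ln \<nu>(exp h)\<close>, and the Donsker-Varadhan formula gives the first inequality.
  \<^item> On \<open>\<Delta>\<^sub>s\<^sub>y\<^sub>m\<close> the empirical mean of \<open>h\<close> is close to \<open>\<mu>(h)\<close> by Stone-Weierstrass; this gives the second.
  \<^item> For the set \<open>\<Gamma>\<close> of samples with almost the moments of \<open>\<mu>\<close>, \<open>\<mu>\<^sup>N(\<Gamma>) \<rightarrow> 1\<close> and the entropy inequality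
    with test function \<open>t 1\<^sub>\<Gamma>\<close> bounds \<open>\<nu>\<^sup>N(\<Gamma>)\<close> below by \<open>exp(-N(S + o(1)))\<close>. Since \<open>\<nu>\<^sup>N\<close> is invariant
    under independent permutations of the coordinates, some sample has at least that proportion of
    its rearrangements in \<open>\<Gamma>\<close>, and once sorted it is close to the approximating sequence.

  The entropy identity is the chain rule for densities; if some \<open>H(\<mu>\<^sub>i) = -\<infinity>\<close>, comparison with the uniform
  law on the cube and the data processing inequality force \<open>H(\<mu>) = -\<infinity>\<close>.
\<close>

subsection \<open>Permutations versus arbitrary maps\<close>

text \<open>Closing a cycle of one-sided estimates avoids showing that limits of microstate
  proportions exist. The obstacle is that the entries of a random permutation are dependent. For the
  upper bound this costs a factor polynomial in \<open>N\<close>, provided the grid is fixed before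
  \<open>N\<close> grows, since its number of points controls the degree. For the lower bound the
  approximating vectors are deterministic and need not resemble a sample position by position; they
  become comparable because a sorted bounded vector is determined, up to a small mean error, by
  finitely many of its moments. The entropy inequality for a single event replaces a law of large
  numbers for \<open>ln f\<close>, so that integrability of \<open>ln f\<close> is enough, and its
  error \<open>ln 2\<close> does not grow with \<open>N\<close>. Finally, \<open>Isym_cal\<close> is
  a supremum over continuous functions, whereas relative entropy is recovered from the test function
  \<open>ln f\<close>; the Gibbs bounds are therefore first extended to bounded measurable functions
  and then applied to truncations of \<open>ln f\<close>.\<close>

lemma fact_ge_exp: "(real N / exp 1) ^ N \<le> fact N"
proof -
  have "(\<Sum>k\<in>{N}. real N ^ k /\<^sub>R fact k) \<le> (\<Sum>k. real N ^ k /\<^sub>R fact k)"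
    by (rule sum_le_suminf[OF summable_exp_generic]) auto
  then have "real N ^ N / fact N \<le> exp (real N)"
    by (simp add: exp_def divide_inverse mult.commute)
  also have "exp (real N) = exp 1 ^ N"
    by (simp flip: exp_of_nat_mult)
  finally show ?thesis
    by (simp add: power_divide field_simps)
qed

text \<open>The induction step is \<open>exp 1 \<le> (b / a) ^ b\<close> for
  \<open>a = N + 1\<close> and \<open>b = N + 2\<close>, which comes from
  \<open>ln (a / b) \<le> a / b - 1\<close>.\<close>

lemma fact_le_exp_aux: "fact (Suc N) \<le> exp 1 * real (Suc N) * (real (Suc N) / exp 1) ^ Suc N"
proof (induction N)
  case (Suc N)
  let ?a = "real (Suc N)" and ?b = "real (Suc (Suc N))"
  have "ln (?a / ?b) \<le> ?a / ?b - 1"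
    by (intro ln_le_minus_one) auto
  then have "ln (?a / ?b) \<le> - (1 / ?b)"
    by (simp add: field_simps)
  then have "?b * ln (?a / ?b) \<le> - 1"
    using mult_left_mono[of "ln (?a / ?b)" "- (1 / ?b)" ?b] by simp
  then have "exp (1 + ?b * ln (?a / ?b)) \<le> 1" by simp
  moreover have "exp (1 + ?b * ln (?a / ?b)) = exp 1 * (?a / ?b) ^ Suc (Suc N)"
    unfolding exp_add exp_of_nat_mult by simp
  ultimately have "exp 1 * (?a / ?b) ^ Suc (Suc N) \<le> 1" by argo
  then have 1: "exp 1 * ?a ^ Suc (Suc N) \<le> ?b ^ Suc (Suc N)"
    unfolding power_divide by (simp add: divide_le_eq del: power_Suc of_nat_Suc)
  have "fact (Suc (Suc N)) \<le> ?b * (exp 1 * ?a * (?a / exp 1) ^ Suc N)"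
    using Suc.IH by (simp only: fact_Suc[of "Suc N"] of_nat_mult mult_left_mono of_nat_0_le_iff)
  also have "\<dots> = ?b * (exp 1 * ?a ^ Suc (Suc N)) / exp 1 ^ Suc N"
    by (simp add: power_divide)
  also have "\<dots> \<le> ?b * ?b ^ Suc (Suc N) / exp 1 ^ Suc N"
    using 1 by (intro divide_right_mono mult_left_mono) auto
  also have "\<dots> = exp 1 * ?b * (?b / exp 1) ^ Suc (Suc N)"
    by (simp add: power_divide)
  finally show ?case .
qed simp

lemma fact_le_exp: "fact N \<le> exp 1 * real (N + 1) * (real N / exp 1) ^ N"
proof (cases N)
  case (Suc M)
  have "fact N \<le> exp 1 * real N * (real N / exp 1) ^ N"
    using fact_le_exp_aux[of M] Suc by simp
  also have "\<dots> \<le> exp 1 * real (N + 1) * (real N / exp 1) ^ N"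
    by (intro mult_right_mono mult_left_mono) auto
  finally show ?thesis .
qed simp

lemma card_perms: "card (perms N) = fact N"
  unfolding perms_def using card_permutations[of "{..<N}" N] by simp

lemma finite_perms [simp]: "finite (perms N)"
  unfolding perms_def by (rule finite_permutations) simp

text \<open>A colour-preserving permutation is determined by its restrictions to the colour classes.
  Each restriction is extended by the identity, so that it becomes a genuine permutation of its
  class.\<close>

lemma card_stabilizer_le:
  fixes c :: "nat \<Rightarrow> 'b"
  assumes B: "finite B" "c ` {..<N} \<subseteq> B"
  shows "card {\<tau>\<in>perms N. \<forall>k<N. c (\<tau> k) = c k} \<le> (\<Prod>b\<in>B. fact (card {k. k < N \<and> c k = b}))"
proof -
  let ?K = "\<lambda>b. {k. k < N \<and> c k = b}"
  let ?S = "{\<tau>\<in>perms N. \<forall>k<N. c (\<tau> k) = c k}"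
  let ?T = "PiE B (\<lambda>b. {\<tau>. \<tau> permutes ?K b})"
  define \<Phi> where "\<Phi> \<tau> = (\<lambda>b\<in>B. \<lambda>k. if k \<in> ?K b then \<tau> k else k)" for \<tau> :: "nat \<Rightarrow> nat"
  have "inj_on \<Phi> ?S"
  proof (rule inj_onI)
    fix s t assume st: "s \<in> ?S" "t \<in> ?S" and eq: "\<Phi> s = \<Phi> t"
    show "s = t"
    proof
      fix k
      show "s k = t k"
      proof (cases "k < N")
        case True
        have "\<Phi> s (c k) k = \<Phi> t (c k) k" using eq by simp
        then show ?thesis using True B by (auto simp: \<Phi>_def)
      next
        case False
        with st show ?thesis by (auto simp: perms_def permutes_def)
      qed
    qed
  qed
  moreover have "\<Phi> ` ?S \<subseteq> ?T"
  proof (rule image_subsetI)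
    fix s assume "s \<in> ?S"
    then have s: "s \<in> perms N" "\<forall>k<N. c (s k) = c k" by auto
    then have p: "s permutes {..<N}" by (simp add: perms_def)
    have "(\<lambda>k. if k \<in> ?K b then s k else k) permutes ?K b" for b
    proof (rule bij_imp_permutes)
      have sK: "s ` ?K b \<subseteq> ?K b"
        using s permutes_in_image[OF p] by auto
      have "bij_betw s (?K b) (?K b)"
        unfolding bij_betw_def
        using sK permutes_inj_on[OF p] endo_inj_surj[of "?K b" s] by auto
      then show "bij_betw (\<lambda>k. if k \<in> ?K b then s k else k) (?K b) (?K b)"
        by (rule bij_betw_cong[THEN iffD1, rotated]) auto
    qed auto
    then show "\<Phi> s \<in> ?T"
      unfolding \<Phi>_def restrict_PiE_iff by simp
  qed
  moreover have "finite ?T"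
    by (intro finite_PiE B finite_permutations) auto
  ultimately have "card ?S \<le> card ?T"
    by (rule card_inj_on_le)
  also have "card ?T = (\<Prod>b\<in>B. fact (card (?K b)))"
    using B by (subst card_PiE) (auto intro!: prod.cong card_permutations)
  finally show ?thesis .
qed

text \<open>A colour pattern with \<open>N\<^sub>b\<close> points of colour \<open>b\<close> is realised by \<open>\<Prod> N\<^sub>b!\<close> of the \<open>N!\<close> permutations and
  by \<open>\<Prod> N\<^sub>b ^ N\<^sub>b\<close> of the \<open>N ^ N\<close> maps, and \<open>m!\<close> equals \<open>(m / e) ^ m\<close> up to a polynomial factor.\<close>

lemma card_perms_type_le:
  fixes c t :: "nat \<Rightarrow> 'b"
  assumes B: "finite B" "c ` {..<N} \<subseteq> B" "card B \<le> K"
  shows "real (card {\<sigma>\<in>perms N. \<forall>j<N. c (inv \<sigma> j) = t j}) * real N ^ N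
     \<le> fact N * (exp 1 * real (N + 1)) ^ K
        * real (card {f\<in>{..<N} \<rightarrow>\<^sub>E {..<N}. \<forall>j<N. c (f j) = t j})"
    (is "real (card ?S) * _ \<le> _ * real (card ?F)")
proof (cases "?S = {}")
  case False
  then obtain s where s: "s \<in> perms N" "\<forall>j<N. c (inv s j) = t j" by auto
  then have p: "s permutes {..<N}" by (simp add: perms_def)
  then have pi: "inv s permutes {..<N}" by (rule permutes_inv)
  let ?K = "\<lambda>b. {k. k < N \<and> c k = b}"
  let ?n = "\<lambda>b. card (?K b)"
  \<comment> \<open>Relative to one fixed realisation \<open>s\<close>, another realisation \<sigma>
    is recorded by \<open>inv \<sigma> \<circ> s\<close>, which preserves all colours.\<close>
  have "card ?S \<le> card {\<tau>\<in>perms N. \<forall>k<N. c (\<tau> k) = c k}"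
  proof (rule card_inj_on_le[where f = "\<lambda>\<sigma>. inv \<sigma> \<circ> s"])
    show "inj_on (\<lambda>\<sigma>. inv \<sigma> \<circ> s) ?S"
    proof (rule inj_onI)
      fix x y assume xy: "x \<in> ?S" "y \<in> ?S" and eq: "inv x \<circ> s = inv y \<circ> s"
      have "(inv x \<circ> s) \<circ> inv s = (inv y \<circ> s) \<circ> inv s" by (simp only: eq)
      then have "inv x = inv y"
        by (simp only: comp_assoc permutes_inv_o(1)[OF p] comp_id)
      have "x permutes {..<N}" "y permutes {..<N}"
        using xy by (auto simp only: perms_def mem_Collect_eq)
      then show "x = y"
        using \<open>inv x = inv y\<close> permutes_inv_inv by metis
    qed
    show "(\<lambda>\<sigma>. inv \<sigma> \<circ> s) ` ?S \<subseteq> {\<tau> \<in> perms N. \<forall>k<N. c (\<tau> k) = c k}"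
    proof (intro image_subsetI CollectI conjI allI impI)
      fix x assume "x \<in> ?S"
      then have x: "x permutes {..<N}" "\<forall>j<N. c (inv x j) = t j" by (auto simp: perms_def)
      show "inv x \<circ> s \<in> perms N"
        unfolding perms_def using permutes_compose[OF p permutes_inv[OF x(1)]] by simp
      fix k assume k: "k < N"
      then have "s k < N" using permutes_in_image[OF p, of k] by simp
      then show "c ((inv x \<circ> s) k) = c k"
        using x(2)[rule_format, of "s k"] s(2)[rule_format, of "s k"] permutes_inverses(2)[OF p, of k] by simp
    qed
  qed simp
  also have "\<dots> \<le> (\<Prod>b\<in>B. fact (?n b))" by (rule card_stabilizer_le[OF B(1,2)])
  finally have "real (card ?S) \<le> real (\<Prod>b\<in>B. fact (?n b))" by (rule of_nat_mono)
  then have S: "real (card ?S) \<le> (\<Prod>b\<in>B. fact (?n b))"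
    unfolding of_nat_prod of_nat_fact .
  have "?F = PiE {..<N} (\<lambda>j. ?K (t j))"
    by (simp only: set_eq_iff PiE_iff mem_Collect_eq lessThan_iff Ball_def) blast
  then have "card ?F = (\<Prod>j<N. ?n (t j))" by (simp add: card_PiE)
  \<comment> \<open>The pattern \<open>t\<close> is a rearrangement of \<open>c\<close>, so only the
    class sizes of \<open>c\<close> matter.\<close>
  also have "\<dots> = (\<Prod>j<N. ?n (c (inv s j)))" using s by simp
  also have "\<dots> = (\<Prod>j<N. ?n (c j))"
    using prod.permute[OF pi, of "\<lambda>j. ?n (c j)"] by (simp add: o_def)
  also have "\<dots> = (\<Prod>b\<in>B. \<Prod>j\<in>{j\<in>{..<N}. c j = b}. ?n (c j))"
    using B by (intro prod.group[symmetric]) auto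
  also have "\<dots> = (\<Prod>b\<in>B. ?n b ^ ?n b)"
    by (intro prod.cong) (auto simp: lessThan_def)
  finally have F: "real (card ?F) = (\<Prod>b\<in>B. real (?n b) ^ ?n b)" by simp
  have "(\<Sum>b\<in>B. ?n b) = card (\<Union>b\<in>B. ?K b)"
    using B by (intro card_UN_disjoint[symmetric]) auto
  also have "(\<Union>b\<in>B. ?K b) = {..<N}" using B by auto
  finally have sum: "(\<Sum>b\<in>B. ?n b) = N" by simp
  have n_le: "?n b \<le> N" for b
    using card_mono[of "{..<N}" "?K b"] by auto
  have "real (card ?S) * real N ^ N \<le> (\<Prod>b\<in>B. fact (?n b)) * real N ^ N"
    using S by (intro mult_right_mono) auto
  also have "\<dots> \<le> (\<Prod>b\<in>B. (exp 1 * real (N + 1)) * (real (?n b) / exp 1) ^ ?n b) * real N ^ N"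
  proof (intro mult_right_mono prod_mono conjI)
    fix b
    have "fact (?n b) \<le> exp 1 * real (?n b + 1) * (real (?n b) / exp 1) ^ ?n b"
      by (rule fact_le_exp)
    also have "\<dots> \<le> exp 1 * real (N + 1) * (real (?n b) / exp 1) ^ ?n b"
      using n_le[of b] by (intro mult_right_mono mult_left_mono) auto
    finally show "fact (?n b) \<le> exp 1 * real (N + 1) * (real (?n b) / exp 1) ^ ?n b" .
  qed auto
  \<comment> \<open>The class sizes add up to \<open>N\<close>, so the powers of
    \<open>exp 1\<close> collect into \<open>exp 1 ^ N\<close>; with \<open>real N ^ N\<close> this
    is the quantity that \<open>fact_ge_exp\<close> bounds by \<open>fact N\<close>.\<close>
  also have "\<dots> = (exp 1 * real (N + 1)) ^ card B * real (card ?F) * (real N ^ N / exp 1 ^ (\<Sum>b\<in>B. ?n b))"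
    unfolding F by (simp add: prod.distrib power_divide prod_dividef power_sum)
  also have "\<dots> = (real N / exp 1) ^ N * (exp 1 * real (N + 1)) ^ card B * real (card ?F)"
    unfolding sum by (simp add: power_divide)
  also have "\<dots> \<le> fact N * (exp 1 * real (N + 1)) ^ K * real (card ?F)"
  proof (intro mult_right_mono mult_mono fact_ge_exp power_increasing B)
    have "1 * 1 \<le> exp 1 * real (N + 1)" by (intro mult_mono) auto
    then show "1 \<le> exp 1 * real (N + 1)" by simp
  qed auto
  finally show ?thesis .
next
  case True
  show ?thesis unfolding True by simp
qed

text \<open>The summand depends on the colour pattern alone, so both sums are grouped by pattern and
  compared fibre by fibre, with one factor for each coordinate \<open>i\<close>.\<close>

lemma sum_perms_le_sum_functions:
  fixes c :: "nat \<Rightarrow> nat \<Rightarrow> 'b" and G :: "(nat \<Rightarrow> nat \<Rightarrow> 'b) \<Rightarrow> real"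
  assumes B: "finite B" "\<And>i. i < n \<Longrightarrow> c i ` {..<N} \<subseteq> B" "card B \<le> K" and G: "\<And>t. 0 \<le> G t"
  shows "(\<Sum>s\<in>PiE {..<n} (\<lambda>_. perms N). G (\<lambda>i\<in>{..<n}. \<lambda>j\<in>{..<N}. c i (inv (s i) j))) * (real N ^ N) ^ n
    \<le> (fact N * (exp 1 * real (N + 1)) ^ K) ^ n *
       (\<Sum>f\<in>PiE {..<n} (\<lambda>_. {..<N} \<rightarrow>\<^sub>E {..<N}). G (\<lambda>i\<in>{..<n}. \<lambda>j\<in>{..<N}. c i (f i j)))"
proof -
  let ?P = "PiE {..<n} (\<lambda>_. perms N)" and ?Q = "PiE {..<n} (\<lambda>_. {..<N} \<rightarrow>\<^sub>E {..<N})"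
  define \<Phi> where "\<Phi> s = (\<lambda>i\<in>{..<n}. \<lambda>j\<in>{..<N}. c i (inv (s i) j))" for s
  define \<Psi> where "\<Psi> f = (\<lambda>i\<in>{..<n}. \<lambda>j\<in>{..<N}. c i (f i j))" for f
  define C where "C = fact N * (exp 1 * real (N + 1)) ^ K"
  have fP: "finite ?P" and fQ: "finite ?Q"
    by (auto intro!: finite_PiE)
  define T where "T = \<Phi> ` ?P \<union> \<Psi> ` ?Q"
  have fT: "finite T" using fP fQ by (simp add: T_def)
  have le: "real (card {s\<in>?P. \<Phi> s = t}) * (real N ^ N) ^ n \<le> C ^ n * real (card {f\<in>?Q. \<Psi> f = t})"
    if t: "t \<in> T" for t
  proof -
    \<comment> \<open>Patterns in \<open>T\<close> are \<open>undefined\<close> off the index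
      ranges, so equality with \<open>t\<close> is a condition on \<open>i < n\<close> and
      \<open>j < N\<close> only. This makes the fibres products over \<open>i\<close>.\<close>
    have t_ext: "t i j = undefined" if "i < n" "\<not> j < N" for i j
      using t that by (auto simp: T_def \<Phi>_def \<Psi>_def)
    have t_ext': "t i = undefined" if "\<not> i < n" for i
      using t that by (auto simp: T_def \<Phi>_def \<Psi>_def)
    have \<Phi>_iff: "\<Phi> s = t \<longleftrightarrow> (\<forall>i<n. \<forall>j<N. c i (inv (s i) j) = t i j)" for s
    proof
      assume *: "\<forall>i<n. \<forall>j<N. c i (inv (s i) j) = t i j"
      show "\<Phi> s = t"
        unfolding \<Phi>_def by (intro ext) (auto simp: * t_ext t_ext' restrict_def)
    qed (auto simp: \<Phi>_def)
    have \<Psi>_iff: "\<Psi> s = t \<longleftrightarrow> (\<forall>i<n. \<forall>j<N. c i (s i j) = t i j)" for s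
    proof
      assume *: "\<forall>i<n. \<forall>j<N. c i (s i j) = t i j"
      show "\<Psi> s = t"
        unfolding \<Psi>_def by (intro ext) (auto simp: * t_ext t_ext' restrict_def)
    qed (auto simp: \<Psi>_def)
    have eq1: "{s\<in>?P. \<Phi> s = t} = PiE {..<n} (\<lambda>i. {\<sigma>\<in>perms N. \<forall>j<N. c i (inv \<sigma> j) = t i j})"
      unfolding \<Phi>_iff by (simp add: set_eq_iff PiE_iff) blast
    have eq2: "{f\<in>?Q. \<Psi> f = t} = PiE {..<n} (\<lambda>i. {f\<in>{..<N} \<rightarrow>\<^sub>E {..<N}. \<forall>j<N. c i (f j) = t i j})"
      unfolding \<Psi>_iff by (simp only: set_eq_iff PiE_iff mem_Collect_eq lessThan_iff) blast
    have "real (card {s\<in>?P. \<Phi> s = t}) * (real N ^ N) ^ n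
      = (\<Prod>i<n. real (card {\<sigma>\<in>perms N. \<forall>j<N. c i (inv \<sigma> j) = t i j}) * real N ^ N)"
      unfolding eq1 by (simp add: card_PiE prod.distrib)
    also have "\<dots> \<le> (\<Prod>i<n. C * real (card {f\<in>{..<N} \<rightarrow>\<^sub>E {..<N}. \<forall>j<N. c i (f j) = t i j}))"
      unfolding C_def by (intro prod_mono conjI card_perms_type_le[OF B(1)] B) auto
    also have "\<dots> = C ^ n * real (card {f\<in>?Q. \<Psi> f = t})"
      unfolding eq2 by (simp add: card_PiE prod.distrib)
    finally show ?thesis .
  qed
  have "(\<Sum>s\<in>?P. G (\<Phi> s)) * (real N ^ N) ^ n = (\<Sum>t\<in>T. \<Sum>s\<in>{s\<in>?P. \<Phi> s = t}. G (\<Phi> s)) * (real N ^ N) ^ n"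
    using fP fT by (subst sum.group) (auto simp: T_def)
  also have "\<dots> = (\<Sum>t\<in>T. G t * (real (card {s\<in>?P. \<Phi> s = t}) * (real N ^ N) ^ n))"
    unfolding sum_distrib_right by (intro sum.cong) auto
  also have "\<dots> \<le> (\<Sum>t\<in>T. G t * (C ^ n * real (card {f\<in>?Q. \<Psi> f = t})))"
    by (intro sum_mono mult_left_mono le G)
  also have "\<dots> = C ^ n * (\<Sum>t\<in>T. \<Sum>f\<in>{f\<in>?Q. \<Psi> f = t}. G (\<Psi> f))"
    unfolding sum_distrib_left by (intro sum.cong) (auto simp: sum_distrib_left)
  also have "\<dots> = C ^ n * (\<Sum>f\<in>?Q. G (\<Psi> f))"
    using fQ fT by (subst sum.group) (auto simp: T_def)
  finally show ?thesis unfolding \<Phi>_def \<Psi>_def C_def .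
qed

subsection \<open>Approximation by continuous functions\<close>

text \<open>One \<open>g\<close> serves all measures of the family at once: a Gibbs bound integrates
  \<open>h\<close> against one measure and \<open>exp h\<close> against another.\<close>

definition L1_cont_approx :: "'a::metric_space measure set \<Rightarrow> ('a \<Rightarrow> real) \<Rightarrow> bool" where
  "L1_cont_approx \<K> h \<longleftrightarrow> (\<forall>e>0. \<exists>g B. continuous_on UNIV g \<and> (\<forall>x. \<bar>g x\<bar> \<le> B) \<and>
     (\<forall>K\<in>\<K>. (\<integral>x. \<bar>h x - g x\<bar> \<partial>K) < e))"

lemma (in finite_measure) integrable_bounded:
  fixes f :: "'a \<Rightarrow> real"
  assumes "f \<in> borel_measurable M" "\<And>x. \<bar>f x\<bar> \<le> B"
  shows "integrable M f"
  using assms by (intro integrable_const_bound[of _ B]) auto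

locale finite_borel_measures =
  fixes \<K> :: "'a::metric_space measure set"
  assumes finite_\<K>: "finite \<K>" and finite_measure_\<K>: "\<And>K. K \<in> \<K> \<Longrightarrow> finite_measure K"
    and sets_\<K>: "\<And>K. K \<in> \<K> \<Longrightarrow> sets K = sets borel"
begin

text \<open>Bounded convergence; finiteness of \<K> yields one index \<open>n\<close> that works for
  every measure.\<close>

lemma approx_lim:
  assumes f: "\<And>n. f n \<in> borel_measurable borel" "\<And>n x. \<bar>f n x\<bar> \<le> B" "\<And>x. (\<lambda>n. f n x) \<longlonglongrightarrow> h x"
    and P: "\<And>n. L1_cont_approx \<K> (f n)"
  shows "L1_cont_approx \<K> h"
  unfolding L1_cont_approx_def
proof (intro allI impI)
  fix e :: real assume "e > 0"
  note [measurable] = f(1)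
  have [measurable]: "h \<in> borel_measurable borel"
    by (rule borel_measurable_LIMSEQ_real[OF f(3)]) auto
  have hB: "\<bar>h x\<bar> \<le> B" for x
    using f(2) by (intro tendsto_le[OF _ tendsto_const tendsto_rabs[OF f(3)]]) auto
  have B: "\<bar>f n x - h x\<bar> \<le> 2 * B" for n x using f(2)[of n x] hB[of x] by linarith
  have lim: "(\<lambda>n. \<bar>f n x - h x\<bar>) \<longlonglongrightarrow> 0" for x
    using tendsto_rabs[OF tendsto_diff[OF f(3)[of x] tendsto_const[of "h x"]]] by simp
  have "\<forall>\<^sub>F n in sequentially. (\<integral>x. \<bar>f n x - h x\<bar> \<partial>K) < e / 2" if K: "K \<in> \<K>" for K
  proof -
    interpret K: finite_measure K by (rule finite_measure_\<K>[OF K])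
    note [measurable_cong] = sets_\<K>[OF K]
    have "(\<lambda>n. \<integral>x. \<bar>f n x - h x\<bar> \<partial>K) \<longlonglongrightarrow> (\<integral>x. 0 \<partial>K)"
      using B lim by (intro integral_dominated_convergence[where w = "\<lambda>_. 2 * B"]) auto
    then show ?thesis using \<open>e > 0\<close> by (intro order_tendstoD) auto
  qed
  then have "\<forall>\<^sub>F n in sequentially. \<forall>K\<in>\<K>. (\<integral>x. \<bar>f n x - h x\<bar> \<partial>K) < e / 2"
    by (intro eventually_ball_finite finite_\<K>) auto
  then obtain n where n: "\<And>K. K \<in> \<K> \<Longrightarrow> (\<integral>x. \<bar>f n x - h x\<bar> \<partial>K) < e / 2"
    by (auto simp: eventually_sequentially)
  obtain g C where g: "continuous_on UNIV g" "\<And>x. \<bar>g x\<bar> \<le> C"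
    "\<And>K. K \<in> \<K> \<Longrightarrow> (\<integral>x. \<bar>f n x - g x\<bar> \<partial>K) < e / 2"
    using P[of n] \<open>e > 0\<close> unfolding L1_cont_approx_def by (meson half_gt_zero)
  have [measurable]: "g \<in> borel_measurable borel" by (rule borel_measurable_continuous_onI[OF g(1)])
  have b: "\<bar>f n x\<bar> \<le> B" "\<bar>h x\<bar> \<le> B" "\<bar>g x\<bar> \<le> C" for x using f(2) hB g(2) by auto
  have i1: "\<bar>\<bar>f n x - h x\<bar>\<bar> \<le> 2 * B" for x using b[of x] by linarith
  have i2: "\<bar>\<bar>f n x - g x\<bar>\<bar> \<le> B + C" "\<bar>\<bar>h x - g x\<bar>\<bar> \<le> B + C" for x using b[of x] by linarith+
  have "(\<integral>x. \<bar>h x - g x\<bar> \<partial>K) < e" if K: "K \<in> \<K>" for K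
  proof -
    interpret K: finite_measure K by (rule finite_measure_\<K>[OF K])
    note [measurable_cong] = sets_\<K>[OF K]
    have "(\<integral>x. \<bar>h x - g x\<bar> \<partial>K) \<le> (\<integral>x. \<bar>f n x - h x\<bar> + \<bar>f n x - g x\<bar> \<partial>K)"
      by (intro integral_mono Bochner_Integration.integrable_add K.integrable_bounded[OF _ i1]
          K.integrable_bounded[OF _ i2(1)] K.integrable_bounded[OF _ i2(2)]) auto
    also have "\<dots> = (\<integral>x. \<bar>f n x - h x\<bar> \<partial>K) + (\<integral>x. \<bar>f n x - g x\<bar> \<partial>K)"
      by (intro Bochner_Integration.integral_add K.integrable_bounded[OF _ i1] K.integrable_bounded[OF _ i2(1)]) auto
    finally show ?thesis using n[OF K] g(3)[OF K] by linarith
  qed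
  then show "\<exists>g B. continuous_on UNIV g \<and> (\<forall>x. \<bar>g x\<bar> \<le> B) \<and> (\<forall>K\<in>\<K>. (\<integral>x. \<bar>h x - g x\<bar> \<partial>K) < e)"
    using g by blast
qed

lemma approx_continuous:
  assumes "continuous_on UNIV g" "\<And>x. \<bar>g x\<bar> \<le> B"
  shows "L1_cont_approx \<K> g"
  unfolding L1_cont_approx_def using assms
  by (intro allI impI exI[of _ g] exI[of _ B]) auto

lemma approx_add:
  assumes m[measurable]: "u \<in> borel_measurable borel" "v \<in> borel_measurable borel"
    and bd: "\<And>x. \<bar>u x\<bar> \<le> A" "\<And>x. \<bar>v x\<bar> \<le> B"
    and P: "L1_cont_approx \<K> u" "L1_cont_approx \<K> v"
  shows "L1_cont_approx \<K> (\<lambda>x. a * u x + b * v x)"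
  unfolding L1_cont_approx_def
proof (intro allI impI)
  fix e :: real assume e: "e > 0"
  \<comment> \<open>The summand 1 makes \<open>k\<close> positive and leaves
    \<open>(\<bar>a\<bar> + \<bar>b\<bar>) * e / k\<close> strictly below \<open>e\<close>.\<close>
  define k where "k = \<bar>a\<bar> + \<bar>b\<bar> + 1"
  have k: "k > 0" by (simp add: k_def)
  obtain g C where g: "continuous_on UNIV g" "\<And>x. \<bar>g x\<bar> \<le> C" "\<And>K. K \<in> \<K> \<Longrightarrow> (\<integral>x. \<bar>u x - g x\<bar> \<partial>K) < e / k"
    using P(1) e k unfolding L1_cont_approx_def by (meson divide_pos_pos)
  obtain g' C' where g': "continuous_on UNIV g'" "\<And>x. \<bar>g' x\<bar> \<le> C'" "\<And>K. K \<in> \<K> \<Longrightarrow> (\<integral>x. \<bar>v x - g' x\<bar> \<partial>K) < e / k"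
    using P(2) e k unfolding L1_cont_approx_def by (meson divide_pos_pos)
  have [measurable]: "g \<in> borel_measurable borel" "g' \<in> borel_measurable borel"
    by (auto intro: borel_measurable_continuous_onI g g')
  have bb: "\<bar>\<bar>u x - g x\<bar>\<bar> \<le> A + C" "\<bar>\<bar>v x - g' x\<bar>\<bar> \<le> B + C'" for x
    using bd[of x] g(2)[of x] g'(2)[of x] by linarith+
  let ?w = "\<lambda>x. \<bar>(a * u x + b * v x) - (a * g x + b * g' x)\<bar>"
  have pw: "?w x \<le> \<bar>a\<bar> * \<bar>u x - g x\<bar> + \<bar>b\<bar> * \<bar>v x - g' x\<bar>" for x
  proof -
    have "(a * u x + b * v x) - (a * g x + b * g' x) = a * (u x - g x) + b * (v x - g' x)"
      by (simp add: algebra_simps)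
    then show ?thesis using abs_triangle_ineq[of "a * (u x - g x)" "b * (v x - g' x)"] by (simp add: abs_mult)
  qed
  have "(\<integral>x. ?w x \<partial>K) < e" if K: "K \<in> \<K>" for K
  proof -
    interpret K: finite_measure K by (rule finite_measure_\<K>[OF K])
    note [measurable_cong] = sets_\<K>[OF K]
    have i: "integrable K (\<lambda>x. \<bar>u x - g x\<bar>)" "integrable K (\<lambda>x. \<bar>v x - g' x\<bar>)"
      by (rule K.integrable_bounded[OF _ bb(1)] K.integrable_bounded[OF _ bb(2)]; simp)+
    have "(\<integral>x. ?w x \<partial>K) \<le> (\<integral>x. \<bar>a\<bar> * \<bar>u x - g x\<bar> + \<bar>b\<bar> * \<bar>v x - g' x\<bar> \<partial>K)"
      using i pw by (intro integral_mono' Bochner_Integration.integrable_add integrable_mult_right) auto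
    also have "\<dots> = \<bar>a\<bar> * (\<integral>x. \<bar>u x - g x\<bar> \<partial>K) + \<bar>b\<bar> * (\<integral>x. \<bar>v x - g' x\<bar> \<partial>K)" using i by simp
    also have "\<dots> \<le> \<bar>a\<bar> * (e / k) + \<bar>b\<bar> * (e / k)"
      using g(3)[OF K] g'(3)[OF K] by (intro add_mono mult_left_mono) auto
    also have "\<dots> = (\<bar>a\<bar> + \<bar>b\<bar>) * e / k" by (simp add: distrib_right add_divide_distrib)
    also have "\<dots> < e" using k e by (simp add: k_def field_simps)
    finally show ?thesis .
  qed
  moreover have "continuous_on UNIV (\<lambda>x. a * g x + b * g' x)"
    by (intro continuous_intros g g')
  moreover have "\<bar>a * g x + b * g' x\<bar> \<le> \<bar>a\<bar> * C + \<bar>b\<bar> * C'" for x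
  proof -
    have "\<bar>a * g x + b * g' x\<bar> \<le> \<bar>a\<bar> * \<bar>g x\<bar> + \<bar>b\<bar> * \<bar>g' x\<bar>"
      using abs_triangle_ineq[of "a * g x" "b * g' x"] by (simp add: abs_mult)
    also have "\<dots> \<le> \<bar>a\<bar> * C + \<bar>b\<bar> * C'" using g(2) g'(2) by (intro add_mono mult_left_mono) auto
    finally show ?thesis .
  qed
  ultimately show "\<exists>w B. continuous_on UNIV w \<and> (\<forall>x. \<bar>w x\<bar> \<le> B) \<and>
     (\<forall>K\<in>\<K>. (\<integral>x. \<bar>a * u x + b * v x - w x\<bar> \<partial>K) < e)"
    by blast
qed

text \<open>For closed \<open>C\<close> the continuous cut-offs \<open>1 - n * infdist x C\<close>,
  truncated at 0, decrease to the indicator.\<close>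

lemma approx_closed:
  assumes "closed C" shows "L1_cont_approx \<K> (indicator C)"
\<comment> \<open>\<open>infdist\<close> to the empty set is 0, so the cut-offs would be constantly
  1 there.\<close>
proof (cases "C = {}")
  case True
  then show ?thesis
    using approx_continuous[of "\<lambda>_. 0" 0] by (simp add: indicator_def[abs_def])
next
  case False
  let ?f = "\<lambda>n x. max 0 (1 - real n * infdist x C)"
  have cont: "continuous_on UNIV (?f n)" for n by (intro continuous_intros)
  have bd: "\<bar>?f n x\<bar> \<le> 1" for n x by (auto simp: infdist_nonneg max_def)
  show ?thesis
  proof (rule approx_lim[of ?f 1])
    show "(\<lambda>n. ?f n x) \<longlonglongrightarrow> indicator C x" for x
    proof (cases "x \<in> C")
      case True
      then show ?thesis by simp
    next
      case F: False
      then have pos: "infdist x C > 0"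
        using assms False in_closed_iff_infdist_zero[of C x] infdist_nonneg[of x C] by force
      obtain n0 :: nat where n0: "real n0 * infdist x C > 1"
        using reals_Archimedean3[OF pos] by blast
      have "\<forall>\<^sub>F n in sequentially. ?f n x = 0"
        unfolding eventually_sequentially
      proof (intro exI allI impI)
        fix n assume "n0 \<le> n"
        then have "real n0 * infdist x C \<le> real n * infdist x C" using pos by simp
        with n0 show "?f n x = 0" by simp
      qed
      then show ?thesis using F by (simp add: tendsto_eventually)
    qed
  qed (use bd cont approx_continuous[OF cont bd] in \<open>auto intro!: borel_measurable_continuous_onI\<close>)
qed

text \<open>Dynkin induction: the closed sets form an intersection-stable generator, and
  \<open>approx_add\<close> and \<open>approx_lim\<close> supply complements and countable disjoint
  unions.\<close>

lemma approx_indicator: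
  assumes "A \<in> sets borel" shows "L1_cont_approx \<K> (indicator A)"
proof -
  have closed_stable: "Int_stable (Collect closed :: 'a set set)" by (auto simp: Int_stable_def)
  have closed_Pow: "(Collect closed :: 'a set set) \<subseteq> Pow UNIV" by simp
  have "A \<in> sigma_sets UNIV (Collect closed)" using assms by (simp add: borel_eq_closed)
  with closed_stable closed_Pow show ?thesis
  proof (induction rule: sigma_sets_induct_disjoint)
    case (basic A)
    then show ?case by (simp add: approx_closed)
  next
    case empty
    then show ?case by (intro approx_closed) simp
  next
    case (compl A)
    then have A[measurable]: "A \<in> sets borel" by (simp add: borel_eq_closed)
    have "L1_cont_approx \<K> (\<lambda>x. 1 * 1 + (-1) * indicator A x)"
      by (rule approx_add[of _ _ 1 1]) (auto intro!: approx_continuous[of _ 1] compl split: split_indicator)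
    also have "(\<lambda>x. 1 * 1 + (-1) * indicator A x) = (indicator (UNIV - A) :: _ \<Rightarrow> real)"
      by (auto simp: fun_eq_iff split: split_indicator)
    finally show ?case .
  next
    case (union A)
    then have A[measurable]: "A i \<in> sets borel" for i by (auto simp: borel_eq_closed)
    have *: "L1_cont_approx \<K> (indicator (\<Union>i<n. A i))" for n
    proof (induction n)
      case 0
      show ?case by (rule approx_closed) simp
    next
      case (Suc n)
      have "L1_cont_approx \<K> (\<lambda>x. 1 * indicator (\<Union>i<n. A i) x + 1 * indicator (A n) x)"
        by (rule approx_add[of _ _ 1 1]) (use Suc union in \<open>auto split: split_indicator\<close>)
      also have "(\<lambda>x. 1 * indicator (\<Union>i<n. A i) x + 1 * indicator (A n) x) = (indicator (\<Union>i<Suc n. A i) :: _ \<Rightarrow> real)"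
      proof
        fix x
        have "A i \<inter> A n = {}" if "i < n" for i
          using union.hyps(1) that by (intro disjoint_family_onD[of A UNIV]) auto
        then have "(\<Union>i<n. A i) \<inter> A n = {}" by blast
        then show "1 * indicator (\<Union>i<n. A i) x + 1 * indicator (A n) x = (indicator (\<Union>i<Suc n. A i) x :: real)"
          by (auto simp: lessThan_Suc indicator_def)
      qed
      finally show ?case .
    qed
    show ?case
    proof (rule approx_lim[OF _ _ _ *])
      show "(\<lambda>n. indicator (\<Union>i<n. A i) x :: real) \<longlonglongrightarrow> indicator (\<Union>i. A i) x" for x
        by (rule LIMSEQ_indicator_UN)
    qed (auto split: split_indicator)
  qed
qed

lemma approx_bounded_measurable_pos:
  assumes "h \<in> borel_measurable borel" "\<And>x. 0 \<le> h x" "\<And>x. h x \<le> B"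
  shows "L1_cont_approx \<K> h"
proof -
  \<comment> \<open>Boundedness is a premise inside the induction. By nonnegativity the functions
    met on the way inherit a bound, except for \<open>c = 0\<close> in a multiple
    \<open>c * u\<close>, where \<open>u\<close> may be unbounded.\<close>
  have "(\<exists>B. \<forall>x. h x \<le> B) \<longrightarrow> L1_cont_approx \<K> h" using assms(1,2)
  proof (induction rule: borel_measurable_induct_real)
    case (set A)
    then show ?case by (simp add: approx_indicator)
  next
    case (mult u c)
    show ?case
    proof (cases "c = 0")
      case True
      then show ?thesis using approx_continuous[of "\<lambda>_. 0" 0] by simp
    next
      case False
      show ?thesis
      proof
        assume "\<exists>B. \<forall>x. c * u x \<le> B"
        then obtain B where B: "c * u x \<le> B" for x by blast
        have u: "u x \<le> B / c" for x using B[of x] False mult(1) by (simp add: field_simps)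
        have "L1_cont_approx \<K> (\<lambda>x. c * u x + 0 * u x)"
          using u mult by (intro approx_add[of _ _ "B / c" "B / c"]) auto
        then show "L1_cont_approx \<K> (\<lambda>x. c * u x)" by simp
      qed
    qed
  next
    case (add u v)
    show ?case
    proof
      assume "\<exists>B. \<forall>x. v x + u x \<le> B"
      then obtain B where B: "v x + u x \<le> B" for x by blast
      have u: "\<bar>u x\<bar> \<le> B" "\<bar>v x\<bar> \<le> B" for x
        using B[of x] add.hyps(2)[of x] add.hyps(4)[of x] by linarith+
      then have "\<exists>B. \<forall>x. u x \<le> B" "\<exists>B. \<forall>x. v x \<le> B" by (meson abs_le_D1)+
      then have "L1_cont_approx \<K> (\<lambda>x. 1 * v x + 1 * u x)"
        using u add by (intro approx_add[of _ _ B B]) auto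
      then show "L1_cont_approx \<K> (\<lambda>x. v x + u x)" by simp
    qed
  next
    case (seq U)
    show ?case
    proof
      assume "\<exists>B. \<forall>x. h x \<le> B"
      then obtain B where B: "h x \<le> B" for x by blast
      have U: "U i x \<le> h x" for i x
        using seq.hyps by (intro incseq_le) (auto simp: incseq_def le_fun_def)
      then have "U i x \<le> B" for i x using B order_trans by blast
      moreover from this have "L1_cont_approx \<K> (U i)" for i using seq.IH by blast
      ultimately show "L1_cont_approx \<K> h"
        using seq.hyps by (intro approx_lim[of U B h]) auto
    qed
  qed
  then show ?thesis using assms(3) by blast
qed

lemma approx_bounded_measurable:
  assumes [measurable]: "h \<in> borel_measurable borel" and b: "\<And>x. \<bar>h x\<bar> \<le> B"
  shows "L1_cont_approx \<K> h"
proof -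
  have 1: "L1_cont_approx \<K> (\<lambda>x. h x + B)"
  proof (rule approx_bounded_measurable_pos[of _ "2 * B"])
    show "0 \<le> h x + B" "h x + B \<le> 2 * B" for x using b[of x] by linarith+
  qed simp
  have "B \<ge> 0" using order_trans[OF abs_ge_zero b] .
  have "L1_cont_approx \<K> (\<lambda>x. 1 * (h x + B) + (- B) * 1)"
  proof (rule approx_add[of _ _ "2 * B" 1])
    show "\<bar>h x + B\<bar> \<le> 2 * B" for x using b[of x] by linarith
  qed (use 1 in \<open>auto intro!: approx_continuous[of _ 1]\<close>)
  then show ?thesis by simp
qed

end

section \<open>Gibbs bounds: from continuous to measurable test functions\<close>

lemma abs_exp_diff_le:
  fixes a b :: real
  assumes "\<bar>a\<bar> \<le> B" "\<bar>b\<bar> \<le> B"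
  shows "\<bar>exp a - exp b\<bar> \<le> exp B * \<bar>a - b\<bar>"
proof -
  have *: "exp y - exp x \<le> exp B * (y - x)" if "x \<le> y" "y \<le> B" for x y :: real
  proof -
    have "exp y - exp x = exp y * (1 - exp (x - y))" by (simp add: exp_diff field_simps)
    also have "\<dots> \<le> exp y * (y - x)"
      using exp_ge_add_one_self[of "x - y"] by (intro mult_left_mono, linarith) simp
    also have "\<dots> \<le> exp B * (y - x)" using that by (intro mult_right_mono) auto
    finally show ?thesis .
  qed
  show ?thesis using *[of a b] *[of b a] assms
    by (cases "a \<le> b") (auto simp: abs_le_iff abs_of_nonneg abs_of_nonpos)
qed

text \<open>Needed because \<open>Isym_cal\<close> tests continuous functions only. Approximation in
  L1 of both measures is enough, since \<open>exp\<close> is Lipschitz on bounded intervals.\<close>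

lemma gibbs_bound_continuous_imp_measurable:
  fixes M N :: "'a::metric_space measure" and h :: "'a \<Rightarrow> real" and c :: real
  assumes M: "prob_space M" "sets M = sets borel" and N: "prob_space N" "sets N = sets borel"
    and c: "\<And>h B. continuous_on UNIV h \<Longrightarrow> (\<And>x. \<bar>h x\<bar> \<le> B) \<Longrightarrow> (\<integral>x. h x \<partial>M) - ln (\<integral>x. exp (h x) \<partial>N) \<le> c"
    and h[measurable]: "h \<in> borel_measurable borel" and hB: "\<And>x. \<bar>h x\<bar> \<le> B"
  shows "(\<integral>x. h x \<partial>M) - ln (\<integral>x. exp (h x) \<partial>N) \<le> c"
proof -
  interpret M: prob_space M by fact
  interpret N: prob_space N by fact
  interpret finite_borel_measures "{M, N}"
    using M.finite_measure_axioms N.finite_measure_axioms M(2) N(2)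
    by (intro finite_borel_measures.intro) (simp, blast, blast)
  note [measurable_cong] = M(2) N(2)
  have B0: "B \<ge> 0" using order_trans[OF abs_ge_zero hB] .
  have appr: "L1_cont_approx {M, N} h" by (rule approx_bounded_measurable[OF h hB])
  have "\<exists>g. continuous_on UNIV g \<and> (\<integral>x. \<bar>h x - g x\<bar> \<partial>M) < 1 / real (Suc k)
      \<and> (\<integral>x. \<bar>h x - g x\<bar> \<partial>N) < 1 / real (Suc k) \<and> (\<exists>C. \<forall>x. \<bar>g x\<bar> \<le> C)" for k
    using appr[unfolded L1_cont_approx_def, rule_format, of "1 / real (Suc k)"] by auto
  then obtain g0 where g0: "\<And>k. continuous_on UNIV (g0 k)" "\<And>k. \<exists>C. \<forall>x. \<bar>g0 k x\<bar> \<le> C"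
    "\<And>k. (\<integral>x. \<bar>h x - g0 k x\<bar> \<partial>M) < 1 / real (Suc k)" "\<And>k. (\<integral>x. \<bar>h x - g0 k x\<bar> \<partial>N) < 1 / real (Suc k)"
    by metis
  \<comment> \<open>Clipping to the interval from \<open>-B\<close> to \<open>B\<close>, which
    contains the values of \<open>h\<close>, moves \<open>g0 k\<close> no farther from
    \<open>h\<close> and bounds every \<open>exp (g k x)\<close> by \<open>exp B\<close>.\<close>
  define g where "g k x = max (-B) (min B (g0 k x))" for k x
  have gc: "continuous_on UNIV (g k)" for k
    unfolding g_def by (intro continuous_intros g0)
  have gB: "\<bar>g k x\<bar> \<le> B" for k x using B0 by (auto simp: g_def)
  have [measurable]: "g k \<in> borel_measurable borel" "g0 k \<in> borel_measurable borel" for k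
    by (auto intro: borel_measurable_continuous_onI gc g0)
  have le: "\<bar>h x - g k x\<bar> \<le> \<bar>h x - g0 k x\<bar>" for k x using hB[of x] by (auto simp: g_def)
  have i0M: "integrable M (\<lambda>x. \<bar>h x - g0 k x\<bar>)" and i0N: "integrable N (\<lambda>x. \<bar>h x - g0 k x\<bar>)" for k
  proof -
    obtain C where C: "\<And>x. \<bar>g0 k x\<bar> \<le> C" using g0(2) by blast
    have "\<bar>\<bar>h x - g0 k x\<bar>\<bar> \<le> B + C" for x using C[of x] hB[of x] by linarith
    then show "integrable M (\<lambda>x. \<bar>h x - g0 k x\<bar>)" "integrable N (\<lambda>x. \<bar>h x - g0 k x\<bar>)"
      by (auto intro!: M.integrable_bounded N.integrable_bounded)
  qed
  have bd: "\<bar>\<bar>h x - g k x\<bar>\<bar> \<le> 2 * B" for k x using hB[of x] gB[of k x] by linarith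
  have gM: "(\<integral>x. \<bar>h x - g k x\<bar> \<partial>M) \<le> 1 / real (Suc k)" and gN: "(\<integral>x. \<bar>h x - g k x\<bar> \<partial>N) \<le> 1 / real (Suc k)" for k
  proof -
    have "(\<integral>x. \<bar>h x - g k x\<bar> \<partial>M) \<le> (\<integral>x. \<bar>h x - g0 k x\<bar> \<partial>M)"
      by (intro integral_mono' le i0M) auto
    moreover have "(\<integral>x. \<bar>h x - g k x\<bar> \<partial>N) \<le> (\<integral>x. \<bar>h x - g0 k x\<bar> \<partial>N)"
      by (intro integral_mono' le i0N) auto
    ultimately show "(\<integral>x. \<bar>h x - g k x\<bar> \<partial>M) \<le> 1 / real (Suc k)" "(\<integral>x. \<bar>h x - g k x\<bar> \<partial>N) \<le> 1 / real (Suc k)"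
      using g0(3,4)[of k] by linarith+
  qed
  have lim0: "(\<lambda>k. C * (1 / real (Suc k))) \<longlonglongrightarrow> 0" for C :: real
    using tendsto_mult[OF tendsto_const[of C] LIMSEQ_Suc[OF lim_1_over_n]] by simp
  have iM: "integrable M h" "integrable M (g k)" for k
    by (rule M.integrable_bounded[OF _ hB] M.integrable_bounded[OF _ gB]; simp)+
  have eB: "\<bar>exp (h x)\<bar> \<le> exp B" "\<bar>exp (g k x)\<bar> \<le> exp B" for k x using hB[of x] gB[of k x] by auto
  have iN: "integrable N (\<lambda>x. exp (h x))" "integrable N (\<lambda>x. exp (g k x))" for k
    by (rule N.integrable_bounded[OF _ eB(1)] N.integrable_bounded[OF _ eB(2)]; simp)+
  have "(\<lambda>k. \<integral>x. g k x \<partial>M) \<longlonglongrightarrow> (\<integral>x. h x \<partial>M)"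
  proof (rule Lim_transform_bound[THEN LIM_zero_cancel, OF _ lim0[of 1]] )
    show "\<forall>\<^sub>F k in sequentially. norm ((\<integral>x. g k x \<partial>M) - (\<integral>x. h x \<partial>M)) \<le> norm (1 * (1 / real (Suc k)))"
    proof (intro always_eventually allI)
      fix k
      have "\<bar>(\<integral>x. g k x \<partial>M) - (\<integral>x. h x \<partial>M)\<bar> = \<bar>\<integral>x. h x - g k x \<partial>M\<bar>"
        using iM by simp
      also have "\<dots> \<le> (\<integral>x. \<bar>h x - g k x\<bar> \<partial>M)"
        using integral_norm_bound[of M "\<lambda>x. h x - g k x"] by simp
      also note gM[of k]
      finally show "norm ((\<integral>x. g k x \<partial>M) - (\<integral>x. h x \<partial>M)) \<le> norm (1 * (1 / real (Suc k)))" by simp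
    qed
  qed
  moreover have "(\<lambda>k. \<integral>x. exp (g k x) \<partial>N) \<longlonglongrightarrow> (\<integral>x. exp (h x) \<partial>N)"
  proof (rule Lim_transform_bound[THEN LIM_zero_cancel, OF _ lim0[of "exp B"]])
    show "\<forall>\<^sub>F k in sequentially. norm ((\<integral>x. exp (g k x) \<partial>N) - (\<integral>x. exp (h x) \<partial>N)) \<le> norm (exp B * (1 / real (Suc k)))"
    proof (intro always_eventually allI)
      fix k
      have "\<bar>(\<integral>x. exp (g k x) \<partial>N) - (\<integral>x. exp (h x) \<partial>N)\<bar> = \<bar>\<integral>x. exp (h x) - exp (g k x) \<partial>N\<bar>"
        using iN by simp
      also have "\<dots> \<le> (\<integral>x. \<bar>exp (h x) - exp (g k x)\<bar> \<partial>N)"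
        using integral_norm_bound[of N "\<lambda>x. exp (h x) - exp (g k x)"] by simp
      also have "\<dots> \<le> (\<integral>x. exp B * \<bar>h x - g k x\<bar> \<partial>N)"
        using hB gB by (intro integral_mono' integrable_mult_right N.integrable_bounded[OF _ bd] abs_exp_diff_le) auto
      also have "\<dots> \<le> exp B * (1 / real (Suc k))"
        using mult_left_mono[OF gN[of k], of "exp B"] by simp
      finally show "norm ((\<integral>x. exp (g k x) \<partial>N) - (\<integral>x. exp (h x) \<partial>N)) \<le> norm (exp B * (1 / real (Suc k)))" by simp
    qed
  qed
  \<comment> \<open>Positivity of the limit lets the convergence pass through
    \<open>ln\<close>.\<close>
  moreover have "(\<integral>x. exp (h x) \<partial>N) > 0"
  proof -
    have "(\<integral>x. exp (- B) \<partial>N) \<le> (\<integral>x. exp (h x) \<partial>N)"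
      using hB by (intro integral_mono iN) (auto simp: abs_le_iff minus_le_iff)
    moreover have "(\<integral>x. exp (- B) \<partial>N) = exp (- B)" by (simp add: N.prob_space)
    ultimately show ?thesis using exp_gt_zero[of "- B"] by linarith
  qed
  ultimately have "(\<lambda>k. (\<integral>x. g k x \<partial>M) - ln (\<integral>x. exp (g k x) \<partial>N)) \<longlonglongrightarrow> (\<integral>x. h x \<partial>M) - ln (\<integral>x. exp (h x) \<partial>N)"
    by (intro tendsto_intros) auto
  then show ?thesis
    by (rule LIMSEQ_le_const2) (use c[OF gc gB] in auto)
qed

subsection \<open>The Donsker-Varadhan formula\<close>

lemma mult_ln_ge: "0 \<le> (x::real) \<Longrightarrow> x - 1 \<le> x * ln x"
proof (cases "x = 0")
  case False
  assume "0 \<le> x"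
  with False have x: "x > 0" by simp
  have "ln (1 / x) \<le> 1 / x - 1" using x by (intro ln_le_minus_one) simp
  then have "- ln x \<le> 1 / x - 1" using x by (simp add: ln_div)
  then have "x * (- ln x) \<le> x * (1 / x - 1)" using x by (intro mult_left_mono) auto
  then show ?thesis using x by (simp add: algebra_simps)
qed simp

lemma prob_density_integral:
  fixes f :: "'a \<Rightarrow> real"
  assumes f: "f \<in> borel_measurable N" "\<And>x. 0 \<le> f x" and P: "prob_space (density N f)"
  shows "integrable N f" "(\<integral>x. f x \<partial>N) = 1"
proof -
  have "(\<integral>\<^sup>+x. ennreal (f x) \<partial>N) = 1"
    using prob_space.emeasure_space_1[OF P] f(1) by (simp add: emeasure_density cong: nn_integral_cong)
  then show "integrable N f" "(\<integral>x. f x \<partial>N) = 1"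
    using f by (auto intro!: integrableI_nn_integral_finite[of _ _ 1] simp: integral_eq_nn_integral)
qed

text \<open>With \<open>u = h - ln f - ln Z\<close>, the inequality \<open>1 + u \<le> exp u\<close>
  gives \<open>f * u \<le> exp h / Z - f\<close> where \<open>f > 0\<close>, and the right-hand side
  has integral 0. This is nonnegativity of the relative entropy with respect to the tilted density
  \<open>exp h / Z\<close>.\<close>

lemma donsker_varadhan_le:
  fixes f h :: "'a \<Rightarrow> real"
  assumes N: "prob_space N" and f[measurable]: "f \<in> borel_measurable N" "\<And>x. 0 \<le> f x"
    and P: "prob_space (density N f)" and ln: "integrable (density N f) (\<lambda>x. ln (f x))"
    and h[measurable]: "h \<in> borel_measurable N" and hB: "\<And>x. \<bar>h x\<bar> \<le> B"
  shows "(\<integral>x. h x \<partial>density N f) - ln (\<integral>x. exp (h x) \<partial>N) \<le> (\<integral>x. ln (f x) \<partial>density N f)"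
proof -
  interpret N: prob_space N by fact
  interpret M: prob_space "density N f" by fact
  let ?M = "density N f"
  have eB: "\<bar>exp (h x)\<bar> \<le> exp B" "exp (-B) \<le> exp (h x)" for x using hB[of x] by auto
  have iN: "integrable N (\<lambda>x. exp (h x))"
    using eB by (intro N.integrable_const_bound[of _ "exp B"]) auto
  define Z where "Z = (\<integral>x. exp (h x) \<partial>N)"
  have "(\<integral>x. exp (- B) \<partial>N) \<le> Z"
    unfolding Z_def using eB by (intro integral_mono iN) auto
  then have "exp (-B) \<le> Z" by (simp add: N.prob_space)
  then have Z: "Z > 0" using exp_gt_zero[of "-B"] by linarith
  have ih: "integrable ?M h"
    using hB by (intro M.integrable_const_bound[of _ B]) auto
  have fi: "integrable N f" "(\<integral>x. f x \<partial>N) = 1" by (rule prob_density_integral[OF f P])+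
  have fln: "integrable N (\<lambda>x. f x * (h x - ln (f x) - ln Z))"
  proof -
    have "integrable ?M (\<lambda>x. h x - ln (f x) - ln Z)"
      by (intro Bochner_Integration.integrable_diff ih ln) simp
    then show ?thesis using f(2) by (subst (asm) integrable_real_density) auto
  qed
  have "(\<integral>x. h x \<partial>?M) - (\<integral>x. ln (f x) \<partial>?M) - ln Z = (\<integral>x. h x - ln (f x) - ln Z \<partial>?M)"
    using ih ln M.prob_space by (subst Bochner_Integration.integral_diff Bochner_Integration.integrable_diff; simp)+
  also have "\<dots> = (\<integral>x. f x * (h x - ln (f x) - ln Z) \<partial>N)"
    using f(2) by (subst integral_real_density) auto
  also have "\<dots> \<le> (\<integral>x. exp (h x) / Z - f x \<partial>N)"
  proof (intro integral_mono fln Bochner_Integration.integrable_diff integrable_divide iN fi)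
    fix x
    show "f x * (h x - ln (f x) - ln Z) \<le> exp (h x) / Z - f x"
    proof (cases "f x = 0")
      case False
      with f(2)[of x] have fx: "f x > 0" by simp
      have "1 + (h x - ln (f x) - ln Z) \<le> exp (h x - ln (f x) - ln Z)" by (rule exp_ge_add_one_self)
      also have "\<dots> = exp (h x) / (f x * Z)" using fx Z by (simp add: exp_diff)
      finally have "f x * (1 + (h x - ln (f x) - ln Z)) \<le> f x * (exp (h x) / (f x * Z))"
        using fx by (intro mult_left_mono) auto
      then show ?thesis using fx by (simp add: algebra_simps)
    qed (use Z in simp)
  qed
  also have "\<dots> = 0" using iN fi Z by (simp add: Z_def)
  finally show ?thesis by (simp add: Z_def)
qed

text \<open>The optimal test function is \<open>ln f\<close>, which may be unbounded. Its
  truncations are admissible, and Fatou's lemma yields integrability together with the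
  bound.\<close>

lemma entropy_bound_of_density:
  fixes f :: "'a \<Rightarrow> real"
  assumes N: "prob_space N" and f[measurable]: "f \<in> borel_measurable N" "\<And>x. 0 \<le> f x"
    and P: "prob_space (density N f)"
    and c: "\<And>h B. h \<in> borel_measurable N \<Longrightarrow> (\<And>x. \<bar>h x\<bar> \<le> B) \<Longrightarrow>
        (\<integral>x. h x \<partial>density N f) - ln (\<integral>x. exp (h x) \<partial>N) \<le> c"
  shows "integrable N (\<lambda>x. f x * ln (f x)) \<and> (\<integral>x. f x * ln (f x) \<partial>N) \<le> c"
proof -
  interpret N: prob_space N by fact
  interpret M: prob_space "density N f" by fact
  let ?M = "density N f"
  have fi: "integrable N f" "(\<integral>x. f x \<partial>N) = 1" by (rule prob_density_integral[OF f P])+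
  define e where "e k = 1 / real (Suc k)" for k
  have e: "0 < e k" "e k \<le> 1" for k by (auto simp: e_def)
  \<comment> \<open>The floor \<open>e k\<close> keeps \<open>ln\<close> finite where
    \<open>f\<close> vanishes and adds at most \<open>e k\<close> to the total mass; the ceiling can
    only lower it.\<close>
  define g where "g k x = max (e k) (min (f x) (real (Suc k)))" for k x
  have [measurable]: "g k \<in> borel_measurable N" for k unfolding g_def by measurable
  have gp: "g k x > 0" for k x using e[of k] by (auto simp: g_def)
  have gB: "\<bar>ln (g k x)\<bar> \<le> ln (real (Suc k))" for k x
  proof -
    have "e k \<le> g k x" "g k x \<le> real (Suc k)" using e[of k] by (auto simp: g_def)
    then have "ln (e k) \<le> ln (g k x)" "ln (g k x) \<le> ln (real (Suc k))"
      using e[of k] gp[of k x] by (auto simp del: of_nat_Suc)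
    then show ?thesis by (simp add: e_def ln_div del: of_nat_Suc)
  qed
  have gint: "integrable N (g k)" for k
    using e(2)[of k] e(1)[of k] by (intro N.integrable_const_bound[of _ "real (Suc k)"]) (auto simp: g_def)
  \<comment> \<open>A lower bound uniform in \<open>k\<close>: after adding 1 the integrands are
    nonnegative, as Fatou's lemma requires.\<close>
  have glb: "f x * ln (g k x) \<ge> - 1" for k x
  proof (cases "f x = 0")
    case False
    with f(2)[of x] have fx: "f x > 0" by simp
    show ?thesis
    proof (cases "f x \<le> real (Suc k)")
      case True
      then have "f x \<le> g k x" by (auto simp: g_def)
      then have "f x * ln (f x) \<le> f x * ln (g k x)" using fx by (intro mult_left_mono) auto
      with mult_ln_ge[of "f x"] fx show ?thesis by linarith
    next
      case False
      then have "g k x \<ge> 1" by (auto simp: g_def)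
      then have "0 \<le> f x * ln (g k x)" using fx by simp
      then show ?thesis by linarith
    qed
  qed simp
  have gM: "(\<integral>x. f x * ln (g k x) \<partial>N) \<le> c + e k" and gMi: "integrable N (\<lambda>x. f x * ln (g k x))" for k
  proof -
    have "integrable ?M (\<lambda>x. ln (g k x))"
      using gB by (intro M.integrable_const_bound[of _ "ln (real (Suc k))"]) auto
    then show "integrable N (\<lambda>x. f x * ln (g k x))"
      using f(2) by (subst (asm) integrable_real_density) auto
    have "(\<integral>x. ln (g k x) \<partial>?M) - ln (\<integral>x. exp (ln (g k x)) \<partial>N) \<le> c"
      by (rule c[OF _ gB]) simp
    then have "(\<integral>x. f x * ln (g k x) \<partial>N) \<le> c + ln (\<integral>x. g k x \<partial>N)"
      using f(2) by (subst (asm) integral_real_density) (auto simp: gp)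
    also have "ln (\<integral>x. g k x \<partial>N) \<le> e k"
    proof -
      have "e k = (\<integral>x. e k \<partial>N)" by (simp add: N.prob_space)
      also have "\<dots> \<le> (\<integral>x. g k x \<partial>N)" by (intro integral_mono gint) (auto simp: g_def)
      finally have pos: "0 < (\<integral>x. g k x \<partial>N)" using e[of k] by linarith
      have "(\<integral>x. g k x \<partial>N) \<le> (\<integral>x. f x + e k \<partial>N)"
      proof (intro integral_mono gint)
        show "g k x \<le> f x + e k" for x using f(2)[of x] e(1)[of k] by (auto simp: g_def)
      qed (use fi in simp)
      also have "\<dots> = 1 + e k" using fi by (simp add: N.prob_space)
      finally have "(\<integral>x. g k x \<partial>N) - 1 \<le> e k" by simp
      with ln_le_minus_one[OF pos] show ?thesis by linarith
    qed
    finally show "(\<integral>x. f x * ln (g k x) \<partial>N) \<le> c + e k" by simp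
  qed
  have e_lim: "e \<longlonglongrightarrow> 0" unfolding e_def using LIMSEQ_Suc[OF lim_1_over_n] by simp
  have lim: "(\<lambda>k. f x * ln (g k x)) \<longlonglongrightarrow> f x * ln (f x)" for x
  proof (cases "f x = 0")
    case False
    with f(2)[of x] have fx: "f x > 0" by simp
    have "\<forall>\<^sub>F k in sequentially. e k < f x" using e_lim fx by (rule order_tendstoD)
    moreover have "\<forall>\<^sub>F k in sequentially. f x < real (Suc k)"
      using reals_Archimedean2[of "f x"] unfolding eventually_sequentially
      by (metis le_SucI less_le_trans of_nat_le_iff)
    ultimately have "\<forall>\<^sub>F k in sequentially. f x * ln (g k x) = f x * ln (f x)"
      by eventually_elim (auto simp: g_def)
    then show ?thesis by (rule tendsto_eventually)
  qed simp
  have "(\<integral>\<^sup>+x. ennreal (f x * ln (f x) + 1) \<partial>N) = (\<integral>\<^sup>+x. liminf (\<lambda>k. ennreal (f x * ln (g k x) + 1)) \<partial>N)"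
  proof (intro nn_integral_cong)
    fix x
    have "(\<lambda>k. ennreal (f x * ln (g k x) + 1)) \<longlonglongrightarrow> ennreal (f x * ln (f x) + 1)"
      by (intro tendsto_ennrealI tendsto_add lim tendsto_const)
    then show "ennreal (f x * ln (f x) + 1) = liminf (\<lambda>k. ennreal (f x * ln (g k x) + 1))"
      by (simp add: lim_imp_Liminf)
  qed
  also have "\<dots> \<le> liminf (\<lambda>k. \<integral>\<^sup>+x. ennreal (f x * ln (g k x) + 1) \<partial>N)"
    by (rule nn_integral_liminf) auto
  also have "\<dots> \<le> liminf (\<lambda>k. ennreal (c + e k + 1))"
  proof (intro Liminf_mono always_eventually allI)
    fix k
    have "0 \<le> f x * ln (g k x) + 1" for x using glb[of x k] by linarith
    then have "(\<integral>\<^sup>+x. ennreal (f x * ln (g k x) + 1) \<partial>N) = ennreal (\<integral>x. f x * ln (g k x) + 1 \<partial>N)"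
      by (intro nn_integral_eq_integral) (auto intro: gMi)
    also have "(\<integral>x. f x * ln (g k x) + 1 \<partial>N) = (\<integral>x. f x * ln (g k x) \<partial>N) + 1"
      using gMi by (simp add: N.prob_space)
    also have "ennreal \<dots> \<le> ennreal (c + e k + 1)" using gM[of k] by (intro ennreal_leI) simp
    finally show "(\<integral>\<^sup>+x. ennreal (f x * ln (g k x) + 1) \<partial>N) \<le> ennreal (c + e k + 1)" .
  qed
  also have "\<dots> = ennreal (c + 0 + 1)"
    by (intro lim_imp_Liminf tendsto_ennrealI tendsto_add e_lim tendsto_const) simp
  finally have le: "(\<integral>\<^sup>+x. ennreal (f x * ln (f x) + 1) \<partial>N) \<le> ennreal (c + 1)" by simp
  have nn: "0 \<le> f x * ln (f x) + 1" for x using mult_ln_ge[OF f(2)[of x]] f(2)[of x] by linarith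
  have I1: "integrable N (\<lambda>x. f x * ln (f x) + 1)"
    using le nn by (intro integrableI_bounded) (auto simp: le_less_trans)
  from Bochner_Integration.integrable_diff[OF this, of "\<lambda>_. 1"]
  have I: "integrable N (\<lambda>x. f x * ln (f x))" by simp
  \<comment> \<open>\<open>ennreal\<close> sends negative reals to 0, so the final comparison
    depends on the sign of \<open>c\<close>; the test function 0 determines it.\<close>
  have "0 \<le> c"
    using c[of "\<lambda>_. 0" 0] by (simp add: N.prob_space)
  have "ennreal ((\<integral>x. f x * ln (f x) \<partial>N) + 1) = ennreal (\<integral>x. f x * ln (f x) + 1 \<partial>N)"
    using I by (simp add: N.prob_space)
  also have "\<dots> = (\<integral>\<^sup>+x. ennreal (f x * ln (f x) + 1) \<partial>N)"
    using I1 nn by (intro nn_integral_eq_integral[symmetric]) auto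
  also note le
  finally have "(\<integral>x. f x * ln (f x) \<partial>N) + 1 \<le> c + 1"
    using \<open>0 \<le> c\<close> by (subst (asm) ennreal_le_iff) auto
  then have "(\<integral>x. f x * ln (f x) \<partial>N) \<le> c" by simp
  with I show ?thesis by simp
qed

text \<open>For a null set \<open>A\<close> of \<open>N\<close> the test functions
  \<open>t * indicator A\<close> give \<open>t * measure M A \<le> c\<close> for every
  \<open>t \<ge> 0\<close>.\<close>

lemma gibbs_bound_imp_absolutely_continuous:
  fixes M N :: "'a measure" and c :: real
  assumes M: "prob_space M" and N: "prob_space N" and s: "sets M = sets N"
    and c: "\<And>h B. h \<in> borel_measurable N \<Longrightarrow> (\<And>x. \<bar>h x\<bar> \<le> B) \<Longrightarrow>
        (\<integral>x. h x \<partial>M) - ln (\<integral>x. exp (h x) \<partial>N) \<le> c"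
  shows "absolutely_continuous N M"
  unfolding absolutely_continuous_def
proof
  fix A assume A: "A \<in> null_sets N"
  interpret M: prob_space M by fact
  interpret N: prob_space N by fact
  have [measurable]: "A \<in> sets N" "A \<in> sets M" using A s by auto
  have [simp]: "measure N A = 0" using A by (simp add: null_setsD1 measure_def)
  have *: "t * measure M A \<le> c" if "t \<ge> 0" for t :: real
  proof -
    have "(\<integral>x. exp (t * indicator A x) \<partial>N) = (\<integral>x. 1 \<partial>N)"
      using AE_not_in[OF A] by (intro integral_cong_AE) (auto elim!: eventually_mono split: split_indicator)
    then have "(\<integral>x. exp (t * indicator A x) \<partial>N) = 1" by (simp add: N.prob_space)
    moreover have "(\<integral>x. t * indicator A x \<partial>M) = t * measure M A" by simp
    moreover have "(\<integral>x. t * indicator A x \<partial>M) - ln (\<integral>x. exp (t * indicator A x) \<partial>N) \<le> c"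
      using that by (intro c[of _ t]) (auto split: split_indicator)
    ultimately show ?thesis by simp
  qed
  have "measure M A = 0"
  proof (rule ccontr)
    assume "measure M A \<noteq> 0"
    then have p: "measure M A > 0" by (simp add: zero_less_measure_iff)
    obtain t :: nat where "real t * measure M A > c" using reals_Archimedean3[OF p] by blast
    with *[of "real t"] show False by simp
  qed
  then show "A \<in> null_sets M" by (auto simp: M.emeasure_eq_measure)
qed

section \<open>Relative entropy through densities\<close>

lemma density_enn2real_RN_deriv:
  assumes N: "prob_space N" and M: "prob_space M" and s: "sets M = sets N" and ac: "absolutely_continuous N M"
  shows "density N (\<lambda>x. ennreal (enn2real (RN_deriv N M x))) = M"
proof -
  interpret N: prob_space N by fact
  interpret M: prob_space M by fact
  have "AE x in N. RN_deriv N M x \<noteq> \<infinity>"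
    by (rule N.RN_deriv_finite) (use ac s in \<open>auto intro: M.sigma_finite_measure_axioms\<close>)
  then have "density N (\<lambda>x. ennreal (enn2real (RN_deriv N M x))) = density N (RN_deriv N M)"
    by (intro density_cong) (auto elim!: eventually_mono simp: less_top)
  also have "\<dots> = M" by (rule N.density_RN_deriv[OF ac s])
  finally show ?thesis .
qed

lemma rel_entropy_le_of_gibbs_bound:
  fixes M N :: "'a measure" and c :: real
  assumes M: "prob_space M" and N: "prob_space N" and s: "sets M = sets N"
    and c: "\<And>h B. h \<in> borel_measurable N \<Longrightarrow> (\<And>x. \<bar>h x\<bar> \<le> B) \<Longrightarrow>
        (\<integral>x. h x \<partial>M) - ln (\<integral>x. exp (h x) \<partial>N) \<le> c"
  shows "rel_entropy M N \<le> ereal c"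
proof -
  have ac: "absolutely_continuous N M" by (rule gibbs_bound_imp_absolutely_continuous[OF assms])
  define f where "f x = enn2real (RN_deriv N M x)" for x
  have M_eq: "density N f = M" unfolding f_def by (rule density_enn2real_RN_deriv[OF N M s ac])
  have f: "f \<in> borel_measurable N" "\<And>x. 0 \<le> f x" by (auto simp: f_def[abs_def])
  have "integrable N (\<lambda>x. f x * ln (f x)) \<and> (\<integral>x. f x * ln (f x) \<partial>N) \<le> c"
    using M c by (intro entropy_bound_of_density[OF N f]) (auto simp: M_eq)
  then show ?thesis using s ac by (auto simp: rel_entropy_def f_def Let_def)
qed

text \<open>Densities are unique almost everywhere, so \<open>f\<close> may replace the version
  given by \<open>RN_deriv\<close>.\<close>

lemma rel_entropy_density:
  fixes f :: "'a \<Rightarrow> real"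
  assumes N: "prob_space N" and f[measurable]: "f \<in> borel_measurable N" "\<And>x. 0 \<le> f x"
    and P: "prob_space (density N f)"
  shows "rel_entropy (density N f) N = (if integrable N (\<lambda>x. f x * ln (f x))
     then ereal (\<integral>x. f x * ln (f x) \<partial>N) else \<infinity>)"
proof -
  interpret N: prob_space N by fact
  let ?g = "\<lambda>x. enn2real (RN_deriv N (density N f) x)"
  have ac: "absolutely_continuous N (density N f)"
    by (rule absolutely_continuousI_density) simp
  have "AE x in N. ennreal (f x) = RN_deriv N (density N f) x"
    by (rule N.RN_deriv_unique) auto
  then have ae: "AE x in N. ?g x * ln (?g x) = f x * ln (f x)"
    using f(2) by (auto elim!: eventually_mono) (metis enn2real_ennreal)
  have 1: "integrable N (\<lambda>x. ?g x * ln (?g x)) \<longleftrightarrow> integrable N (\<lambda>x. f x * ln (f x))"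
    by (intro integrable_cong_AE) (use ae in auto)
  have 2: "(\<integral>x. ?g x * ln (?g x) \<partial>N) = (\<integral>x. f x * ln (f x) \<partial>N)"
    by (intro integral_cong_AE) (use ae in auto)
  show ?thesis using ac by (simp add: rel_entropy_def Let_def 1 2)
qed

lemma rel_entropy_finite_density:
  assumes N: "prob_space N" and M: "prob_space M" and fin: "rel_entropy M N < \<infinity>"
  obtains f :: "'a \<Rightarrow> real" where "f \<in> borel_measurable N" "\<And>x. 0 \<le> f x" "M = density N f"
    "integrable N (\<lambda>x. f x * ln (f x))" "rel_entropy M N = ereal (\<integral>x. f x * ln (f x) \<partial>N)"
    "integrable M (\<lambda>x. ln (f x))" "rel_entropy M N = ereal (\<integral>x. ln (f x) \<partial>M)"
proof -
  have s: "sets M = sets N" and ac: "absolutely_continuous N M"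
    using fin by (auto simp: rel_entropy_def split: if_splits)
  define f where "f x = enn2real (RN_deriv N M x)" for x
  have M_eq: "density N f = M" unfolding f_def by (rule density_enn2real_RN_deriv[OF N M s ac])
  have f[measurable]: "f \<in> borel_measurable N" "\<And>x. 0 \<le> f x" by (auto simp: f_def[abs_def])
  have I: "integrable N (\<lambda>x. f x * ln (f x))"
    and E: "rel_entropy M N = ereal (\<integral>x. f x * ln (f x) \<partial>N)"
    using fin s ac by (auto simp: rel_entropy_def f_def Let_def split: if_splits)
  have "integrable M (\<lambda>x. ln (f x))"
    unfolding M_eq[symmetric] using I f(2) by (subst integrable_real_density) auto
  moreover have "(\<integral>x. ln (f x) \<partial>M) = (\<integral>x. f x * ln (f x) \<partial>N)"
    unfolding M_eq[symmetric] using f(2) by (subst integral_real_density) auto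
  ultimately show ?thesis using that[of f] f I E M_eq by simp
qed

text \<open>When it vanishes, \<open>rel_entropy\<close> coincides with \<open>KL_divergence\<close>
  to base \<open>exp 1\<close>, for which vanishing characterises equality.\<close>

lemma rel_entropy_eq_0_iff:
  assumes N: "prob_space N" and M: "prob_space M"
  shows "rel_entropy M N = 0 \<longleftrightarrow> M = N"
proof
  assume eq: "M = N"
  have "N = density N (\<lambda>x. ennreal 1)" by (simp add: density_1)
  then have "rel_entropy N N = rel_entropy (density N (\<lambda>x. ennreal ((\<lambda>x. 1::real) x))) N" by simp
  also have "\<dots> = 0" using N by (subst rel_entropy_density) (auto simp: density_1)
  finally show "rel_entropy M N = 0" using eq by simp
next
  assume 0: "rel_entropy M N = 0"
  interpret N: prob_space N by fact
  interpret M: prob_space M by fact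
  interpret information_space N "exp 1"
    by standard simp
  have s: "sets M = sets N" and ac: "absolutely_continuous N M"
    using 0 by (auto simp: rel_entropy_def split: if_splits)
  obtain f :: "'a \<Rightarrow> real" where f: "f \<in> borel_measurable N" "\<And>x. 0 \<le> f x" "M = density N f"
    "integrable N (\<lambda>x. f x * ln (f x))" "rel_entropy M N = ereal (\<integral>x. f x * ln (f x) \<partial>N)"
    "integrable M (\<lambda>x. ln (f x))"
    by (rule rel_entropy_finite_density[OF N M]) (use 0 in auto)
  have ae: "AE x in N. ennreal (f x) = RN_deriv N M x"
    by (rule N.RN_deriv_unique) (use f in auto)
  then have ae': "AE x in M. entropy_density (exp 1) N M x = ln (f x)"
    using f(2) unfolding f(3)
    by (subst AE_density) (use f in \<open>auto simp: entropy_density_def log_def elim!: eventually_mono\<close>, metis enn2real_ennreal)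
  have [measurable]: "f \<in> borel_measurable M" using f(1) s by (simp cong: measurable_cong_sets)
  have [measurable]: "entropy_density (exp 1) N M \<in> borel_measurable M"
    unfolding entropy_density_def using s by (auto cong: measurable_cong_sets)
  have "integrable M (entropy_density (exp 1) N M)"
    using f(6) by (subst integrable_cong_AE[OF _ _ ae']) auto
  moreover have "KL_divergence (exp 1) N M = 0"
  proof -
    have "KL_divergence (exp 1) N M = (\<integral>x. ln (f x) \<partial>M)"
      unfolding KL_divergence_def by (intro integral_cong_AE ae') auto
    also have "\<dots> = (\<integral>x. f x * ln (f x) \<partial>N)"
      unfolding f(3) using f(1,2) by (subst integral_real_density) auto
    finally show ?thesis using f(5) 0 by simp
  qed
  ultimately show "M = N"
    using KL_eq_0_iff_eq_ac[OF M ac s] by simp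
qed

subsection \<open>Polynomials and measures on the cube\<close>

text \<open>Compactness is taken in the space of all functions on the naturals. The coordinates from
  \<open>n\<close> on range over the compact singleton \<open>{undefined}\<close>, so Tychonoff's
  theorem applies.\<close>

lemma cube_eq_PiE_UNIV: "cube R n = PiE UNIV (\<lambda>i. if i < n then {-R..R} else {undefined})"
proof (intro set_eqI iffI)
  fix x assume "x \<in> cube R n"
  then show "x \<in> PiE UNIV (\<lambda>i. if i < n then {-R..R} else {undefined})"
    unfolding cube_def PiE_iff extensional_def by simp
next
  fix x assume x: "x \<in> PiE UNIV (\<lambda>i. if i < n then {-R..R} else {undefined})"
  have *: "x i \<in> (if i < n then {-R..R} else {undefined})" for i using x by (auto simp only: PiE_iff UNIV_I)
  show "x \<in> cube R n"
    unfolding cube_def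
  proof (rule PiE_I)
    show "x i \<in> {-R..R}" if "i \<in> {..<n}" for i using *[of i] that by simp
    show "x i = undefined" if "i \<notin> {..<n}" for i using *[of i] that by simp
  qed
qed

lemma compact_cube: "compact (cube R n)"
proof -
  have "compactin (product_topology (\<lambda>_. euclidean) UNIV) (cube R n)"
    unfolding cube_eq_PiE_UNIV compactin_PiE by (auto simp: compactin_euclidean_iff)
  then show ?thesis
    by (simp add: euclidean_product_topology compactin_euclidean_iff)
qed

text \<open>Monomials are index lists, as in \<open>Delta_R\<close>, so moment conditions apply term
  by term; the empty list is the constant monomial.\<close>

definition poly_eval :: "(real \<times> nat list) list \<Rightarrow> (nat \<Rightarrow> real) \<Rightarrow> real" where
  "poly_eval L x = (\<Sum>(c, is)\<leftarrow>L. c * prod_list (map x is))"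

definition poly_vars :: "nat \<Rightarrow> (real \<times> nat list) list \<Rightarrow> bool" where
  "poly_vars n L \<longleftrightarrow> (\<forall>(c, is)\<in>set L. set is \<subseteq> {..<n})"

lemma poly_eval_simps [simp]:
  "poly_eval [] x = 0"
  "poly_eval ((c, is) # L) x = c * prod_list (map x is) + poly_eval L x"
  "poly_eval (L @ L') x = poly_eval L x + poly_eval L' x"
  by (simp_all add: poly_eval_def)

lemma poly_vars_simps [simp]:
  "poly_vars n []"
  "poly_vars n ((c, is) # L) \<longleftrightarrow> set is \<subseteq> {..<n} \<and> poly_vars n L"
  "poly_vars n (L @ L') \<longleftrightarrow> poly_vars n L \<and> poly_vars n L'"
  by (auto simp: poly_vars_def)

lemma poly_eval_mult_monomial:
  "poly_eval (map (\<lambda>(c', is'). (c * c', is @ is')) L) x = c * prod_list (map x is) * poly_eval L x"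
  by (induction L) (auto simp: algebra_simps)

lemma poly_vars_mult_monomial:
  "set is \<subseteq> {..<n} \<Longrightarrow> poly_vars n L \<Longrightarrow> poly_vars n (map (\<lambda>(c', is'). (c * c', is @ is')) L)"
  by (induction L) auto

lemma poly_mult_exists:
  "poly_vars n L \<Longrightarrow> poly_vars n L' \<Longrightarrow> \<exists>L''. poly_vars n L'' \<and> (\<forall>x. poly_eval L'' x = poly_eval L x * poly_eval L' x)"
proof (induction L)
  case Nil
  then show ?case by (intro exI[of _ "[]"]) simp
next
  case (Cons a L)
  obtain c "is" where a: "a = (c, is)" by (cases a)
  obtain L'' where L'': "poly_vars n L''" "\<And>x. poly_eval L'' x = poly_eval L x * poly_eval L' x"
    using Cons a by auto
  show ?case
    by (rule exI[of _ "map (\<lambda>(c', is'). (c * c', is @ is')) L' @ L''"])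
      (use L'' Cons.prems a in \<open>auto simp: poly_eval_mult_monomial distrib_right intro!: poly_vars_mult_monomial\<close>)
qed

lemma continuous_on_poly_eval: "continuous_on S (poly_eval L)"
proof -
  have m: "continuous_on S (\<lambda>x :: nat \<Rightarrow> real. prod_list (map x is))" for "is"
    by (induction "is") (auto intro!: continuous_intros continuous_on_coordinatewise_then_product
        intro: continuous_on_product_coordinates continuous_on_subset)
  show ?thesis
  proof (induction L)
    case Nil
    then show ?case by (simp add: poly_eval_def[abs_def])
  next
    case (Cons a L)
    obtain c "is" where a: "a = (c, is)" by (cases a)
    have "continuous_on S (\<lambda>x. c * prod_list (map x is) + poly_eval L x)"
      by (intro continuous_intros m Cons)
    then show ?case by (simp add: a)
  qed
qed

lemma poly_dense_cube:
  assumes h: "continuous_on (cube R n) h" and e: "e > 0"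
  obtains L where "poly_vars n L" "\<And>x. x \<in> cube R n \<Longrightarrow> \<bar>h x - poly_eval L x\<bar> < e"
proof -
  interpret function_ring_on "{poly_eval L | L. poly_vars n L}" "cube R n"
  proof
    fix f g assume fg: "f \<in> {poly_eval L | L. poly_vars n L}" "g \<in> {poly_eval L | L. poly_vars n L}"
    then obtain L L' where L: "f = poly_eval L" "g = poly_eval L'" "poly_vars n L" "poly_vars n L'" by auto
    show "(\<lambda>x. f x + g x) \<in> {poly_eval L | L. poly_vars n L}"
      using L by (auto intro!: exI[of _ "L @ L'"] simp: fun_eq_iff)
    obtain L'' where "poly_vars n L''" "\<And>x. poly_eval L'' x = poly_eval L x * poly_eval L' x"
      using poly_mult_exists[OF L(3,4)] by blast
    then show "(\<lambda>x. f x * g x) \<in> {poly_eval L | L. poly_vars n L}"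
      using L by (auto intro!: exI[of _ "L''"] simp: fun_eq_iff)
  next
    show "(\<lambda>_. c) \<in> {poly_eval L | L. poly_vars n L}" for c
      by (auto intro!: exI[of _ "[(c, [])]"] simp: fun_eq_iff)
  next
    fix x y assume xy: "x \<in> cube R n" "y \<in> cube R n" "x \<noteq> y"
    then obtain i where i: "x i \<noteq> y i" by auto
    \<comment> \<open>Points of the cube agree outside \<open>{..<n}\<close>, so the separating
      coordinate is an admissible variable.\<close>
    have "i < n"
    proof (rule ccontr)
      assume "\<not> i < n"
      then have "x i = undefined" "y i = undefined" using xy by (auto simp: cube_def PiE_iff extensional_def)
      with i show False by simp
    qed
    then show "\<exists>f\<in>{poly_eval L | L. poly_vars n L}. f x \<noteq> f y"
      using i by (intro bexI[of _ "poly_eval [(1, [i])]"]) (auto intro!: exI[of _ "[(1, [i])]"])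
  qed (auto simp: compact_cube continuous_on_poly_eval)
  from Stone_Weierstrass_basic[OF h e] show ?thesis using that by blast
qed

text \<open>The metric on functions weights coordinates geometrically: finitely many carry the
  distance up to \<open>(1/2) ^ N\<close>, and each of these differs by at most \<eta>.\<close>

lemma cube_uniformly_continuous:
  fixes h :: "(nat \<Rightarrow> real) \<Rightarrow> real"
  assumes h: "continuous_on (cube R n) h" and e: "e > 0"
  obtains \<eta> where "\<eta> > 0"
    "\<And>x y. x \<in> cube R n \<Longrightarrow> y \<in> cube R n \<Longrightarrow> (\<And>i. i < n \<Longrightarrow> \<bar>x i - y i\<bar> \<le> \<eta>) \<Longrightarrow> \<bar>h x - h y\<bar> < e"
proof -
  have "uniformly_continuous_on (cube R n) h"
    by (rule compact_uniformly_continuous[OF h compact_cube])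
  then obtain d where d: "d > 0" "\<And>x y. x \<in> cube R n \<Longrightarrow> y \<in> cube R n \<Longrightarrow> dist y x < d \<Longrightarrow> dist (h y) (h x) < e"
    unfolding uniformly_continuous_on_def using e by meson
  obtain N where N: "(1/2::real) ^ N < d / 2"
    using real_arch_pow_inv[of "d/2" "1/2"] d by auto
  show ?thesis
  \<comment> \<open>With a tail below \<open>d / 2\<close> the distance is less than
    \<open>2 * (d / 8) + d / 2\<close>, hence below \<open>d\<close>.\<close>
  proof (rule that[of "d / 8"])
    fix x y assume x: "x \<in> cube R n" and y: "y \<in> cube R n" and xy: "\<And>i. i < n \<Longrightarrow> \<bar>x i - y i\<bar> \<le> d / 8"
    have c: "dist (y i) (x i) \<le> d / 8" for i
    proof (cases "i < n")
      case True
      then show ?thesis using xy[of i] by (simp add: dist_real_def abs_minus_commute)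
    next
      case False
      then have "x i = undefined" "y i = undefined" using x y by (auto simp: cube_def PiE_iff extensional_def)
      then show ?thesis using d by simp
    qed
    have "dist y x \<le> 2 * Max {dist (y (from_nat m)) (x (from_nat m)) | m. m \<le> N} + (1/2)^N"
      by (rule dist_fun_le_dist_first_terms)
    also have "Max {dist (y (from_nat m)) (x (from_nat m)) | m. m \<le> N} \<le> d / 8"
      using c by (subst Max_le_iff) auto
    finally have "dist y x < d" using N d by simp
    from d(2)[OF x y this] show "\<bar>h x - h y\<bar> < e" by (simp add: dist_real_def abs_minus_commute)
  qed (use d in simp)
qed

lemma prod_list_abs_le:
  fixes x :: "nat \<Rightarrow> real"
  assumes "\<And>i. i \<in> set is \<Longrightarrow> \<bar>x i\<bar> \<le> R"
  shows "\<bar>prod_list (map x is)\<bar> \<le> R ^ length is"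
  using assms
proof (induction "is")
  case (Cons i "is")
  have "\<bar>x i\<bar> * \<bar>prod_list (map x is)\<bar> \<le> R * R ^ length is"
    using Cons.prems[of i] by (intro mult_mono Cons) auto
  then show ?case by (simp add: abs_mult)
qed simp

text \<open>Separates the coordinates, so that integrals of monomials factorise under a product
  measure.\<close>

lemma prod_list_map_eq_prod_count:
  fixes x :: "nat \<Rightarrow> real"
  assumes "set is \<subseteq> {..<n}"
  shows "prod_list (map x is) = (\<Prod>i<n. x i ^ count_list is i)"
  using assms
proof (induction "is")
  case (Cons a "is")
  have "(\<Prod>i<n. x i ^ count_list (a # is) i) = (\<Prod>i<n. (if i = a then x i else 1) * x i ^ count_list is i)"
    by (intro prod.cong) auto
  also have "\<dots> = x a * (\<Prod>i<n. x i ^ count_list is i)"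
    using Cons.prems by (simp add: prod.distrib prod.delta)
  finally show ?case using Cons by simp
qed simp

text \<open>Compares the product sigma-algebra on extensional points with the Borel sets of the full
  function space; continuous functions thereby become measurable.\<close>

lemma measurable_id_PiM_borel:
  fixes n :: nat
  shows "(\<lambda>x. x) \<in> borel_measurable (PiM {..<n} (\<lambda>_. lborel :: real measure))"
proof (rule measurable_coordinatewise_then_product)
  fix i
  show "(\<lambda>x. x i) \<in> borel_measurable (PiM {..<n} (\<lambda>_. lborel :: real measure))"
  proof (cases "i < n")
    case True
    then have "(\<lambda>x. x i) \<in> measurable (PiM {..<n} (\<lambda>_. lborel :: real measure)) lborel"
      by (intro measurable_component_singleton) auto
    then show ?thesis by simp
  next
    case False
    have "(\<lambda>x. x i) \<in> borel_measurable (PiM {..<n} (\<lambda>_. lborel :: real measure)) \<longleftrightarrow>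
      (\<lambda>x. undefined :: real) \<in> borel_measurable (PiM {..<n} (\<lambda>_. lborel :: real measure))"
      using False by (intro measurable_cong) (auto simp: space_PiM PiE_iff extensional_def)
    then show ?thesis by simp
  qed
qed

lemma cube_in_sets: "cube R n \<in> sets (PiM {..<n} (\<lambda>_. lborel))"
  unfolding cube_def by (rule sets_PiM_I_finite) auto

text \<open>Used for \<mu> and also for the product of its marginals.\<close>

locale cube_prob = prob_space M for M :: "(nat \<Rightarrow> real) measure" +
  fixes R :: real and n :: nat
  assumes sets_M [measurable_cong]: "sets M = sets (PiM {..<n} (\<lambda>_. lborel))"
    and M_cube: "emeasure M (cube R n) = 1"
begin

lemma cube_sets [measurable]: "cube R n \<in> sets M"
  using cube_in_sets sets_M by simp

lemma space_M: "space M = PiE {..<n} (\<lambda>_. UNIV)"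
  using sets_eq_imp_space_eq[OF sets_M] by (simp add: space_PiM)

lemma AE_cube: "AE x in M. x \<in> cube R n"
  using AE_prob_1[of "cube R n"] M_cube by (simp add: measure_def)

lemma measurable_id: "(\<lambda>x. x) \<in> borel_measurable M"
  using measurable_id_PiM_borel[of n] sets_M by (simp cong: measurable_cong_sets)

lemma measurable_indicator_cube:
  fixes h :: "(nat \<Rightarrow> real) \<Rightarrow> real"
  assumes h: "continuous_on (cube R n) h"
  shows "(\<lambda>x. indicator (cube R n) x * h x) \<in> borel_measurable M"
proof -
  have "(\<lambda>x. indicator (cube R n) x *\<^sub>R h x) \<in> borel_measurable borel"
    by (rule borel_measurable_continuous_on_indicator[OF _ h]) (simp add: compact_cube compact_imp_closed)
  from measurable_compose[OF measurable_id this] show ?thesis by simp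
qed

lemma cube_bounded:
  fixes h :: "(nat \<Rightarrow> real) \<Rightarrow> real"
  assumes h: "continuous_on (cube R n) h"
  obtains B where "B \<ge> 0" "\<And>x. x \<in> cube R n \<Longrightarrow> \<bar>h x\<bar> \<le> B"
proof -
  have "compact (h ` cube R n)" using h compact_cube by (rule compact_continuous_image)
  then have "bounded (h ` cube R n)" by (rule compact_imp_bounded)
  then obtain B where "\<And>x. x \<in> cube R n \<Longrightarrow> \<bar>h x\<bar> \<le> B" by (auto simp: bounded_iff)
  then show ?thesis by (intro that[of "max B 0"]) (auto simp: le_max_iff_disj)
qed

lemma integrable_indicator_cube:
  fixes h :: "(nat \<Rightarrow> real) \<Rightarrow> real"
  assumes h: "continuous_on (cube R n) h"
  shows "integrable M (\<lambda>x. indicator (cube R n) x * h x)"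
proof -
  obtain B where B: "B \<ge> 0" "\<And>x. x \<in> cube R n \<Longrightarrow> \<bar>h x\<bar> \<le> B" using cube_bounded[OF h] by blast
  show ?thesis
    by (rule integrable_const_bound[of _ B])
      (use B measurable_indicator_cube[OF h] in \<open>auto split: split_indicator\<close>)
qed

lemma integral_indicator_cube:
  fixes h :: "(nat \<Rightarrow> real) \<Rightarrow> real"
  assumes "continuous_on UNIV h"
  shows "(\<integral>x. indicator (cube R n) x * h x \<partial>M) = (\<integral>x. h x \<partial>M)"
proof -
  have "h \<in> borel_measurable borel" by (rule borel_measurable_continuous_onI[OF assms])
  then have "h \<in> borel_measurable M" using measurable_compose[OF measurable_id] by blast
  then show ?thesis
    using AE_cube measurable_indicator_cube[OF continuous_on_subset[OF assms]]
    by (intro integral_cong_AE) (auto elim!: eventually_mono)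
qed

lemma integrable_continuous:
  fixes h :: "(nat \<Rightarrow> real) \<Rightarrow> real"
  assumes "continuous_on UNIV h"
  shows "integrable M h"
proof -
  have "h \<in> borel_measurable borel" by (rule borel_measurable_continuous_onI[OF assms])
  then have m: "h \<in> borel_measurable M" using measurable_compose[OF measurable_id] by blast
  have i: "integrable M (\<lambda>x. indicator (cube R n) x * h x)"
    by (rule integrable_indicator_cube[OF continuous_on_subset[OF assms]]) simp
  have "AE x in M. indicator (cube R n) x * h x = h x"
    using AE_cube by (auto elim!: eventually_mono)
  from integrable_cong_AE_imp[OF i m this] show ?thesis .
qed

lemma continuous_on_monomial: "continuous_on UNIV (\<lambda>x :: nat \<Rightarrow> real. prod_list (map x is))"
  using continuous_on_poly_eval[of UNIV "[(1, is)]"] by (simp add: poly_eval_def[abs_def])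

lemma integral_poly_eval:
  "(\<integral>x. poly_eval L x \<partial>M) = (\<Sum>(c, is)\<leftarrow>L. c * (\<integral>x. prod_list (map x is) \<partial>M))"
proof (induction L)
  case Nil
  then show ?case by (simp add: poly_eval_def[abs_def])
next
  case (Cons a L)
  obtain c "is" where a: "a = (c, is)" by (cases a)
  have "(\<integral>x. poly_eval (a # L) x \<partial>M) = (\<integral>x. c * prod_list (map x is) + poly_eval L x \<partial>M)"
    by (simp add: a)
  also have "\<dots> = c * (\<integral>x. prod_list (map x is) \<partial>M) + (\<integral>x. poly_eval L x \<partial>M)"
    by (simp add: integrable_continuous[OF continuous_on_monomial] integrable_continuous[OF continuous_on_poly_eval])
  finally show ?case using Cons by (simp add: a)
qed

lemma integral_poly_close:
  fixes h :: "(nat \<Rightarrow> real) \<Rightarrow> real"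
  assumes h: "continuous_on (cube R n) h" and L: "\<And>x. x \<in> cube R n \<Longrightarrow> \<bar>h x - poly_eval L x\<bar> < e"
  shows "\<bar>(\<integral>x. poly_eval L x \<partial>M) - (\<integral>x. indicator (cube R n) x * h x \<partial>M)\<bar> \<le> e"
proof -
  let ?D = "\<lambda>x. indicator (cube R n) x * (poly_eval L x - h x)"
  have c: "continuous_on (cube R n) (\<lambda>x. poly_eval L x - h x)"
    by (intro continuous_intros h continuous_on_poly_eval)
  have "(\<integral>x. poly_eval L x \<partial>M) - (\<integral>x. indicator (cube R n) x * h x \<partial>M)
    = (\<integral>x. indicator (cube R n) x * poly_eval L x \<partial>M) - (\<integral>x. indicator (cube R n) x * h x \<partial>M)"
    by (simp add: integral_indicator_cube continuous_on_poly_eval)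
  also have "\<dots> = (\<integral>x. ?D x \<partial>M)"
    by (subst Bochner_Integration.integral_diff[symmetric])
      (auto intro: integrable_indicator_cube h continuous_on_poly_eval simp: right_diff_distrib)
  also have "\<bar>\<dots>\<bar> \<le> (\<integral>x. \<bar>?D x\<bar> \<partial>M)"
    using integral_norm_bound[of M ?D] by simp
  also have "\<dots> \<le> (\<integral>x. e \<partial>M)"
  proof (rule integral_mono_AE)
    show "AE x in M. \<bar>?D x\<bar> \<le> e"
      using AE_cube by eventually_elim (auto simp: abs_minus_commute intro: less_imp_le[OF L])
  qed (use integrable_indicator_cube[OF c] in auto)
  also have "\<dots> = e" by (simp add: prob_space)
  finally show ?thesis .
qed

end

subsection \<open>Upper bound for the mutual pressure\<close>

locale approximated = cube_prob \<mu> R n for \<mu> R n +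
  fixes \<Xi> :: "nat \<Rightarrow> nat \<Rightarrow> nat \<Rightarrow> real"
  assumes R_pos: "R > 0" and approx: "approx_seq R n \<mu> \<Xi>"
begin

lemma measurable_coord': "(\<lambda>x. x i) \<in> measurable \<mu> lborel"
proof -
  have "(\<lambda>x. x i) \<in> borel_measurable \<mu>"
    using measurable_compose[OF measurable_id, of "\<lambda>x. x i" borel] by simp
  then show ?thesis by simp
qed

lemma prob_space_marg: "prob_space (marg \<mu> i)"
  unfolding marg_def by (rule prob_space_distr[OF measurable_coord'])

lemma sets_marg [simp, measurable_cong]: "sets (marg \<mu> i) = sets borel"
  by (simp add: marg_def)

lemma space_marg [simp]: "space (marg \<mu> i) = UNIV"
  by (simp add: marg_def)

lemma emeasure_marg: "i < n \<Longrightarrow> emeasure (marg \<mu> i) {-R..R} = 1"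
proof -
  assume i: "i < n"
  have "emeasure (marg \<mu> i) {-R..R} = emeasure \<mu> ((\<lambda>x. x i) -` {-R..R} \<inter> space \<mu>)"
    unfolding marg_def by (rule emeasure_distr[OF measurable_coord']) simp
  also have "\<dots> \<ge> emeasure \<mu> (cube R n)"
    using measurable_sets[OF measurable_coord', of "{-R..R}" i] i
    by (intro emeasure_mono) (auto simp: cube_def space_M PiE_iff)
  finally have "emeasure (marg \<mu> i) {-R..R} \<ge> 1" using M_cube by simp
  moreover have "emeasure (marg \<mu> i) {-R..R} \<le> 1"
    using prob_space.emeasure_le_1[OF prob_space_marg] by blast
  ultimately show ?thesis by (rule antisym[rotated])
qed

lemma AE_marg: "i < n \<Longrightarrow> AE t in marg \<mu> i. t \<in> {-R..R}"
  using prob_space.AE_prob_1[OF prob_space_marg, of i "{-R..R}"] emeasure_marg[of i] by (simp add: measure_def)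

definition \<nu> :: "(nat \<Rightarrow> real) measure" where "\<nu> = PiM {..<n} (\<lambda>i. marg \<mu> i)"

sublocale marg: product_prob_space "\<lambda>i. marg \<mu> i" "{..<n}"
  by (intro product_prob_space.intro product_sigma_finite.intro product_prob_space_axioms.intro
      prob_space_marg prob_space_imp_sigma_finite)

lemma prob_space_\<nu>: "prob_space \<nu>"
  unfolding \<nu>_def by (rule marg.prob_space_axioms)

sublocale \<nu>: cube_prob \<nu> R n
proof (intro cube_prob.intro prob_space_\<nu>, unfold_locales)
  show "sets \<nu> = sets (PiM {..<n} (\<lambda>_. lborel))"
    unfolding \<nu>_def by (intro sets_PiM_cong) auto
  show "emeasure \<nu> (cube R n) = 1"
    unfolding \<nu>_def cube_def by (subst marg.emeasure_PiM) (auto simp: emeasure_marg)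
qed

lemma integrable_power_marg: "i < n \<Longrightarrow> integrable (marg \<mu> i) (\<lambda>t. t ^ k)"
proof -
  assume i: "i < n"
  show ?thesis
  proof (rule finite_measure.integrable_const_bound[OF prob_space.finite_measure[OF prob_space_marg], where B = "R ^ k"])
    show "AE t in marg \<mu> i. norm (t ^ k) \<le> R ^ k"
      using AE_marg[OF i] by eventually_elim (auto simp: power_abs intro!: power_mono)
  qed simp
qed

lemma integral_monomial_product:
  assumes "set is \<subseteq> {..<n}"
  shows "(\<integral>x. prod_list (map x is) \<partial>\<nu>) = (\<Prod>i<n. \<integral>t. t ^ count_list is i \<partial>marg \<mu> i)"
  unfolding \<nu>_def prod_list_map_eq_prod_count[OF assms]
  by (rule marg.product_integral_prod) (auto intro: integrable_power_marg)

section \<open>Convergence of the product of the empirical measures\<close>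

definition pt :: "nat \<Rightarrow> (nat \<Rightarrow> nat) \<Rightarrow> nat \<Rightarrow> real" where
  "pt N k = (\<lambda>i\<in>{..<n}. \<Xi> i N (k i))"

lemma pt_in_cube: "(\<And>i. i < n \<Longrightarrow> k i < N) \<Longrightarrow> pt N k \<in> cube R n"
  using approx unfolding approx_seq_def pt_def cube_def by (intro restrict_PiE_iff[THEN iffD2]) blast

text \<open>Expectation of \<open>F\<close> under the product of the empirical measures of the
  \<open>n\<close> vectors at level \<open>N\<close>.\<close>

definition avg :: "nat \<Rightarrow> ((nat \<Rightarrow> real) \<Rightarrow> real) \<Rightarrow> real" where
  "avg N F = (\<Sum>k\<in>PiE {..<n} (\<lambda>_. {..<N}). F (pt N k)) / real N ^ n"

lemma card_index: "card (PiE {..<n} (\<lambda>_. {..<N})) = N ^ n"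
  by (simp add: card_PiE)

lemma avg_monomial:
  assumes "set is \<subseteq> {..<n}"
  shows "avg N (\<lambda>x. prod_list (map x is)) = (\<Prod>i<n. kappa N (\<lambda>j. \<Xi> i N j ^ count_list is i))"
proof -
  have "(\<Sum>k\<in>PiE {..<n} (\<lambda>_. {..<N}). prod_list (map (pt N k) is))
    = (\<Sum>k\<in>PiE {..<n} (\<lambda>_. {..<N}). \<Prod>i<n. \<Xi> i N (k i) ^ count_list is i)"
    unfolding prod_list_map_eq_prod_count[OF assms] by (intro sum.cong prod.cong) (auto simp: pt_def)
  also have "\<dots> = (\<Prod>i<n. \<Sum>j<N. \<Xi> i N j ^ count_list is i)"
    by (rule prod_sum_PiE[symmetric]) auto
  finally show ?thesis by (simp add: avg_def kappa_def prod_dividef)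
qed

lemma avg_monomial_tendsto:
  assumes "set is \<subseteq> {..<n}"
  shows "(\<lambda>N. avg N (\<lambda>x. prod_list (map x is))) \<longlonglongrightarrow> (\<integral>x. prod_list (map x is) \<partial>\<nu>)"
  unfolding avg_monomial[OF assms] integral_monomial_product[OF assms]
  using approx by (intro tendsto_prod) (auto simp: approx_seq_def)

lemma avg_poly_tendsto:
  "poly_vars n L \<Longrightarrow> (\<lambda>N. avg N (poly_eval L)) \<longlonglongrightarrow> (\<integral>x. poly_eval L x \<partial>\<nu>)"
proof (induction L)
  case Nil
  then show ?case by (simp add: avg_def poly_eval_def[abs_def])
next
  case (Cons a L)
  obtain c "is" where a: "a = (c, is)" by (cases a)
  have 1: "avg N (poly_eval (a # L)) = c * avg N (\<lambda>x. prod_list (map x is)) + avg N (poly_eval L)" for N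
    by (simp add: avg_def a sum.distrib add_divide_distrib sum_distrib_left)
  have 2: "(\<lambda>N. c * avg N (\<lambda>x. prod_list (map x is)) + avg N (poly_eval L)) \<longlonglongrightarrow>
     c * (\<integral>x. prod_list (map x is) \<partial>\<nu>) + (\<integral>x. poly_eval L x \<partial>\<nu>)"
    using Cons a by (intro tendsto_intros avg_monomial_tendsto) auto
  have 3: "(\<integral>x. poly_eval (a # L) x \<partial>\<nu>) = c * (\<integral>x. prod_list (map x is) \<partial>\<nu>) + (\<integral>x. poly_eval L x \<partial>\<nu>)"
    unfolding \<nu>.integral_poly_eval by (simp add: a)
  show ?case unfolding 1 3 by (rule 2)
qed

lemma avg_diff_le:
  assumes "N > 0" and le: "\<And>x. x \<in> cube R n \<Longrightarrow> \<bar>F x - G x\<bar> \<le> e"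
  shows "\<bar>avg N F - avg N G\<bar> \<le> e"
proof -
  let ?I = "PiE {..<n} (\<lambda>_. {..<N})"
  have "\<bar>(\<Sum>k\<in>?I. F (pt N k)) - (\<Sum>k\<in>?I. G (pt N k))\<bar> \<le> (\<Sum>k\<in>?I. \<bar>F (pt N k) - G (pt N k)\<bar>)"
    unfolding sum_subtractf[symmetric] by (rule sum_abs)
  also have "\<dots> \<le> (\<Sum>k\<in>?I. e)"
    by (intro sum_mono le pt_in_cube) auto
  also have "\<dots> = real N ^ n * e" by (simp add: card_index)
  finally show ?thesis
    using \<open>N > 0\<close> unfolding avg_def diff_divide_distrib[symmetric]
    by (simp add: abs_divide divide_le_eq mult.commute)
qed

text \<open>Weak convergence of the product empirical measures to \<nu>: for monomials the averages
  factorise into the moments prescribed by \<open>approx_seq\<close>, and polynomials are dense on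
  the cube.\<close>

lemma avg_continuous_tendsto:
  assumes h: "continuous_on (cube R n) h"
  shows "(\<lambda>N. avg N h) \<longlonglongrightarrow> (\<integral>x. indicator (cube R n) x * h x \<partial>\<nu>)"
proof (rule LIMSEQ_I)
  fix e :: real assume e: "e > 0"
  obtain L where L: "poly_vars n L" "\<And>x. x \<in> cube R n \<Longrightarrow> \<bar>h x - poly_eval L x\<bar> < e / 4"
    using poly_dense_cube[OF h, of "e / 4"] e by auto
  obtain N0 where N0: "\<And>N. N \<ge> N0 \<Longrightarrow> \<bar>avg N (poly_eval L) - (\<integral>x. poly_eval L x \<partial>\<nu>)\<bar> < e / 4"
    using LIMSEQ_D[OF avg_poly_tendsto[OF L(1)], of "e / 4"] e by auto
  have 1: "\<bar>(\<integral>x. poly_eval L x \<partial>\<nu>) - (\<integral>x. indicator (cube R n) x * h x \<partial>\<nu>)\<bar> \<le> e / 4"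
    by (rule \<nu>.integral_poly_close[OF h L(2)])
  show "\<exists>no. \<forall>N\<ge>no. norm (avg N h - (\<integral>x. indicator (cube R n) x * h x \<partial>\<nu>)) < e"
  \<comment> \<open>\<open>Suc N0\<close> also ensures \<open>N > 0\<close>, so that
    \<open>avg\<close> is a genuine average.\<close>
  proof (intro exI[of _ "Suc N0"] allI impI)
    fix N assume N: "N \<ge> Suc N0"
    have "\<bar>avg N h - avg N (poly_eval L)\<bar> \<le> e / 4"
      using N L(2) by (intro avg_diff_le) (auto intro: less_imp_le)
    with N0[of N] N 1 e show "norm (avg N h - (\<integral>x. indicator (cube R n) x * h x \<partial>\<nu>)) < e"
      unfolding real_norm_def by linarith
  qed
qed

section \<open>Exponential bound for the normalised partition function\<close>

definition pressure_sum :: "((nat \<Rightarrow> real) \<Rightarrow> real) \<Rightarrow> nat \<Rightarrow> real" where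
  "pressure_sum h N = (\<Sum>s\<in>PiE {..<n} (\<lambda>_. perms N).
     exp (\<Sum>j<N. h (\<lambda>i\<in>{..<n}. act (s i) (xi_vec \<Xi> i N) j))) / (fact N) ^ n"

lemma act_xi_vec:
  assumes "\<sigma> \<in> perms N" "j < N"
  shows "act \<sigma> (xi_vec \<Xi> i N) j = \<Xi> i N (inv \<sigma> j)" "inv \<sigma> j < N"
proof -
  have "inv \<sigma> permutes {..<N}" using assms by (auto simp: perms_def intro: permutes_inv)
  then show "inv \<sigma> j < N" using assms permutes_in_image[of "inv \<sigma>" "{..<N}" j] by simp
  then show "act \<sigma> (xi_vec \<Xi> i N) j = \<Xi> i N (inv \<sigma> j)"
    by (simp add: act_def xi_vec_def)
qed

lemma act_point:
  assumes "s \<in> PiE {..<n} (\<lambda>_. perms N)" "j < N"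
  shows "(\<lambda>i\<in>{..<n}. act (s i) (xi_vec \<Xi> i N) j) = pt N (\<lambda>i. inv (s i) j)"
  unfolding pt_def using assms by (intro restrict_ext act_xi_vec) (auto simp: PiE_iff)

lemma id_in_perms: "id \<in> perms N" by (simp add: perms_def permutes_id)

lemma finite_perms_PiE: "finite (PiE {..<n} (\<lambda>_. perms N))"
  by (intro finite_PiE) auto

lemma pressure_sum_pos: "pressure_sum h N > 0"
proof -
  have "(\<lambda>i\<in>{..<n}. id) \<in> PiE {..<n} (\<lambda>_. perms N)" using id_in_perms by auto
  then have "PiE {..<n} (\<lambda>_. perms N) \<noteq> {}" by blast
  then have "0 < (\<Sum>s\<in>PiE {..<n} (\<lambda>_. perms N). exp (\<Sum>j<N. h (\<lambda>i\<in>{..<n}. act (s i) (xi_vec \<Xi> i N) j)))"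
    by (intro sum_pos finite_perms_PiE) auto
  then show ?thesis by (simp add: pressure_sum_def)
qed

lemma Psym_eq: "Psym n \<Xi> h = limsup (\<lambda>N. ereal (ln (pressure_sum h N) / real N))"
proof -
  have "ereal (1 / real N) * elog (pressure_sum h N) = ereal (ln (pressure_sum h N) / real N)" for N
    using pressure_sum_pos[of h N] by (simp add: elog_def)
  then show ?thesis by (simp add: Psym_def pressure_sum_def)
qed

text \<open>Transposing \<open>n\<close> maps on \<open>{..<N}\<close> into \<open>N\<close> index
  vectors makes the positions independent, and the sum over all such families of vectors is a
  product over \<open>j\<close>. Injectivity of the transposition suffices for the
  inequality.\<close>

lemma sum_functions_le_power:
  fixes g :: "(nat \<Rightarrow> real) \<Rightarrow> real"
  assumes g: "\<And>x. 0 \<le> g x"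
  shows "(\<Sum>f\<in>PiE {..<n} (\<lambda>_. {..<N} \<rightarrow>\<^sub>E {..<N}). \<Prod>j<N. g (pt N (\<lambda>i. f i j)))
    \<le> (\<Sum>k\<in>PiE {..<n} (\<lambda>_. {..<N}). g (pt N k)) ^ N"
proof -
  let ?Q = "PiE {..<n} (\<lambda>_. {..<N} \<rightarrow>\<^sub>E {..<N})" and ?I = "PiE {..<n} (\<lambda>_. {..<N})"
  define \<Phi> where "\<Phi> f = (\<lambda>j\<in>{..<N}. \<lambda>i\<in>{..<n}. f i j)" for f :: "nat \<Rightarrow> nat \<Rightarrow> nat"
  have inj: "inj_on \<Phi> ?Q"
  proof (rule inj_onI, intro ext)
    fix f f' i j assume f: "f \<in> ?Q" "f' \<in> ?Q" and eq: "\<Phi> f = \<Phi> f'"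
    show "f i j = f' i j"
    proof (cases "i < n \<and> j < N")
      case True
      have "\<Phi> f j i = \<Phi> f' j i" using eq by simp
      then show ?thesis using True by (simp add: \<Phi>_def)
    next
      case False
      then show ?thesis using f PiE_arb[OF f(1), of i] PiE_arb[OF f(2), of i]
          PiE_arb[OF PiE_mem[OF f(1), of i], of j] PiE_arb[OF PiE_mem[OF f(2), of i], of j]
        by (cases "i < n") auto
    qed
  qed
  have sub: "\<Phi> ` ?Q \<subseteq> PiE {..<N} (\<lambda>_. ?I)"
  proof (rule image_subsetI)
    fix f assume f: "f \<in> ?Q"
    have "f i j < N" if "i < n" "j < N" for i j
      using PiE_mem[OF PiE_mem[OF f, of i], of j] that by simp
    then show "\<Phi> f \<in> PiE {..<N} (\<lambda>_. ?I)"
      unfolding \<Phi>_def by (intro restrict_PiE_iff[THEN iffD2] ballI) auto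
  qed
  have "(\<Sum>f\<in>?Q. \<Prod>j<N. g (pt N (\<lambda>i. f i j))) = (\<Sum>f\<in>?Q. \<Prod>j<N. g (pt N (\<Phi> f j)))"
    by (intro sum.cong prod.cong arg_cong[of _ _ g]) (auto simp: \<Phi>_def pt_def)
  also have "\<dots> = (\<Sum>F\<in>\<Phi> ` ?Q. \<Prod>j<N. g (pt N (F j)))"
    by (simp add: sum.reindex[OF inj])
  also have "\<dots> \<le> (\<Sum>F\<in>PiE {..<N} (\<lambda>_. ?I). \<Prod>j<N. g (pt N (F j)))"
    using sub by (intro sum_mono2) (auto intro!: finite_PiE prod_nonneg g)
  also have "\<dots> = (\<Prod>j<N. \<Sum>k\<in>?I. g (pt N k))"
    by (rule prod_sum_PiE[symmetric]) (auto intro: finite_PiE)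
  finally show ?thesis by simp
qed

text \<open>\<open>K\<close> counts the grid values and does not depend on \<open>N\<close>. The
  error \<open>exp (real N * e)\<close> is paid twice: to pass to grid values, and to return to the
  original points once permutations have been replaced by maps.\<close>

lemma pressure_sum_le:
  assumes h: "continuous_on (cube R n) h" and e: "e > 0"
  obtains K where "\<And>N. N > 0 \<Longrightarrow>
    pressure_sum h N \<le> exp (2 * real N * e) * ((exp 1 * real (N + 1)) ^ K) ^ n * avg N (\<lambda>x. exp (h x)) ^ N"
proof -
  obtain w where w: "w > 0" "\<And>x y. x \<in> cube R n \<Longrightarrow> y \<in> cube R n \<Longrightarrow> (\<And>i. i < n \<Longrightarrow> \<bar>x i - y i\<bar> \<le> w) \<Longrightarrow> \<bar>h x - h y\<bar> < e"
    using cube_uniformly_continuous[OF h e] by blast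
  \<comment> \<open>Rounding down on a grid that starts at \<open>-R\<close> keeps values between
    \<open>-R\<close> and \<open>R\<close>, so uniform continuity on the cube applies.\<close>
  define q where "q x = - R + w * of_int \<lfloor>(x + R) / w\<rfloor>" for x :: real
  have q: "q x \<in> {-R..R}" "\<bar>x - q x\<bar> \<le> w" if "x \<in> {-R..R}" for x
  proof -
    have "of_int \<lfloor>(x + R) / w\<rfloor> \<le> (x + R) / w" by simp
    then have 1: "w * of_int \<lfloor>(x + R) / w\<rfloor> \<le> x + R" using w(1) by (simp only: pos_le_divide_eq mult.commute)
    have "(x + R) / w < of_int \<lfloor>(x + R) / w\<rfloor> + 1" by linarith
    then have "x + R < (of_int \<lfloor>(x + R) / w\<rfloor> + 1) * w" by (simp only: pos_divide_less_eq[OF w(1)])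
    then have 2: "x + R < w * of_int \<lfloor>(x + R) / w\<rfloor> + w" by (simp add: algebra_simps)
    have 3: "0 \<le> w * of_int \<lfloor>(x + R) / w\<rfloor>" using that w by simp
    show "q x \<in> {-R..R}" "\<bar>x - q x\<bar> \<le> w" using 1 2 3 that by (auto simp: q_def)
  qed
  define B where "B = q ` {-R..R}"
  have fB: "finite B"
  proof -
    have "B \<subseteq> (\<lambda>k. - R + w * of_int k) ` {0..\<lfloor>2 * R / w\<rfloor>}"
    proof
      fix y assume "y \<in> B"
      then obtain x where x: "x \<in> {-R..R}" "y = q x" by (auto simp: B_def)
      have "0 \<le> \<lfloor>(x + R) / w\<rfloor>" using x w by simp
      moreover have "\<lfloor>(x + R) / w\<rfloor> \<le> \<lfloor>2 * R / w\<rfloor>"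
        using x w by (intro floor_mono divide_right_mono) auto
      ultimately show "y \<in> (\<lambda>k. - R + w * of_int k) ` {0..\<lfloor>2 * R / w\<rfloor>}"
        using x(2) by (auto simp: q_def)
    qed
    then show ?thesis by (rule finite_subset) simp
  qed
  show ?thesis
  proof (rule that[of "card B"])
    fix N :: nat assume N: "N > 0"
    have Xi: "\<Xi> i N j \<in> {-R..R}" if "i < n" "j < N" for i j
      using approx that by (auto simp: approx_seq_def)
    define c where "c i k = q (\<Xi> i N k)" for i k
    define G where "G t = exp (\<Sum>j<N. h (\<lambda>i\<in>{..<n}. t i j))" for t :: "nat \<Rightarrow> nat \<Rightarrow> real"
    have cmp: "\<bar>h (pt N k) - h (\<lambda>i\<in>{..<n}. c i (k i))\<bar> \<le> e" if "\<And>i. i < n \<Longrightarrow> k i < N" for k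
    proof (rule less_imp_le, rule w(2))
      show "pt N k \<in> cube R n" using that by (rule pt_in_cube)
      show "(\<lambda>i\<in>{..<n}. c i (k i)) \<in> cube R n"
        unfolding cube_def c_def using q(1) Xi that by (intro restrict_PiE_iff[THEN iffD2]) blast
      show "\<bar>pt N k i - (\<lambda>i\<in>{..<n}. c i (k i)) i\<bar> \<le> w" if i: "i < n" for i
        using q(2)[OF Xi[OF i \<open>\<And>i. i < n \<Longrightarrow> k i < N\<close>[OF i]]] i by (simp add: pt_def c_def)
    qed
    let ?P = "PiE {..<n} (\<lambda>_. perms N)" and ?Q = "PiE {..<n} (\<lambda>_. {..<N} \<rightarrow>\<^sub>E {..<N})"
    let ?S = "\<Sum>k\<in>PiE {..<n} (\<lambda>_. {..<N}). exp (h (pt N k))"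
    let ?A = "\<Sum>s\<in>?P. exp (\<Sum>j<N. h (\<lambda>i\<in>{..<n}. act (s i) (xi_vec \<Xi> i N) j))"
    have "?A \<le> (\<Sum>s\<in>?P. exp (real N * e) * G (\<lambda>i\<in>{..<n}. \<lambda>j\<in>{..<N}. c i (inv (s i) j)))"
    proof (rule sum_mono)
      fix s assume s: "s \<in> ?P"
      have inv: "inv (s i) j < N" if "i < n" "j < N" for i j
        using act_xi_vec(2)[of "s i" N j] s that by auto
      have "(\<Sum>j<N. h (\<lambda>i\<in>{..<n}. act (s i) (xi_vec \<Xi> i N) j)) = (\<Sum>j<N. h (pt N (\<lambda>i. inv (s i) j)))"
        using act_point[OF s] by (intro sum.cong) auto
      also have "\<dots> \<le> (\<Sum>j<N. e + h (\<lambda>i\<in>{..<n}. c i (inv (s i) j)))"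
      proof (rule sum_mono)
        fix j assume "j \<in> {..<N}"
        then have "\<bar>h (pt N (\<lambda>i. inv (s i) j)) - h (\<lambda>i\<in>{..<n}. c i (inv (s i) j))\<bar> \<le> e"
          using inv by (intro cmp) auto
        then show "h (pt N (\<lambda>i. inv (s i) j)) \<le> e + h (\<lambda>i\<in>{..<n}. c i (inv (s i) j))" by linarith
      qed
      also have "\<dots> = real N * e + (\<Sum>j<N. h (\<lambda>i\<in>{..<n}. (\<lambda>i\<in>{..<n}. \<lambda>j\<in>{..<N}. c i (inv (s i) j)) i j))"
      proof -
        have "(\<lambda>i\<in>{..<n}. c i (inv (s i) j)) = (\<lambda>i\<in>{..<n}. (\<lambda>i\<in>{..<n}. \<lambda>j\<in>{..<N}. c i (inv (s i) j)) i j)"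
          if "j < N" for j using that by (intro restrict_ext) auto
        then show ?thesis by (simp add: sum.distrib)
      qed
      finally show "exp (\<Sum>j<N. h (\<lambda>i\<in>{..<n}. act (s i) (xi_vec \<Xi> i N) j)) \<le>
          exp (real N * e) * G (\<lambda>i\<in>{..<n}. \<lambda>j\<in>{..<N}. c i (inv (s i) j))"
        unfolding G_def exp_add[symmetric] by simp
    qed
    also have "\<dots> = exp (real N * e) * (\<Sum>s\<in>?P. G (\<lambda>i\<in>{..<n}. \<lambda>j\<in>{..<N}. c i (inv (s i) j)))"
      by (simp add: sum_distrib_left)
    finally have 1: "?A \<le> exp (real N * e) * (\<Sum>s\<in>?P. G (\<lambda>i\<in>{..<n}. \<lambda>j\<in>{..<N}. c i (inv (s i) j)))" .
    have 2: "(\<Sum>s\<in>?P. G (\<lambda>i\<in>{..<n}. \<lambda>j\<in>{..<N}. c i (inv (s i) j)))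
      \<le> (fact N * (exp 1 * real (N + 1)) ^ card B) ^ n * (\<Sum>f\<in>?Q. G (\<lambda>i\<in>{..<n}. \<lambda>j\<in>{..<N}. c i (f i j))) / (real N ^ N) ^ n"
    proof -
      have "(\<Sum>s\<in>?P. G (\<lambda>i\<in>{..<n}. \<lambda>j\<in>{..<N}. c i (inv (s i) j))) * (real N ^ N) ^ n
        \<le> (fact N * (exp 1 * real (N + 1)) ^ card B) ^ n * (\<Sum>f\<in>?Q. G (\<lambda>i\<in>{..<n}. \<lambda>j\<in>{..<N}. c i (f i j)))"
        by (rule sum_perms_le_sum_functions[OF fB]) (use Xi in \<open>auto simp: B_def c_def G_def\<close>)
      then show ?thesis using N by (simp add: pos_le_divide_eq)
    qed
    have "(\<Sum>f\<in>?Q. G (\<lambda>i\<in>{..<n}. \<lambda>j\<in>{..<N}. c i (f i j))) \<le>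
       (\<Sum>f\<in>?Q. exp (real N * e) * (\<Prod>j<N. exp (h (pt N (\<lambda>i. f i j)))))"
    proof (rule sum_mono)
      fix f assume f: "f \<in> ?Q"
      have fN: "f i j < N" if "i < n" "j < N" for i j
        using PiE_mem[OF PiE_mem[OF f, of i], of j] that by simp
      have "(\<Sum>j<N. h (\<lambda>i\<in>{..<n}. (\<lambda>i\<in>{..<n}. \<lambda>j\<in>{..<N}. c i (f i j)) i j)) = (\<Sum>j<N. h (\<lambda>i\<in>{..<n}. c i (f i j)))"
        by (intro sum.cong arg_cong[of _ _ h] restrict_ext) auto
      also have "\<dots> \<le> (\<Sum>j<N. e + h (pt N (\<lambda>i. f i j)))"
      proof (rule sum_mono)
        fix j assume "j \<in> {..<N}"
        then have "\<bar>h (pt N (\<lambda>i. f i j)) - h (\<lambda>i\<in>{..<n}. c i (f i j))\<bar> \<le> e"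
          using fN by (intro cmp) auto
        then show "h (\<lambda>i\<in>{..<n}. c i (f i j)) \<le> e + h (pt N (\<lambda>i. f i j))" by linarith
      qed
      also have "\<dots> = real N * e + (\<Sum>j<N. h (pt N (\<lambda>i. f i j)))" by (simp add: sum.distrib)
      finally show "G (\<lambda>i\<in>{..<n}. \<lambda>j\<in>{..<N}. c i (f i j)) \<le> exp (real N * e) * (\<Prod>j<N. exp (h (pt N (\<lambda>i. f i j))))"
        unfolding G_def by (simp flip: exp_sum exp_add)
    qed
    also have "\<dots> = exp (real N * e) * (\<Sum>f\<in>?Q. \<Prod>j<N. exp (h (pt N (\<lambda>i. f i j))))"
      by (simp add: sum_distrib_left)
    also have "\<dots> \<le> exp (real N * e) * ?S ^ N"
      by (intro mult_left_mono sum_functions_le_power) simp_all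
    finally have 3: "(\<Sum>f\<in>?Q. G (\<lambda>i\<in>{..<n}. \<lambda>j\<in>{..<N}. c i (f i j))) \<le> exp (real N * e) * ?S ^ N" .
    \<comment> \<open>The factor \<open>fact N ^ n\<close> cancels against the normalisation, and
      the denominator \<open>(real N ^ N) ^ n\<close> turns \<open>?S ^ N\<close> into the
      \<open>N\<close>-th power of \<open>avg\<close>.\<close>
    have "?A \<le> exp (real N * e) * ((fact N * (exp 1 * real (N + 1)) ^ card B) ^ n * (exp (real N * e) * ?S ^ N) / (real N ^ N) ^ n)"
      by (rule order_trans[OF 1 mult_left_mono[OF order_trans[OF 2]]])
        (use 3 in \<open>auto intro!: divide_right_mono mult_left_mono\<close>)
    then have "pressure_sum h N \<le> exp (real N * e) * ((fact N * (exp 1 * real (N + 1)) ^ card B) ^ n * (exp (real N * e) * ?S ^ N) / (real N ^ N) ^ n) / fact N ^ n"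
      unfolding pressure_sum_def by (rule divide_right_mono) simp
    also have "\<dots> = (exp (real N * e) * exp (real N * e)) * ((exp 1 * real (N + 1)) ^ card B) ^ n * (?S ^ N / (real N ^ N) ^ n)"
      by (simp add: power_mult_distrib)
    also have "exp (real N * e) * exp (real N * e) = exp (2 * real N * e)"
      by (simp flip: exp_add)
    also have "?S ^ N / (real N ^ N) ^ n = avg N (\<lambda>x. exp (h x)) ^ N"
      by (simp add: avg_def power_divide mult.commute flip: power_mult)
    finally show "pressure_sum h N \<le> exp (2 * real N * e) * ((exp 1 * real (N + 1)) ^ card B) ^ n * avg N (\<lambda>x. exp (h x)) ^ N" .
  qed
qed

lemma exp_integral_pos:
  fixes h :: "(nat \<Rightarrow> real) \<Rightarrow> real"
  assumes h: "continuous_on (cube R n) h"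
  shows "(\<integral>x. indicator (cube R n) x * exp (h x) \<partial>\<nu>) > 0"
proof -
  obtain B where B: "B \<ge> 0" "\<And>x. x \<in> cube R n \<Longrightarrow> \<bar>h x\<bar> \<le> B" using cube_bounded[OF h] by blast
  have "exp (- B) = (\<integral>x. indicator (cube R n) x * exp (- B) \<partial>\<nu>)"
    using \<nu>.M_cube by (simp add: measure_def)
  also have "\<dots> \<le> (\<integral>x. indicator (cube R n) x * exp (h x) \<partial>\<nu>)"
  proof (intro integral_mono \<nu>.integrable_indicator_cube continuous_intros h)
    fix x
    show "indicator (cube R n) x * exp (- B) \<le> indicator (cube R n) x * exp (h x)"
      using B(2)[of x] by (auto split: split_indicator)
  qed
  finally show ?thesis using exp_gt_zero[of "- B"] by linarith
qed

lemma Psym_le: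
  assumes h: "continuous_on (cube R n) h"
  shows "Psym n \<Xi> h \<le> ereal (ln (\<integral>x. indicator (cube R n) x * exp (h x) \<partial>\<nu>))"
proof (rule ereal_le_epsilon2)
  fix e :: real assume e: "e > 0"
  let ?Z = "\<integral>x. indicator (cube R n) x * exp (h x) \<partial>\<nu>"
  obtain K where K: "\<And>N. N > 0 \<Longrightarrow>
    pressure_sum h N \<le> exp (2 * real N * (e / 2)) * ((exp 1 * real (N + 1)) ^ K) ^ n * avg N (\<lambda>x. exp (h x)) ^ N"
    using pressure_sum_le[OF h, of "e / 2"] e by auto
  have avg: "(\<lambda>N. avg N (\<lambda>x. exp (h x))) \<longlonglongrightarrow> ?Z"
    by (intro avg_continuous_tendsto continuous_intros h)
  have Z: "?Z > 0" by (rule exp_integral_pos[OF h])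
  have ev: "\<forall>\<^sub>F N in sequentially. avg N (\<lambda>x. exp (h x)) > 0"
    using avg Z by (rule order_tendstoD)
  \<comment> \<open>The polynomial factor contributes a term of order \<open>ln N / N\<close> to the
    exponent. The first term is \<open>e\<close> because \<open>pressure_sum_le\<close> doubles the
    \<open>e / 2\<close> put into it.\<close>
  let ?b = "\<lambda>N. e + real (K * n) * ((1 + ln (real (N + 1))) / real N) + ln (avg N (\<lambda>x. exp (h x)))"
  have "Psym n \<Xi> h \<le> limsup (\<lambda>N. ereal (?b N))"
    unfolding Psym_eq
  proof (rule Limsup_mono)
    show "\<forall>\<^sub>F N in sequentially. ereal (ln (pressure_sum h N) / real N) \<le> ereal (?b N)"
      using ev eventually_gt_at_top[of 0]
    proof eventually_elim
      case (elim N)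
      let ?a = "avg N (\<lambda>x. exp (h x))"
      have pos: "0 < exp (real N * e)" "0 < (exp 1 * real (N + 1)) ^ (K * n)" "0 < ?a ^ N"
        using elim by auto
      have "ln (pressure_sum h N) \<le> ln (exp (real N * e) * (exp 1 * real (N + 1)) ^ (K * n) * ?a ^ N)"
        using K[OF elim(2)] pressure_sum_pos[of h N] by (intro ln_mono) (auto simp: power_mult)
      also have "\<dots> = real N * e + real (K * n) * (1 + ln (real (N + 1))) + real N * ln ?a"
        using pos elim by (simp add: ln_mult ln_realpow)
      finally show ?case using elim(2) by (simp add: field_simps)
    qed
  qed
  also have "\<dots> = ereal (e + real (K * n) * 0 + ln ?Z)"
  proof (rule lim_imp_Limsup)
    have "(\<lambda>N. (1 + ln (real (N + 1))) / real N) \<longlonglongrightarrow> 0"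
      by real_asymp
    then show "(\<lambda>N. ereal (?b N)) \<longlonglongrightarrow> ereal (e + real (K * n) * 0 + ln ?Z)"
      using avg Z by (intro tendsto_ereal tendsto_intros) auto
  qed simp
  finally show "Psym n \<Xi> h \<le> ereal (ln ?Z) + ereal e" by (simp add: add.commute)
qed

text \<open>It suffices to consider real upper bounds \<open>c\<close> of \<open>Isym_cal\<close>;
  through \<open>Psym_le\<close> such a \<open>c\<close> becomes a Gibbs bound for every continuous
  \<open>h\<close>.\<close>

lemma rel_entropy_le_Isym_cal: "rel_entropy \<mu> \<nu> \<le> Isym_cal R n \<mu> \<Xi>"
proof (rule ereal_le_real)
  fix c assume c: "Isym_cal R n \<mu> \<Xi> \<le> ereal c"
  have s\<nu>: "sets \<mu> = sets \<nu>" using sets_M \<nu>.sets_M by simp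
  have cont: "(\<integral>x. h x \<partial>\<mu>) - ln (\<integral>x. exp (h x) \<partial>\<nu>) \<le> c" if h: "continuous_on UNIV h" for h :: "(nat \<Rightarrow> real) \<Rightarrow> real"
  proof -
    have hc: "continuous_on (cube R n) h" using h continuous_on_subset by blast
    have "ereal (LINT x:cube R n|\<mu>. h x) - Psym n \<Xi> h \<le> Isym_cal R n \<mu> \<Xi>"
      unfolding Isym_cal_def using hc by (intro SUP_upper) auto
    also note c
    finally have 1: "ereal (LINT x:cube R n|\<mu>. h x) - Psym n \<Xi> h \<le> ereal c" .
    have 2: "(LINT x:cube R n|\<mu>. h x) = (\<integral>x. h x \<partial>\<mu>)"
      unfolding set_lebesgue_integral_def using integral_indicator_cube[OF h] by simp
    have "(\<integral>x. indicator (cube R n) x * exp (h x) \<partial>\<nu>) = (\<integral>x. exp (h x) \<partial>\<nu>)"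
      by (intro \<nu>.integral_indicator_cube continuous_intros h)
    then have "Psym n \<Xi> h \<le> ereal (ln (\<integral>x. exp (h x) \<partial>\<nu>))" using Psym_le[OF hc] by simp
    then have "ereal (LINT x:cube R n|\<mu>. h x) - ereal (ln (\<integral>x. exp (h x) \<partial>\<nu>)) \<le> ereal (LINT x:cube R n|\<mu>. h x) - Psym n \<Xi> h"
      by (intro ereal_minus_mono) auto
    with 1 have "ereal (LINT x:cube R n|\<mu>. h x) - ereal (ln (\<integral>x. exp (h x) \<partial>\<nu>)) \<le> ereal c" by (rule order_trans[rotated])
    then show ?thesis using 2 by simp
  qed
  \<comment> \<open>The extension to measurable functions concerns Borel measures on a metric space,
    so both measures are transported along the inclusion into the space of all functions.\<close>
  let ?M = "distr \<mu> borel (\<lambda>x. x)" and ?N = "distr \<nu> borel (\<lambda>x. x)"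
  note [measurable] = measurable_id \<nu>.measurable_id
  show "rel_entropy \<mu> \<nu> \<le> ereal c"
  proof (rule rel_entropy_le_of_gibbs_bound[OF prob_space_axioms \<nu>.prob_space_axioms s\<nu>])
    fix h :: "(nat \<Rightarrow> real) \<Rightarrow> real" and B
    assume h[measurable]: "h \<in> borel_measurable \<nu>" and hB: "\<And>x. \<bar>h x\<bar> \<le> B"
    \<comment> \<open>\<open>h\<close> is measurable on extensional points only. Restricting the
      argument first extends it to a Borel function and leaves it unchanged on those points.\<close>
    define g where "g x = h (restrict x {..<n})" for x
    have "(\<lambda>x :: nat \<Rightarrow> real. restrict x {..<n}) \<in> measurable borel (PiM {..<n} (\<lambda>_. lborel))"
      by (intro measurable_restrict) simp
    then have "(\<lambda>x :: nat \<Rightarrow> real. restrict x {..<n}) \<in> measurable borel \<nu>"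
      using \<nu>.sets_M by (simp cong: measurable_cong_sets)
    then have g[measurable]: "g \<in> borel_measurable borel"
      unfolding g_def[abs_def] by (rule measurable_compose) (rule h)
    have "(\<integral>x. g x \<partial>?M) - ln (\<integral>x. exp (g x) \<partial>?N) \<le> c"
    proof (rule gibbs_bound_continuous_imp_measurable[where B = B])
      fix k :: "(nat \<Rightarrow> real) \<Rightarrow> real" and B assume k: "continuous_on UNIV k"
      have [measurable]: "k \<in> borel_measurable borel" by (rule borel_measurable_continuous_onI[OF k])
      show "(\<integral>x. k x \<partial>?M) - ln (\<integral>x. exp (k x) \<partial>?N) \<le> c"
        using cont[OF k] by (simp add: integral_distr)
    qed (auto intro: prob_space_distr \<nu>.prob_space_distr simp: hB g_def[abs_def] g[unfolded g_def[abs_def]])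
    moreover have "(\<integral>x. g x \<partial>?M) = (\<integral>x. h x \<partial>\<mu>)"
    proof -
      have "(\<integral>x. g x \<partial>?M) = (\<integral>x. g x \<partial>\<mu>)" by (simp add: integral_distr)
      also have "\<dots> = (\<integral>x. h x \<partial>\<mu>)"
        by (intro Bochner_Integration.integral_cong) (auto simp: g_def space_M PiE_restrict)
      finally show ?thesis .
    qed
    moreover have "(\<integral>x. exp (g x) \<partial>?N) = (\<integral>x. exp (h x) \<partial>\<nu>)"
    proof -
      have "(\<integral>x. exp (g x) \<partial>?N) = (\<integral>x. exp (g x) \<partial>\<nu>)" by (simp add: integral_distr)
      also have "\<dots> = (\<integral>x. exp (h x) \<partial>\<nu>)"
        by (intro Bochner_Integration.integral_cong) (auto simp: g_def \<nu>.space_M PiE_restrict)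
      finally show ?thesis .
    qed
    ultimately show "(\<integral>x. h x \<partial>\<mu>) - ln (\<integral>x. exp (h x) \<partial>\<nu>) \<le> c" by simp
  qed
qed

end

subsection \<open>Mean values on microstates\<close>

text \<open>Telescoping, one factor at a time; \<open>R \<ge> 1\<close> lets both terms carry the
  same power of \<open>R\<close>.\<close>

lemma prod_list_diff_le:
  fixes x y :: "nat \<Rightarrow> real"
  assumes "\<And>i. i \<in> set is \<Longrightarrow> \<bar>x i\<bar> \<le> R" "\<And>i. i \<in> set is \<Longrightarrow> \<bar>y i\<bar> \<le> R"
    and "set is \<subseteq> {..<n}" and R: "R \<ge> 1"
  shows "\<bar>prod_list (map x is) - prod_list (map y is)\<bar> \<le> real (length is) * R ^ length is * (\<Sum>i<n. \<bar>x i - y i\<bar>)"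
  using assms(1-3)
proof (induction "is")
  case (Cons a "is")
  let ?D = "\<Sum>i<n. \<bar>x i - y i\<bar>" and ?l = "real (length is)" and ?p = "R ^ length is"
  have D: "?D \<ge> 0" by (intro sum_nonneg) auto
  have p: "?p \<ge> 0" using R by simp
  have a: "\<bar>x a - y a\<bar> \<le> ?D"
    using Cons.prems(3) by (intro member_le_sum) auto
  have IH: "\<bar>prod_list (map x is) - prod_list (map y is)\<bar> \<le> ?l * ?p * ?D" using Cons by auto
  have "prod_list (map x (a # is)) - prod_list (map y (a # is))
    = x a * (prod_list (map x is) - prod_list (map y is)) + (x a - y a) * prod_list (map y is)"
    by (simp add: algebra_simps)
  also have "\<bar>\<dots>\<bar> \<le> \<bar>x a\<bar> * \<bar>prod_list (map x is) - prod_list (map y is)\<bar> + \<bar>x a - y a\<bar> * \<bar>prod_list (map y is)\<bar>"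
    by (rule order_trans[OF abs_triangle_ineq]) (simp add: abs_mult)
  also have "\<dots> \<le> R * (?l * ?p * ?D) + ?D * ?p"
    using Cons.prems IH a p D R by (intro add_mono mult_mono prod_list_abs_le) auto
  also have "\<dots> \<le> R * (?l * ?p * ?D) + R * (?D * ?p)"
    using R D p mult_right_mono[of 1 R "?D * ?p"] by simp
  also have "\<dots> = real (length (a # is)) * R ^ length (a # is) * ?D"
    by (simp add: algebra_simps)
  finally show ?case .
qed simp

context approximated
begin

lemma poly_mean_close:
  fixes x :: "nat \<Rightarrow> nat \<Rightarrow> real"
  assumes N: "N > 0" and \<delta>: "\<delta> > 0"
    and mom: "\<And>is. set is \<subseteq> {..<n} \<Longrightarrow> 1 \<le> length is \<Longrightarrow> length is \<le> m \<Longrightarrow>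
        \<bar>kappa N (\<lambda>j. prod_list (map (x j) is)) - (\<integral>y. prod_list (map y is) \<partial>\<mu>)\<bar> < \<delta>"
  shows "poly_vars n L \<Longrightarrow> (\<And>c is. (c, is) \<in> set L \<Longrightarrow> length is \<le> m) \<Longrightarrow>
    \<bar>kappa N (\<lambda>j. poly_eval L (x j)) - (\<integral>y. poly_eval L y \<partial>\<mu>)\<bar> \<le> (\<Sum>(c, is)\<leftarrow>L. \<bar>c\<bar>) * \<delta>"
proof (induction L)
  case Nil
  then show ?case by (simp add: kappa_def poly_eval_def[abs_def])
next
  case (Cons a L)
  obtain c "is" where a: "a = (c, is)" by (cases a)
  have l: "set is \<subseteq> {..<n}" "length is \<le> m" using Cons.prems a by auto
  have 1: "\<bar>kappa N (\<lambda>j. prod_list (map (x j) is)) - (\<integral>y. prod_list (map y is) \<partial>\<mu>)\<bar> \<le> \<delta>"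
  \<comment> \<open>The moment conditions start at length 1; the constant monomial has mean 1 on
    both sides.\<close>
  proof (cases "is = []")
    case True
    then show ?thesis using N \<delta> by (simp add: kappa_def prob_space)
  next
    case False
    then show ?thesis using mom[OF l(1) _ l(2)] by (cases "is") auto
  qed
  have IH: "\<bar>kappa N (\<lambda>j. poly_eval L (x j)) - (\<integral>y. poly_eval L y \<partial>\<mu>)\<bar> \<le> (\<Sum>(c, is)\<leftarrow>L. \<bar>c\<bar>) * \<delta>"
    using Cons a by auto
  have 2: "kappa N (\<lambda>j. poly_eval (a # L) (x j)) = c * kappa N (\<lambda>j. prod_list (map (x j) is)) + kappa N (\<lambda>j. poly_eval L (x j))"
    by (simp add: kappa_def a sum.distrib add_divide_distrib sum_distrib_left)
  have 3: "(\<integral>y. poly_eval (a # L) y \<partial>\<mu>) = c * (\<integral>y. prod_list (map y is) \<partial>\<mu>) + (\<integral>y. poly_eval L y \<partial>\<mu>)"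
    unfolding integral_poly_eval by (simp add: a)
  have "\<bar>kappa N (\<lambda>j. poly_eval (a # L) (x j)) - (\<integral>y. poly_eval (a # L) y \<partial>\<mu>)\<bar>
    = \<bar>c * (kappa N (\<lambda>j. prod_list (map (x j) is)) - (\<integral>y. prod_list (map y is) \<partial>\<mu>))
       + (kappa N (\<lambda>j. poly_eval L (x j)) - (\<integral>y. poly_eval L y \<partial>\<mu>))\<bar>"
    unfolding 2 3 by (simp add: algebra_simps)
  also have "\<dots> \<le> \<bar>c\<bar> * \<bar>kappa N (\<lambda>j. prod_list (map (x j) is)) - (\<integral>y. prod_list (map y is) \<partial>\<mu>)\<bar>
       + \<bar>kappa N (\<lambda>j. poly_eval L (x j)) - (\<integral>y. poly_eval L y \<partial>\<mu>)\<bar>"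
    by (rule order_trans[OF abs_triangle_ineq]) (simp add: abs_mult)
  also have "\<dots> \<le> \<bar>c\<bar> * \<delta> + (\<Sum>(c, is)\<leftarrow>L. \<bar>c\<bar>) * \<delta>"
    by (intro add_mono mult_left_mono 1 IH) auto
  also have "\<dots> = (\<Sum>(c, is)\<leftarrow>a # L. \<bar>c\<bar>) * \<delta>" by (simp add: a distrib_right)
  finally show ?case .
qed

lemma Delta_sym_mean_close:
  assumes h: "continuous_on (cube R n) h" and e: "e > 0"
  obtains m \<delta> where "\<delta> > 0" "\<And>N s. N > 0 \<Longrightarrow> s \<in> Delta_sym R \<mu> \<Xi> n N m \<delta> \<Longrightarrow>
     \<bar>kappa N (\<lambda>j. h (\<lambda>i\<in>{..<n}. act (s i) (xi_vec \<Xi> i N) j)) - (\<integral>x. indicator (cube R n) x * h x \<partial>\<mu>)\<bar> \<le> e"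
proof -
  obtain L where L: "poly_vars n L" "\<And>x. x \<in> cube R n \<Longrightarrow> \<bar>h x - poly_eval L x\<bar> < e / 3"
    using poly_dense_cube[OF h, of "e / 3"] e by auto
  define A where "A = (\<Sum>(c, is)\<leftarrow>L. \<bar>c\<bar>)"
  have A: "A \<ge> 0" unfolding A_def by (intro sum_list_nonneg) auto
  \<comment> \<open>\<open>A + 1\<close> avoids division by 0 and gives
    \<open>A * \<delta> \<le> e / 3\<close>.\<close>
  define \<delta> where "\<delta> = e / (3 * (A + 1))"
  have \<delta>: "\<delta> > 0" using A e by (simp add: \<delta>_def)
  \<comment> \<open>A crude bound for all degrees that occur in \<open>L\<close>.\<close>
  define m where "m = sum_list (map (\<lambda>(c, is). length is) L)"
  have m: "length is \<le> m" if "(c, is) \<in> set L" for c "is"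
  proof -
    have "length is \<in> set (map (\<lambda>(c, is). length is) L)" using that by force
    then show ?thesis unfolding m_def by (rule member_le_sum_list) simp
  qed
  have 1: "\<bar>(\<integral>x. poly_eval L x \<partial>\<mu>) - (\<integral>x. indicator (cube R n) x * h x \<partial>\<mu>)\<bar> \<le> e / 3"
    by (rule integral_poly_close[OF h L(2)])
  show ?thesis
  proof (rule that[OF \<delta>, of m])
    fix N s assume N: "N > 0" and s: "s \<in> Delta_sym R \<mu> \<Xi> n N m \<delta>"
    let ?x = "\<lambda>j. \<lambda>i\<in>{..<n}. act (s i) (xi_vec \<Xi> i N) j"
    have sP: "s \<in> PiE {..<n} (\<lambda>_. perms N)" using s by (simp add: Delta_sym_def)
    have cube: "?x j \<in> cube R n" if "j < N" for j
      unfolding act_point[OF sP that] using act_xi_vec(2)[OF _ that] PiE_mem[OF sP]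
      by (intro pt_in_cube) auto
    have mom: "\<bar>kappa N (\<lambda>j. prod_list (map (?x j) is)) - (\<integral>y. prod_list (map y is) \<partial>\<mu>)\<bar> < \<delta>"
      if "is": "set is \<subseteq> {..<n}" "1 \<le> length is" "length is \<le> m" for "is"
    proof -
      have "\<bar>kappa N (\<lambda>j. prod_list (map (\<lambda>i. (\<lambda>i\<in>{..<n}. act (s i) (xi_vec \<Xi> i N)) i j) is)) - (\<integral>y. prod_list (map (\<lambda>i. y i) is) \<partial>\<mu>)\<bar> < \<delta>"
        using s "is" unfolding Delta_sym_def Delta_R_def by blast
      moreover have "map (\<lambda>i. (\<lambda>i\<in>{..<n}. act (s i) (xi_vec \<Xi> i N)) i j) is = map (?x j) is" for j
        using "is"(1) by (intro map_cong) auto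
      ultimately show ?thesis by (simp only:)
    qed
    have "\<bar>kappa N (\<lambda>j. poly_eval L (?x j)) - (\<integral>y. poly_eval L y \<partial>\<mu>)\<bar> \<le> (\<Sum>(c, is)\<leftarrow>L. \<bar>c\<bar>) * \<delta>"
      by (rule poly_mean_close[OF N \<delta> mom L(1) m])
    also have "\<dots> \<le> e / 3" unfolding A_def[symmetric] using A e by (simp add: \<delta>_def field_simps)
    finally have 2: "\<bar>kappa N (\<lambda>j. poly_eval L (?x j)) - (\<integral>y. poly_eval L y \<partial>\<mu>)\<bar> \<le> e / 3" .
    have "\<bar>(\<Sum>j<N. h (?x j)) - (\<Sum>j<N. poly_eval L (?x j))\<bar> \<le> (\<Sum>j<N. \<bar>h (?x j) - poly_eval L (?x j)\<bar>)"
      unfolding sum_subtractf[symmetric] by (rule sum_abs)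
    also have "\<dots> \<le> (\<Sum>j<N. e / 3)" using L(2)[OF cube] by (intro sum_mono less_imp_le) auto
    finally have "\<bar>kappa N (\<lambda>j. h (?x j)) - kappa N (\<lambda>j. poly_eval L (?x j))\<bar> \<le> e / 3"
      using N unfolding kappa_def diff_divide_distrib[symmetric]
      by (simp add: abs_divide divide_le_eq mult.commute)
    with 1 2 show "\<bar>kappa N (\<lambda>j. h (?x j)) - (\<integral>x. indicator (cube R n) x * h x \<partial>\<mu>)\<bar> \<le> e"
      by linarith
  qed
qed

section \<open>Mutual pressure against microstates\<close>

definition Delta_log :: "nat \<Rightarrow> real \<Rightarrow> nat \<Rightarrow> ereal" where
  "Delta_log m \<delta> N = ereal (1 / real N) * elog (real (card (Delta_sym R \<mu> \<Xi> n N m \<delta>)) / (fact N) ^ n)"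

lemma Isym_eq: "Isym R n \<mu> \<Xi> = - (INF m. INF \<delta>\<in>{0<..}. limsup (Delta_log m \<delta>))"
  unfolding Isym_def Delta_log_def ..

lemma finite_Delta_sym: "finite (Delta_sym R \<mu> \<Xi> n N m \<delta>)"
  unfolding Delta_sym_def by (rule finite_subset[OF _ finite_perms_PiE]) auto

text \<open>An exponential Chebyshev bound: of the pressure sum keep only the part over
  \<open>Delta_sym\<close>, where every exponent is at least \<open>N * (?I - e)\<close>.\<close>

lemma Isym_cal_le_Isym: "Isym_cal R n \<mu> \<Xi> \<le> Isym R n \<mu> \<Xi>"
  unfolding Isym_cal_def
proof (rule SUP_least)
  fix h :: "(nat \<Rightarrow> real) \<Rightarrow> real" assume "h \<in> {h. continuous_on (cube R n) h}"
  then have h: "continuous_on (cube R n) h" by simp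
  let ?I = "\<integral>x. indicator (cube R n) x * h x \<partial>\<mu>"
  let ?J = "INF m. INF \<delta>\<in>{0<..}. limsup (Delta_log m \<delta>)"
  have "?J \<le> (Psym n \<Xi> h + ereal (- ?I)) + ereal e" if e: "e > 0" for e :: real
  proof -
    obtain m \<delta> where m: "\<delta> > 0" "\<And>N s. N > 0 \<Longrightarrow> s \<in> Delta_sym R \<mu> \<Xi> n N m \<delta> \<Longrightarrow>
     \<bar>kappa N (\<lambda>j. h (\<lambda>i\<in>{..<n}. act (s i) (xi_vec \<Xi> i N) j)) - ?I\<bar> \<le> e"
      by (rule Delta_sym_mean_close[OF h e]) (rule that)
    have "?J \<le> limsup (Delta_log m \<delta>)"
      using m(1) by (intro INF_lower2[of m] INF_lower2[of \<delta>]) auto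
    also have "\<dots> \<le> limsup (\<lambda>N. ereal (ln (pressure_sum h N) / real N) + ereal (e - ?I))"
    proof (rule Limsup_mono)
      show "\<forall>\<^sub>F N in sequentially. Delta_log m \<delta> N \<le> ereal (ln (pressure_sum h N) / real N) + ereal (e - ?I)"
        using eventually_gt_at_top[of 0]
      proof eventually_elim
        case (elim N)
        let ?D = "Delta_sym R \<mu> \<Xi> n N m \<delta>"
        show ?case
        proof (cases "card ?D = 0")
          case True
          then show ?thesis using elim by (simp add: Delta_log_def elog_def)
        next
          case False
          have "real (card ?D) * exp (real N * (?I - e)) = (\<Sum>s\<in>?D. exp (real N * (?I - e)))" by simp
          also have "\<dots> \<le> (\<Sum>s\<in>?D. exp (\<Sum>j<N. h (\<lambda>i\<in>{..<n}. act (s i) (xi_vec \<Xi> i N) j)))"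
          proof (rule sum_mono)
            fix s assume "s \<in> ?D"
            from m(2)[OF elim this] have "?I - e \<le> kappa N (\<lambda>j. h (\<lambda>i\<in>{..<n}. act (s i) (xi_vec \<Xi> i N) j))"
              by linarith
            then have "real N * (?I - e) \<le> real N * kappa N (\<lambda>j. h (\<lambda>i\<in>{..<n}. act (s i) (xi_vec \<Xi> i N) j))"
              by (intro mult_left_mono) auto
            then show "exp (real N * (?I - e)) \<le> exp (\<Sum>j<N. h (\<lambda>i\<in>{..<n}. act (s i) (xi_vec \<Xi> i N) j))"
              using elim by (simp add: kappa_def)
          qed
          also have "\<dots> \<le> (\<Sum>s\<in>PiE {..<n} (\<lambda>_. perms N). exp (\<Sum>j<N. h (\<lambda>i\<in>{..<n}. act (s i) (xi_vec \<Xi> i N) j)))"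
            by (intro sum_mono2 finite_perms_PiE) (auto simp: Delta_sym_def)
          finally have "real (card ?D) * exp (real N * (?I - e)) / fact N ^ n \<le> pressure_sum h N"
            unfolding pressure_sum_def by (rule divide_right_mono) simp
          then have le: "(real (card ?D) / fact N ^ n) * exp (real N * (?I - e)) \<le> pressure_sum h N" by simp
          have pos: "real (card ?D) / fact N ^ n > 0" using False by simp
          have "ln (real (card ?D) / fact N ^ n) + real N * (?I - e) = ln ((real (card ?D) / fact N ^ n) * exp (real N * (?I - e)))"
            using pos by (simp only: ln_mult_pos exp_gt_zero ln_exp)
          also have "\<dots> \<le> ln (pressure_sum h N)" 
            using le mult_pos_pos[OF pos exp_gt_zero] by (intro ln_mono)
          finally have "ln (real (card ?D) / fact N ^ n) \<le> ln (pressure_sum h N) + real N * (e - ?I)"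
            by (simp add: algebra_simps)
          then have "ln (real (card ?D) / fact N ^ n) / real N \<le> (ln (pressure_sum h N) + real N * (e - ?I)) / real N"
            by (rule divide_right_mono) simp
          also have "\<dots> = ln (pressure_sum h N) / real N + (e - ?I)" using elim by (simp add: add_divide_distrib)
          finally show ?thesis using pos unfolding Delta_log_def elog_def by simp
        qed
      qed
    qed
    also have "\<dots> = Psym n \<Xi> h + ereal (e - ?I)"
      unfolding Psym_eq by (intro Limsup_add_ereal_right) auto
    also have "\<dots> = (Psym n \<Xi> h + ereal (- ?I)) + ereal e" by (simp add: add.assoc)
    finally show ?thesis .
  qed
  then have "?J \<le> Psym n \<Xi> h + ereal (- ?I)" by (rule ereal_le_epsilon2)
  then have "ereal ?I - Psym n \<Xi> h \<le> - ?J"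
    by (cases "Psym n \<Xi> h"; cases ?J) auto
  then show "ereal (LINT x:cube R n|\<mu>. h x) - Psym n \<Xi> h \<le> Isym R n \<mu> \<Xi>"
    unfolding Isym_eq by (simp add: set_lebesgue_integral_def)
qed

end

subsection \<open>Sorted vectors with close moments\<close>

text \<open>The part of \<open>u\<close> in the layer between 0 and \<open>w\<close>; shifts by
  multiples of \<open>w\<close> slice a number into layers, as in \<open>sum_ramp\<close>.\<close>

definition ramp :: "real \<Rightarrow> real \<Rightarrow> real" where
  "ramp w u = max 0 (min w u)"

lemma sum_ramp: "w \<ge> 0 \<Longrightarrow> (\<Sum>k<K. ramp w (u - real k * w)) = max 0 (min (real K * w) u)"
proof (induction K)
  case (Suc K)
  have step: "max 0 (min a u) + ramp w (u - a) = max 0 (min (a + w) u)" if "0 \<le> a" for a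
    using that Suc.prems by (auto simp: ramp_def max_def min_def)
  have "(\<Sum>k<Suc K. ramp w (u - real k * w)) = max 0 (min (real K * w) u) + ramp w (u - real K * w)"
    using Suc by simp
  also have "\<dots> = max 0 (min (real (Suc K) * w) u)"
    using Suc.prems by (subst step) (auto simp: distrib_right add.commute)
  finally show ?case .
qed (simp add: max_def min_def)

lemma mono_ramp: "a \<le> b \<Longrightarrow> ramp w a \<le> ramp w b"
  by (auto simp: ramp_def)

lemma ramp_bounds: "w \<ge> 0 \<Longrightarrow> 0 \<le> ramp w u" "w \<ge> 0 \<Longrightarrow> ramp w u \<le> w"
  by (auto simp: ramp_def)

text \<open>Where both monotone sequences take extreme values, their difference cannot change sign.\<close>

lemma sum_abs_diff_monotone_le:
  fixes u v :: "nat \<Rightarrow> real"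
  assumes mono: "\<And>j k. j \<le> k \<Longrightarrow> k < N \<Longrightarrow> u j \<le> u k" "\<And>j k. j \<le> k \<Longrightarrow> k < N \<Longrightarrow> v j \<le> v k"
    and bd: "\<And>j. j < N \<Longrightarrow> u j \<in> {0..w}" "\<And>j. j < N \<Longrightarrow> v j \<in> {0..w}"
  shows "(\<Sum>j<N. \<bar>u j - v j\<bar>) \<le> \<bar>(\<Sum>j<N. u j) - (\<Sum>j<N. v j)\<bar>
    + 2 * w * (real (card {j. j < N \<and> 0 < u j \<and> u j < w}) + real (card {j. j < N \<and> 0 < v j \<and> v j < w}))"
proof -
  define Bu where "Bu = {j. j < N \<and> 0 < u j \<and> u j < w}"
  define Bv where "Bv = {j. j < N \<and> 0 < v j \<and> v j < w}"
  define Bad where "Bad = Bu \<union> Bv"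
  define G where "G = {..<N} - Bad"
  have fin: "finite Bad" "finite G" by (auto simp: Bad_def Bu_def Bv_def G_def)
  have split: "{..<N} = G \<union> Bad" "G \<inter> Bad = {}" by (auto simp: G_def Bad_def Bu_def Bv_def)
  have G: "(u j = 0 \<or> u j = w) \<and> (v j = 0 \<or> v j = w)" "j < N" if "j \<in> G" for j
    using that bd[of j] by (force simp: G_def Bad_def Bu_def Bv_def)+
  have sum_split: "(\<Sum>j<N. F j) = (\<Sum>j\<in>G. F j) + (\<Sum>j\<in>Bad. F j)" for F :: "nat \<Rightarrow> real"
    unfolding split(1) by (rule sum.union_disjoint[OF fin(2,1) split(2)])
  have badN: "j < N" if "j \<in> Bad" for j using that by (auto simp: Bad_def Bu_def Bv_def)
  have badle: "\<bar>u j - v j\<bar> \<le> w" if "j \<in> Bad" for j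
    using bd[OF badN[OF that]] by (auto simp: abs_le_iff)
  have sb: "(\<Sum>j\<in>Bad. \<bar>u j - v j\<bar>) \<le> w * real (card Bad)"
    using sum_bounded_above[of Bad "\<lambda>j. \<bar>u j - v j\<bar>" w] badle by (simp add: mult.commute)
  have "(\<forall>j\<in>G. v j \<le> u j) \<or> (\<forall>j\<in>G. u j \<le> v j)"
  proof (rule ccontr)
    assume "\<not> ?thesis"
    then obtain j k where jk: "j \<in> G" "u j < v j" "k \<in> G" "v k < u k" by (auto simp: not_le)
    \<comment> \<open>By monotonicity the values of \<open>u\<close> force \<open>j < k\<close>,
      while those of \<open>v\<close> force \<open>k < j\<close>.\<close>
    have "u j = 0" "v j = w" "v k = 0" "u k = w"
      using G[OF jk(1)] G[OF jk(3)] jk bd[of j] bd[of k] by auto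
    then show False
      using mono(1)[of k j] mono(2)[of j k] G(2)[OF jk(1)] G(2)[OF jk(3)] jk by (cases "j \<le> k") auto
  qed
  then have "(\<Sum>j\<in>G. \<bar>u j - v j\<bar>) = \<bar>\<Sum>j\<in>G. u j - v j\<bar>"
  proof
    assume *: "\<forall>j\<in>G. v j \<le> u j"
    then have "(\<Sum>j\<in>G. \<bar>u j - v j\<bar>) = (\<Sum>j\<in>G. u j - v j)" by (intro sum.cong) auto
    moreover have "(\<Sum>j\<in>G. u j - v j) \<ge> 0" using * by (intro sum_nonneg) auto
    ultimately show ?thesis by simp
  next
    assume *: "\<forall>j\<in>G. u j \<le> v j"
    then have "(\<Sum>j\<in>G. \<bar>u j - v j\<bar>) = (\<Sum>j\<in>G. - (u j - v j))" by (intro sum.cong) auto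
    also have "\<dots> = - (\<Sum>j\<in>G. u j - v j)" by (rule sum_negf)
    moreover have "(\<Sum>j\<in>G. u j - v j) \<le> 0" using * by (intro sum_nonpos) auto
    ultimately show ?thesis by simp
  qed
  also have "\<dots> = \<bar>(\<Sum>j<N. u j - v j) - (\<Sum>j\<in>Bad. u j - v j)\<bar>"
    using sum_split[of "\<lambda>j. u j - v j"] by simp
  also have "\<dots> \<le> \<bar>\<Sum>j<N. u j - v j\<bar> + \<bar>\<Sum>j\<in>Bad. u j - v j\<bar>" by (rule abs_triangle_ineq4)
  also have "\<bar>\<Sum>j\<in>Bad. u j - v j\<bar> \<le> (\<Sum>j\<in>Bad. \<bar>u j - v j\<bar>)" by (rule sum_abs)
  finally have "(\<Sum>j\<in>G. \<bar>u j - v j\<bar>) \<le> \<bar>\<Sum>j<N. u j - v j\<bar> + w * real (card Bad)" using sb by linarith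
  \<comment> \<open>Bad positions count twice: in the sum of distances itself, and when the signed
    sum is extended from \<open>G\<close> to all positions.\<close>
  then have 1: "(\<Sum>j<N. \<bar>u j - v j\<bar>) \<le> \<bar>(\<Sum>j<N. u j) - (\<Sum>j<N. v j)\<bar> + 2 * (w * real (card Bad))"
    using sb by (simp add: sum_split[of "\<lambda>j. \<bar>u j - v j\<bar>"] sum_subtractf)
  show ?thesis
  proof (cases "N = 0")
    case False
    then have w: "w \<ge> 0" using bd(1)[of 0] by auto
    have "card Bad \<le> card Bu + card Bv" unfolding Bad_def by (rule card_Un_le)
    then have "w * real (card Bad) \<le> w * (real (card Bu) + real (card Bv))"
      using w by (intro mult_left_mono) auto
    then show ?thesis using 1 unfolding Bu_def[symmetric] Bv_def[symmetric] by (simp add: algebra_simps)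
  qed simp
qed

text \<open>The open layers are disjoint, so each position lies strictly inside at most one of
  them.\<close>

lemma sum_card_ramp_interior_le:
  fixes x :: "nat \<Rightarrow> real"
  assumes w: "w > 0"
  shows "(\<Sum>k<K. card {j. j < N \<and> 0 < ramp w (x j - real k * w) \<and> ramp w (x j - real k * w) < w}) \<le> N"
proof -
  have "(\<Sum>k<K. card {j. j < N \<and> 0 < ramp w (x j - real k * w) \<and> ramp w (x j - real k * w) < w})
    = card (SIGMA k:{..<K}. {j. j < N \<and> 0 < ramp w (x j - real k * w) \<and> ramp w (x j - real k * w) < w})"
    by (subst card_SigmaI) auto
  also have "\<dots> \<le> card {..<N}"
  proof (rule card_inj_on_le[where f = snd])
    show "inj_on snd (SIGMA k:{..<K}. {j. j < N \<and> 0 < ramp w (x j - real k * w) \<and> ramp w (x j - real k * w) < w})"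
    proof (rule inj_onI, clarsimp)
      fix k l j assume kl: "0 < ramp w (x j - real k * w)" "ramp w (x j - real k * w) < w"
        "0 < ramp w (x j - real l * w)" "ramp w (x j - real l * w) < w"
      have *: False if "a < b" "ramp w (x j - real a * w) < w" "0 < ramp w (x j - real b * w)" for a b :: nat
      proof -
        have "x j < real a * w + w" using that w by (auto simp: ramp_def max_def min_def split: if_splits)
        moreover have "real b * w < x j" using that w by (auto simp: ramp_def max_def min_def split: if_splits)
        moreover have "real (a + 1) * w \<le> real b * w" using that(1) w by (intro mult_right_mono) auto
        ultimately show False by (simp add: distrib_right)
      qed
      show "k = l" using *[of k l] *[of l k] kl by (cases k l rule: linorder_cases) auto
    qed
  qed auto
  finally show ?thesis by simp
qed

text \<open>Weierstrass approximation. Besides \<open>e\<close>, only the degree and the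
  coefficients of the polynomial determine \<open>m\<close> and \<open>\<delta>\<close>; hence the
  uniformity in \<open>N\<close> and in the vectors.\<close>

lemma moments_determine_continuous:
  fixes \<phi> :: "real \<Rightarrow> real"
  assumes \<phi>: "continuous_on {-R..R} \<phi>" and e: "e > 0"
  shows "\<exists>m \<delta>. \<delta> > 0 \<and> (\<forall>N>0. \<forall>x y. (\<forall>j<N. x j \<in> {-R..R}) \<longrightarrow> (\<forall>j<N. y j \<in> {-R..R}) \<longrightarrow>
     (\<forall>k. 1 \<le> k \<and> k \<le> m \<longrightarrow> \<bar>kappa N (\<lambda>j. x j ^ k) - kappa N (\<lambda>j. y j ^ k)\<bar> < \<delta>) \<longrightarrow>
     \<bar>kappa N (\<lambda>j. \<phi> (x j)) - kappa N (\<lambda>j. \<phi> (y j))\<bar> \<le> e)"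
proof -
  obtain g where g: "real_polynomial_function g" "\<And>t. t \<in> {-R..R} \<Longrightarrow> \<bar>\<phi> t - g t\<bar> < e / 3"
    using Stone_Weierstrass_real_polynomial_function[OF compact_Icc \<phi>, of "e / 3"] e by auto
  obtain a d where ad: "g = (\<lambda>t. \<Sum>i\<le>d. a i * t ^ i)"
    using g(1) real_polynomial_function_iff_sum by auto
  define A where "A = (\<Sum>i\<le>d. \<bar>a i\<bar>)"
  have A: "A \<ge> 0" by (simp add: A_def sum_nonneg)
  define \<delta> where "\<delta> = e / (3 * (A + 1))"
  have \<delta>: "\<delta> > 0" using A e by (simp add: \<delta>_def)
  show ?thesis
  proof (intro exI[of _ d] exI[of _ \<delta>] conjI allI impI \<delta>)
    fix N :: nat and x y :: "nat \<Rightarrow> real"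
    assume N: "N > 0" and x: "\<forall>j<N. x j \<in> {-R..R}" and y: "\<forall>j<N. y j \<in> {-R..R}"
      and m: "\<forall>k. 1 \<le> k \<and> k \<le> d \<longrightarrow> \<bar>kappa N (\<lambda>j. x j ^ k) - kappa N (\<lambda>j. y j ^ k)\<bar> < \<delta>"
    have close: "\<bar>kappa N (\<lambda>j. \<phi> (z j)) - kappa N (\<lambda>j. g (z j))\<bar> \<le> e / 3" if z: "\<forall>j<N. z j \<in> {-R..R}" for z
    proof -
      have "\<bar>(\<Sum>j<N. \<phi> (z j)) - (\<Sum>j<N. g (z j))\<bar> \<le> (\<Sum>j<N. \<bar>\<phi> (z j) - g (z j)\<bar>)"
        unfolding sum_subtractf[symmetric] by (rule sum_abs)
      also have "\<dots> \<le> (\<Sum>j<N. e / 3)" using z g(2) by (intro sum_mono less_imp_le) auto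
      finally show ?thesis using N unfolding kappa_def diff_divide_distrib[symmetric]
        by (simp add: abs_divide divide_le_eq mult.commute)
    qed
    have kg: "kappa N (\<lambda>j. g (z j)) = (\<Sum>i\<le>d. a i * kappa N (\<lambda>j. z j ^ i))" for z
    proof -
      have "(\<Sum>j<N. \<Sum>i\<le>d. a i * z j ^ i) = (\<Sum>i\<le>d. \<Sum>j<N. a i * z j ^ i)" by (rule sum.swap)
      then show ?thesis by (simp add: kappa_def ad sum_divide_distrib sum_distrib_left)
    qed
    have "\<bar>kappa N (\<lambda>j. g (x j)) - kappa N (\<lambda>j. g (y j))\<bar>
      = \<bar>\<Sum>i\<le>d. a i * (kappa N (\<lambda>j. x j ^ i) - kappa N (\<lambda>j. y j ^ i))\<bar>"
      unfolding kg by (simp add: sum_subtractf right_diff_distrib)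
    also have "\<dots> \<le> (\<Sum>i\<le>d. \<bar>a i * (kappa N (\<lambda>j. x j ^ i) - kappa N (\<lambda>j. y j ^ i))\<bar>)" by (rule sum_abs)
    also have "\<dots> \<le> (\<Sum>i\<le>d. \<bar>a i\<bar> * \<delta>)"
    proof (rule sum_mono)
      fix i assume i: "i \<in> {..d}"
      \<comment> \<open>The moments of order 0 coincide.\<close>
      have "\<bar>kappa N (\<lambda>j. x j ^ i) - kappa N (\<lambda>j. y j ^ i)\<bar> \<le> \<delta>"
        using m[rule_format, of i] i \<delta> by (cases "i = 0") auto
      then show "\<bar>a i * (kappa N (\<lambda>j. x j ^ i) - kappa N (\<lambda>j. y j ^ i))\<bar> \<le> \<bar>a i\<bar> * \<delta>"
        unfolding abs_mult by (intro mult_left_mono) auto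
    qed
    also have "\<dots> = A * \<delta>" by (simp add: A_def sum_distrib_right)
    also have "\<dots> \<le> e / 3" using A e by (simp add: \<delta>_def field_simps)
    finally show "\<bar>kappa N (\<lambda>j. \<phi> (x j)) - kappa N (\<lambda>j. \<phi> (y j))\<bar> \<le> e"
      using close[OF x] close[OF y] by linarith
  qed
qed

text \<open>Slice both vectors into \<open>K\<close> layers. The slices are again monotone, so in
  each layer their distance is the difference of their sums up to the positions strictly inside.
  Over all layers there are at most \<open>N\<close> such positions for each vector, which costs
  \<open>2 * w * (N + N)\<close>, that is \<open>4 * w\<close> in the mean.\<close>

lemma sorted_mean_abs_diff_le:
  fixes x y :: "nat \<Rightarrow> real"
  assumes w: "w > 0" "real K * w = 2 * R" and N: "N > 0"
    and x: "\<And>j. j < N \<Longrightarrow> x j \<in> {-R..R}" "\<And>j k. j \<le> k \<Longrightarrow> k < N \<Longrightarrow> x j \<le> x k"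
    and y: "\<And>j. j < N \<Longrightarrow> y j \<in> {-R..R}" "\<And>j k. j \<le> k \<Longrightarrow> k < N \<Longrightarrow> y j \<le> y k"
  shows "kappa N (\<lambda>j. \<bar>x j - y j\<bar>) \<le>
    (\<Sum>k<K. \<bar>kappa N (\<lambda>j. ramp w (x j + R - real k * w)) - kappa N (\<lambda>j. ramp w (y j + R - real k * w))\<bar>) + 4 * w"
proof -
  let ?r = "\<lambda>k t. ramp w (t + R - real k * w)"
  let ?b = "\<lambda>z k. real (card {j. j < N \<and> 0 < ?r k (z j) \<and> ?r k (z j) < w})"
  have exp: "t + R = (\<Sum>k<K. ?r k t)" if "t \<in> {-R..R}" for t
    using that w sum_ramp[of w "t + R" K] by auto
  have "(\<Sum>j<N. \<bar>x j - y j\<bar>) \<le> (\<Sum>j<N. \<Sum>k<K. \<bar>?r k (x j) - ?r k (y j)\<bar>)"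
  proof (rule sum_mono)
    fix j assume "j \<in> {..<N}"
    then have "x j - y j = (\<Sum>k<K. ?r k (x j) - ?r k (y j))"
      using exp[of "x j"] exp[of "y j"] x(1)[of j] y(1)[of j] by (simp add: sum_subtractf)
    then show "\<bar>x j - y j\<bar> \<le> (\<Sum>k<K. \<bar>?r k (x j) - ?r k (y j)\<bar>)" by (simp add: sum_abs)
  qed
  also have "\<dots> = (\<Sum>k<K. \<Sum>j<N. \<bar>?r k (x j) - ?r k (y j)\<bar>)" by (rule sum.swap)
  also have "\<dots> \<le> (\<Sum>k<K. \<bar>(\<Sum>j<N. ?r k (x j)) - (\<Sum>j<N. ?r k (y j))\<bar> + 2 * w * (?b x k + ?b y k))"
    using x y w by (intro sum_mono sum_abs_diff_monotone_le) (auto intro!: mono_ramp ramp_bounds)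
  also have "\<dots> = (\<Sum>k<K. \<bar>(\<Sum>j<N. ?r k (x j)) - (\<Sum>j<N. ?r k (y j))\<bar>) + 2 * w * ((\<Sum>k<K. ?b x k) + (\<Sum>k<K. ?b y k))"
    by (simp only: sum.distrib flip: sum_distrib_left)
  also have "\<dots> \<le> (\<Sum>k<K. \<bar>(\<Sum>j<N. ?r k (x j)) - (\<Sum>j<N. ?r k (y j))\<bar>) + 2 * w * (real N + real N)"
  proof -
    have "(\<Sum>k<K. ?b z k) \<le> real N" for z
      using sum_card_ramp_interior_le[OF w(1), of N "\<lambda>j. z j + R" K] by (simp flip: of_nat_sum)
    then show ?thesis using w by (intro add_left_mono mult_left_mono add_mono) auto
  qed
  finally have "(\<Sum>j<N. \<bar>x j - y j\<bar>) / real N \<le>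
     ((\<Sum>k<K. \<bar>(\<Sum>j<N. ?r k (x j)) - (\<Sum>j<N. ?r k (y j))\<bar>) + 2 * w * (real N + real N)) / real N"
    by (rule divide_right_mono) simp
  also have "\<dots> = (\<Sum>k<K. \<bar>kappa N (\<lambda>j. ?r k (x j)) - kappa N (\<lambda>j. ?r k (y j))\<bar>) + 4 * w"
  proof -
    have "\<bar>a\<bar> / real N = \<bar>a / real N\<bar>" for a by simp
    then show ?thesis
      using N unfolding kappa_def add_divide_distrib diff_divide_distrib[symmetric]
      by (simp add: sum_divide_distrib[of _ "{..<K}"])
  qed
  finally show ?thesis by (simp add: kappa_def)
qed

lemma sorted_moments_close:
  assumes R: "R > 0" and e: "e > 0"
  obtains \<delta> m where "\<delta> > 0"
    "\<And>N x y. N > 0 \<Longrightarrow> (\<And>j. j < N \<Longrightarrow> x j \<in> {-R..R}) \<Longrightarrow> (\<And>j k. j \<le> k \<Longrightarrow> k < N \<Longrightarrow> x j \<le> x k) \<Longrightarrow>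
       (\<And>j. j < N \<Longrightarrow> y j \<in> {-R..R}) \<Longrightarrow> (\<And>j k. j \<le> k \<Longrightarrow> k < N \<Longrightarrow> y j \<le> y k) \<Longrightarrow>
       (\<And>k. 1 \<le> k \<Longrightarrow> k \<le> m \<Longrightarrow> \<bar>kappa N (\<lambda>j. x j ^ k) - kappa N (\<lambda>j. y j ^ k)\<bar> < \<delta>) \<Longrightarrow>
       kappa N (\<lambda>j. \<bar>x j - y j\<bar>) \<le> e"
proof -
  \<comment> \<open>Chosen so that \<open>4 * w = 8 * R / K\<close> is at most \<open>e / 2\<close>;
    the other half is shared by the \<open>K\<close> layers.\<close>
  obtain K :: nat where K: "real K * (e / 16) > R" using reals_Archimedean3[of "e / 16"] e by auto
  have K0: "K > 0" using K R by (cases K) auto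
  define w where "w = 2 * R / real K"
  have w: "w > 0" "real K * w = 2 * R" "4 * w \<le> e / 2" using K K0 R by (auto simp: w_def field_simps)
  let ?\<phi> = "\<lambda>k t. ramp w (t + R - real k * w)"
  have "\<exists>m \<delta>. \<delta> > 0 \<and> (\<forall>N>0. \<forall>x y. (\<forall>j<N. x j \<in> {-R..R}) \<longrightarrow> (\<forall>j<N. y j \<in> {-R..R}) \<longrightarrow>
     (\<forall>i. 1 \<le> i \<and> i \<le> m \<longrightarrow> \<bar>kappa N (\<lambda>j. x j ^ i) - kappa N (\<lambda>j. y j ^ i)\<bar> < \<delta>) \<longrightarrow>
     \<bar>kappa N (\<lambda>j. ?\<phi> k (x j)) - kappa N (\<lambda>j. ?\<phi> k (y j))\<bar> \<le> e / (2 * real K))" for k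
    using e K0 by (intro moments_determine_continuous) (auto simp: ramp_def intro!: continuous_intros)
  then obtain m \<delta> where m\<delta>: "\<And>k. \<delta> k > 0"
    "\<And>k N x y. N > 0 \<Longrightarrow> (\<forall>j<N. x j \<in> {-R..R}) \<Longrightarrow> (\<forall>j<N. y j \<in> {-R..R}) \<Longrightarrow>
     (\<forall>i. 1 \<le> i \<and> i \<le> m k \<longrightarrow> \<bar>kappa N (\<lambda>j. x j ^ i) - kappa N (\<lambda>j. y j ^ i)\<bar> < \<delta> k) \<Longrightarrow>
     \<bar>kappa N (\<lambda>j. ?\<phi> k (x j)) - kappa N (\<lambda>j. ?\<phi> k (y j))\<bar> \<le> e / (2 * real K)"
    by metis
  show ?thesis
  proof (rule that[of "Min (\<delta> ` {..<K})" "Max (m ` {..<K})"])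
    show "0 < Min (\<delta> ` {..<K})" using K0 m\<delta>(1) by (subst Min_gr_iff) auto
    fix N :: nat and x y :: "nat \<Rightarrow> real"
    assume N: "N > 0" and x: "\<And>j. j < N \<Longrightarrow> x j \<in> {-R..R}" "\<And>j k. j \<le> k \<Longrightarrow> k < N \<Longrightarrow> x j \<le> x k"
      and y: "\<And>j. j < N \<Longrightarrow> y j \<in> {-R..R}" "\<And>j k. j \<le> k \<Longrightarrow> k < N \<Longrightarrow> y j \<le> y k"
      and mom: "\<And>k. 1 \<le> k \<Longrightarrow> k \<le> Max (m ` {..<K}) \<Longrightarrow> \<bar>kappa N (\<lambda>j. x j ^ k) - kappa N (\<lambda>j. y j ^ k)\<bar> < Min (\<delta> ` {..<K})"
    have le: "\<bar>kappa N (\<lambda>j. ?\<phi> k (x j)) - kappa N (\<lambda>j. ?\<phi> k (y j))\<bar> \<le> e / (2 * real K)" if k: "k < K" for k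
    proof (rule m\<delta>(2)[OF N])
      show "\<forall>i. 1 \<le> i \<and> i \<le> m k \<longrightarrow> \<bar>kappa N (\<lambda>j. x j ^ i) - kappa N (\<lambda>j. y j ^ i)\<bar> < \<delta> k"
      proof (intro allI impI)
        fix i assume i: "1 \<le> i \<and> i \<le> m k"
        have "m k \<le> Max (m ` {..<K})" using k by simp
        moreover have "Min (\<delta> ` {..<K}) \<le> \<delta> k" using k by simp
        ultimately show "\<bar>kappa N (\<lambda>j. x j ^ i) - kappa N (\<lambda>j. y j ^ i)\<bar> < \<delta> k"
          using mom[of i] i by linarith
      qed
    qed (use x y in auto)
    have "kappa N (\<lambda>j. \<bar>x j - y j\<bar>) \<le>
      (\<Sum>k<K. \<bar>kappa N (\<lambda>j. ?\<phi> k (x j)) - kappa N (\<lambda>j. ?\<phi> k (y j))\<bar>) + 4 * w"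
      by (rule sorted_mean_abs_diff_le[OF w(1,2) N x y])
    also have "\<dots> \<le> (\<Sum>k<K. e / (2 * real K)) + e / 2"
      using le w by (intro add_mono sum_mono) auto
    also have "\<dots> = e" using K0 by simp
    finally show "kappa N (\<lambda>j. \<bar>x j - y j\<bar>) \<le> e" .
  qed
qed

subsection \<open>Large deviation lower bound\<close>

text \<open>The height of the test function on \<open>E\<close> is
  \<open>t = - ln (measure N E)\<close>. The normalising integral is then
  \<open>2 - measure N E\<close>, which explains the error \<open>ln 2\<close>.\<close>

lemma entropy_event_bound:
  fixes f :: "'a \<Rightarrow> real"
  assumes N: "prob_space N" and f[measurable]: "f \<in> borel_measurable N" "\<And>x. 0 \<le> f x"
    and P: "prob_space (density N f)" and ln: "integrable (density N f) (\<lambda>x. ln (f x))"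
    and E[measurable]: "E \<in> sets N" and p: "measure (density N f) E > 0"
  shows "measure N E > 0"
    and "- measure (density N f) E * ln (measure N E) \<le> (\<integral>x. ln (f x) \<partial>density N f) + ln 2"
proof -
  interpret N: prob_space N by fact
  interpret M: prob_space "density N f" by fact
  let ?p = "measure (density N f) E" and ?q = "measure N E" and ?S = "\<integral>x. ln (f x) \<partial>density N f"
  have *: "t * ?p - ln (1 + (exp t - 1) * ?q) \<le> ?S" for t :: real
  proof -
    have "(\<integral>x. t * indicator E x \<partial>density N f) - ln (\<integral>x. exp (t * indicator E x) \<partial>N) \<le> ?S"
      by (rule donsker_varadhan_le[OF N f P ln, where B = "\<bar>t\<bar>"]) (auto split: split_indicator)
    moreover have "(\<integral>x. t * indicator E x \<partial>density N f) = t * ?p" by simp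
    moreover have "(\<integral>x. exp (t * indicator E x) \<partial>N) = (\<integral>x. 1 + (exp t - 1) * indicator E x \<partial>N)"
      by (intro Bochner_Integration.integral_cong) (auto split: split_indicator)
    moreover have "(\<integral>x. 1 + (exp t - 1) * indicator E x \<partial>N) = 1 + (exp t - 1) * ?q"
      by (subst Bochner_Integration.integral_add)
        (auto simp: N.prob_space N.emeasure_eq_measure intro!: integrable_mult_right integrable_real_indicator)
    ultimately show ?thesis by simp
  qed
  \<comment> \<open>If \<open>E\<close> were null for \<open>N\<close>, a large \<open>t\<close>
    would violate the bound.\<close>
  show q: "?q > 0"
  proof (rule ccontr)
    assume "\<not> ?q > 0"
    then have "?q = 0" using measure_nonneg[of N E] by linarith
    then have "((?S + 1) / ?p) * ?p \<le> ?S" using *[of "(?S + 1) / ?p"] by simp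
    then show False using p by simp
  qed
  have "- ln ?q * ?p - ln (1 + (exp (- ln ?q) - 1) * ?q) \<le> ?S" by (rule *)
  moreover have "exp (- ln ?q) = 1 / ?q" using q by (simp add: exp_minus inverse_eq_divide)
  moreover have "1 + (1 / ?q - 1) * ?q = 2 - ?q" using q by (simp add: algebra_simps)
  moreover have "ln (2 - ?q) \<le> ln 2" using q by (intro ln_mono) (auto intro: le_less_trans[OF N.prob_le_1])
  ultimately show "- ?p * ln ?q \<le> ?S + ln 2" by (simp add: algebra_simps)
qed

lemma PiM_density:
  fixes f :: "'i \<Rightarrow> 'a \<Rightarrow> real"
  assumes I: "finite I" and N: "\<And>i. sigma_finite_measure (N i)"
    and f[measurable]: "\<And>i. f i \<in> borel_measurable (N i)" and f0: "\<And>i x. 0 \<le> f i x"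
    and P: "\<And>i. sigma_finite_measure (density (N i) (f i))"
  shows "PiM I (\<lambda>i. density (N i) (f i)) = density (PiM I N) (\<lambda>X. \<Prod>i\<in>I. f i (X i))"
proof -
  interpret N: product_sigma_finite N by (intro product_sigma_finite.intro N)
  interpret M: product_sigma_finite "\<lambda>i. density (N i) (f i)" by (intro product_sigma_finite.intro P)
  show ?thesis
  proof (rule M.PiM_eqI[symmetric])
    show "sets (density (PiM I N) (\<lambda>X. \<Prod>i\<in>I. f i (X i))) = sets (PiM I (\<lambda>i. density (N i) (f i)))"
      by (auto intro!: sets_PiM_cong)
    fix A assume "\<And>i. i \<in> I \<Longrightarrow> A i \<in> sets (density (N i) (f i))"
    then have A: "A i \<in> sets (N i)" if "i \<in> I" for i using that by simp
    have [measurable]: "PiE I A \<in> sets (PiM I N)" using A I by (intro sets_PiM_I_finite) auto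
    have "emeasure (density (PiM I N) (\<lambda>X. \<Prod>i\<in>I. f i (X i))) (PiE I A)
      = (\<integral>\<^sup>+X. ennreal (\<Prod>i\<in>I. f i (X i)) * indicator (PiE I A) X \<partial>PiM I N)"
      by (rule emeasure_density) auto
    also have "\<dots> = (\<integral>\<^sup>+X. (\<Prod>i\<in>I. ennreal (f i (X i)) * indicator (A i) (X i)) \<partial>PiM I N)"
    proof (rule nn_integral_cong)
      fix X assume X: "X \<in> space (PiM I N)"
      show "ennreal (\<Prod>i\<in>I. f i (X i)) * indicator (PiE I A) X = (\<Prod>i\<in>I. ennreal (f i (X i)) * indicator (A i) (X i))"
      proof (cases "X \<in> PiE I A")
        case True
        then show ?thesis by (auto simp: prod_ennreal f0 PiE_iff intro!: prod.cong)
      next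
        case False
        then obtain i where "i \<in> I" "X i \<notin> A i" using X by (auto simp: space_PiM PiE_iff)
        then have "(\<Prod>i\<in>I. ennreal (f i (X i)) * indicator (A i) (X i)) = 0"
          using I by (intro prod_zero) (auto intro!: bexI[of _ i])
        then show ?thesis using False by simp
      qed
    qed
    also have "\<dots> = (\<Prod>i\<in>I. \<integral>\<^sup>+x. ennreal (f i x) * indicator (A i) x \<partial>N i)"
      using A I by (intro N.product_nn_integral_prod) auto
    also have "\<dots> = (\<Prod>i\<in>I. emeasure (density (N i) (f i)) (A i))"
      using A by (intro prod.cong) (auto simp: emeasure_density)
    finally show "emeasure (density (PiM I N) (\<lambda>X. \<Prod>i\<in>I. f i (X i))) (PiE I A) = (\<Prod>i\<in>I. emeasure (density (N i) (f i)) (A i))" .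
  qed (rule I)
qed

lemma integral_PiM_component:
  fixes g :: "'a \<Rightarrow> real"
  assumes M: "prob_space M" and i: "i \<in> I" and g: "integrable M g"
  shows "integrable (PiM I (\<lambda>_. M)) (\<lambda>X. g (X i))" "(\<integral>X. g (X i) \<partial>PiM I (\<lambda>_. M)) = (\<integral>x. g x \<partial>M)"
proof -
  have m: "(\<lambda>X. X i) \<in> measurable (PiM I (\<lambda>_. M)) M" using i by (rule measurable_component_singleton)
  have d: "distr (PiM I (\<lambda>_. M)) M (\<lambda>X. X i) = M" using M i by (rule distr_PiM_component)
  have gm: "g \<in> borel_measurable M" using g by auto
  show "integrable (PiM I (\<lambda>_. M)) (\<lambda>X. g (X i))"
    using g integrable_distr_eq[OF m gm] d by simp
  show "(\<integral>X. g (X i) \<partial>PiM I (\<lambda>_. M)) = (\<integral>x. g x \<partial>M)"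
    using integral_distr[OF m gm] d by simp
qed

text \<open>The density of the power factorises, so its entropy is \<open>card I\<close> times that
  of one factor, while the error \<open>ln 2\<close> keeps its size.\<close>

lemma tensor_event_bound:
  fixes f :: "'a \<Rightarrow> real"
  assumes N: "prob_space N" and f[measurable]: "f \<in> borel_measurable N" "\<And>x. 0 \<le> f x"
    and P: "prob_space (density N f)" and ln: "integrable (density N f) (\<lambda>x. ln (f x))"
    and I: "finite I"
    and E: "E \<in> sets (PiM I (\<lambda>_. N))" and p: "measure (PiM I (\<lambda>_. density N f)) E > 0"
  shows "measure (PiM I (\<lambda>_. N)) E > 0"
    and "- measure (PiM I (\<lambda>_. density N f)) E * ln (measure (PiM I (\<lambda>_. N)) E)
       \<le> real (card I) * (\<integral>x. ln (f x) \<partial>density N f) + ln 2"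
proof -
  let ?F = "\<lambda>X. \<Prod>i\<in>I. f (X i)"
  have eq: "PiM I (\<lambda>_. density N f) = density (PiM I (\<lambda>_. N)) ?F"
    using I N P f by (intro PiM_density prob_space_imp_sigma_finite)
  have pN: "prob_space (PiM I (\<lambda>_. N))" by (intro prob_space_PiM N)
  have pM: "prob_space (PiM I (\<lambda>_. density N f))" by (intro prob_space_PiM P)
  \<comment> \<open>\<open>ln\<close> of the product splits into a sum where no factor vanishes,
    which is almost everywhere under the density measure.\<close>
  have "AE x in density N f. f x > 0"
    by (subst AE_density) (auto simp: less_le f(2))
  then have "AE X in PiM I (\<lambda>_. density N f). f (X i) > 0" if "i \<in> I" for i
    using that P by (intro AE_PiM_component) auto
  then have "AE X in PiM I (\<lambda>_. density N f). \<forall>i\<in>I. f (X i) > 0"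
    using I by (simp add: AE_finite_all)
  then have ae: "AE X in PiM I (\<lambda>_. density N f). (\<Sum>i\<in>I. ln (f (X i))) = ln (?F X)"
    by eventually_elim (metis I ln_prod less_irrefl)
  have int: "integrable (PiM I (\<lambda>_. density N f)) (\<lambda>X. \<Sum>i\<in>I. ln (f (X i)))"
    using integral_PiM_component(1)[OF P _ ln, where I = I] by (intro Bochner_Integration.integrable_sum) auto
  have Fm[measurable]: "?F \<in> borel_measurable (PiM I (\<lambda>_. N))"
    "(\<lambda>X. ln (?F X)) \<in> borel_measurable (PiM I (\<lambda>_. density N f))"
    unfolding eq by measurable
  have int': "integrable (PiM I (\<lambda>_. density N f)) (\<lambda>X. ln (?F X))"
    by (rule integrable_cong_AE_imp[OF int Fm(2) ae])
  have "(\<integral>X. ln (?F X) \<partial>PiM I (\<lambda>_. density N f)) = (\<integral>X. (\<Sum>i\<in>I. ln (f (X i))) \<partial>PiM I (\<lambda>_. density N f))"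
    using ae int Fm by (intro integral_cong_AE) auto
  also have "\<dots> = (\<Sum>i\<in>I. \<integral>X. ln (f (X i)) \<partial>PiM I (\<lambda>_. density N f))"
    using integral_PiM_component(1)[OF P _ ln, where I = I] by (intro Bochner_Integration.integral_sum) auto
  also have "\<dots> = real (card I) * (\<integral>x. ln (f x) \<partial>density N f)"
    using integral_PiM_component(2)[OF P _ ln, where I = I] by simp
  finally have S: "(\<integral>X. ln (?F X) \<partial>PiM I (\<lambda>_. density N f)) = real (card I) * (\<integral>x. ln (f x) \<partial>density N f)" .
  have F0: "\<And>X. 0 \<le> ?F X" by (intro prod_nonneg) (auto simp: f(2))
  show "measure (PiM I (\<lambda>_. N)) E > 0"
    by (rule entropy_event_bound(1)[OF pN Fm(1) F0 _ _ E]) (use pM int' p in \<open>simp_all add: eq\<close>)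
  have "- measure (density (PiM I (\<lambda>_. N)) ?F) E * ln (measure (PiM I (\<lambda>_. N)) E)
      \<le> (\<integral>X. ln (?F X) \<partial>density (PiM I (\<lambda>_. N)) ?F) + ln 2"
    by (rule entropy_event_bound(2)[OF pN Fm(1) F0 _ _ E]) (use pM int' p in \<open>simp_all add: eq\<close>)
  then show "- measure (PiM I (\<lambda>_. density N f)) E * ln (measure (PiM I (\<lambda>_. N)) E)
       \<le> real (card I) * (\<integral>x. ln (f x) \<partial>density N f) + ln 2"
    using S by (simp add: eq)
qed

lemma hoeffding_PiM:
  fixes Y :: "'a \<Rightarrow> real"
  assumes M: "prob_space M" and Y[measurable]: "Y \<in> borel_measurable M" and B: "AE x in M. \<bar>Y x\<bar> \<le> B" "B > 0"
    and N: "N > 0" and d: "d > 0"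
  shows "measure (PiM {..<N} (\<lambda>_. M)) {X \<in> space (PiM {..<N} (\<lambda>_. M)). d \<le> \<bar>kappa N (\<lambda>j. Y (X j)) - (\<integral>x. Y x \<partial>M)\<bar>}
    \<le> 2 * exp (- (real N * d\<^sup>2 / (2 * B\<^sup>2)))"
proof -
  let ?P = "PiM {..<N} (\<lambda>_. M)"
  interpret M: prob_space M by fact
  interpret P: prob_space ?P by (intro prob_space_PiM M)
  have iY: "integrable M Y" using B by (intro M.integrable_const_bound[of _ B]) auto
  have E: "(\<integral>X. Y (X j) \<partial>?P) = (\<integral>x. Y x \<partial>M)" if "j < N" for j
    using that by (intro integral_PiM_component(2) M iY) auto
  \<comment> \<open>The coordinates are independent because their joint law is the product of their
    laws.\<close>
  have "P.indep_vars (\<lambda>_. M) (\<lambda>j X. X j) {..<N}"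
  proof (subst P.indep_vars_iff_distr_eq_PiM')
    show "{..<N} \<noteq> {}" using N by auto
    have "distr ?P ?P (\<lambda>x. \<lambda>i\<in>{..<N}. x i) = distr ?P ?P (\<lambda>x. x)"
      by (intro distr_cong) (auto simp: space_PiM PiE_restrict)
    also have "\<dots> = ?P" by (simp add: distr_id2)
    also have "\<dots> = PiM {..<N} (\<lambda>i. distr ?P M (\<lambda>x. x i))"
      using M by (intro PiM_cong refl distr_PiM_component[of "{..<N}" "\<lambda>_. M", symmetric]) auto
    finally show "distr ?P ?P (\<lambda>x. \<lambda>i\<in>{..<N}. x i) = PiM {..<N} (\<lambda>i. distr ?P M (\<lambda>x. x i))" .
  qed auto
  then have indep: "P.indep_vars (\<lambda>_. borel) (\<lambda>j X. Y (X j)) {..<N}"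
    by (rule P.indep_vars_compose2) simp
  interpret H: Hoeffding_ineq ?P "{..<N}" "\<lambda>j X. Y (X j)" "\<lambda>_. - B" "\<lambda>_. B" "\<Sum>j<N. \<integral>X. Y (X j) \<partial>?P"
  proof unfold_locales
    fix j assume "j \<in> {..<N}"
    then have "AE X in ?P. \<bar>Y (X j)\<bar> \<le> B" using M B by (intro AE_PiM_component) auto
    then show "AE X in ?P. Y (X j) \<in> {- B..B}" by eventually_elim auto
  qed (auto intro: indep)
  have "P.prob {X \<in> space ?P. real N * d \<le> \<bar>(\<Sum>j<N. Y (X j)) - (\<Sum>j<N. \<integral>X. Y (X j) \<partial>?P)\<bar>}
    \<le> 2 * exp (- 2 * (real N * d)\<^sup>2 / (\<Sum>j<N. (B - - B)\<^sup>2))"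
    using N d B by (intro H.Hoeffding_ineq_abs_ge) auto
  also have "- 2 * (real N * d)\<^sup>2 / (\<Sum>j<N. (B - - B)\<^sup>2) = - (real N * d\<^sup>2 / (2 * B\<^sup>2))"
    using N B by (simp add: power2_eq_square field_simps)
  also have "{X \<in> space ?P. real N * d \<le> \<bar>(\<Sum>j<N. Y (X j)) - (\<Sum>j<N. \<integral>X. Y (X j) \<partial>?P)\<bar>}
    = {X \<in> space ?P. d \<le> \<bar>kappa N (\<lambda>j. Y (X j)) - (\<integral>x. Y x \<partial>M)\<bar>}"
  proof (intro Collect_cong conj_cong refl)
    fix X
    have "(\<Sum>j<N. Y (X j)) - (\<Sum>j<N. \<integral>X. Y (X j) \<partial>?P) = real N * (kappa N (\<lambda>j. Y (X j)) - (\<integral>x. Y x \<partial>M))"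
      using N E by (simp add: kappa_def right_diff_distrib)
    then have "\<bar>(\<Sum>j<N. Y (X j)) - (\<Sum>j<N. \<integral>X. Y (X j) \<partial>?P)\<bar> = real N * \<bar>kappa N (\<lambda>j. Y (X j)) - (\<integral>x. Y x \<partial>M)\<bar>"
      by (simp add: abs_mult)
    then show "(real N * d \<le> \<bar>(\<Sum>j<N. Y (X j)) - (\<Sum>j<N. \<integral>X. Y (X j) \<partial>?P)\<bar>) = (d \<le> \<bar>kappa N (\<lambda>j. Y (X j)) - (\<integral>x. Y x \<partial>M)\<bar>)"
      using N by simp
  qed
  finally show ?thesis .
qed

lemma ex_sorting_permutation:
  fixes x :: "nat \<Rightarrow> real"
  obtains \<tau> where "\<tau> permutes {..<N}" "\<And>j k. j \<le> k \<Longrightarrow> k < N \<Longrightarrow> x (\<tau> j) \<le> x (\<tau> k)"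
proof -
  let ?l = "map x [0..<N]"
  have "mset (sort ?l) = mset ?l" by simp
  then obtain p where p: "p permutes {..<length ?l}" "permute_list p ?l = sort ?l"
    by (rule mset_eq_permutation)
  have pN: "p permutes {..<N}" using p(1) by simp
  have nth: "sort ?l ! j = x (p j)" if "j < N" for j
  proof -
    have "p j < N" using permutes_in_image[OF pN, of j] that by simp
    then show ?thesis unfolding p(2)[symmetric] using that permute_list_nth[OF p(1), of j] by simp
  qed
  show ?thesis
  proof (rule that[OF pN])
    fix j k assume "j \<le> k" "k < N"
    then show "x (p j) \<le> x (p k)"
      using sorted_nth_mono[of "sort ?l" j k] nth[of j] nth[of k] by simp
  qed
qed

context approximated
begin

section \<open>Law of large numbers for the moments\<close>

text \<open>The set \<Gamma> of samples. Positions are the outer index and coordinates the inner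
  one, the reverse of \<open>Delta_R\<close>.\<close>

definition Good :: "nat \<Rightarrow> nat \<Rightarrow> real \<Rightarrow> (nat \<Rightarrow> nat \<Rightarrow> real) set" where
  "Good N m d = {X \<in> PiE {..<N} (\<lambda>_. cube R n). \<forall>is\<in>{is. set is \<subseteq> {..<n} \<and> 1 \<le> length is \<and> length is \<le> m}.
     \<bar>kappa N (\<lambda>j. prod_list (map (X j) is)) - (\<integral>y. prod_list (map y is) \<partial>\<mu>)\<bar> < d}"

lemma finite_index_lists: "finite {is. set is \<subseteq> {..<n} \<and> 1 \<le> length is \<and> length is \<le> m}"
  by (rule finite_subset[OF _ finite_lists_length_le[of "{..<n}" m]]) auto

lemma sets_\<nu>_eq: "sets \<nu> = sets \<mu>"
  using sets_M \<nu>.sets_M by simp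

lemma measurable_monomial: "(\<lambda>x. prod_list (map x is)) \<in> borel_measurable \<mu>"
  by (rule measurable_compose[OF measurable_id borel_measurable_continuous_onI[OF continuous_on_monomial]])

lemma measurable_kappa_monomial:
  "(\<lambda>X. kappa N (\<lambda>j. prod_list (map (X j) is))) \<in> borel_measurable (PiM {..<N} (\<lambda>_. \<mu>))"
proof -
  have "(\<lambda>X. prod_list (map (X j) is)) \<in> borel_measurable (PiM {..<N} (\<lambda>_. \<mu>))" if "j < N" for j
    using that measurable_compose[OF measurable_component_singleton[of j "{..<N}" "\<lambda>_. \<mu>"] measurable_monomial] by auto
  then show ?thesis unfolding kappa_def by (intro borel_measurable_divide borel_measurable_sum) auto
qed

lemma Good_sets: "Good N m d \<in> sets (PiM {..<N} (\<lambda>_. \<mu>))"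
proof -
  let ?P = "PiM {..<N} (\<lambda>_. \<mu>)"
  let ?L = "{is. set is \<subseteq> {..<n} \<and> 1 \<le> length is \<and> length is \<le> m}"
  have c: "PiE {..<N} (\<lambda>_. cube R n) \<in> sets ?P"
    by (intro sets_PiM_I_finite) (auto simp: cube_sets)
  have A: "{X \<in> space ?P. \<forall>is\<in>?L. \<bar>kappa N (\<lambda>j. prod_list (map (X j) is)) - (\<integral>y. prod_list (map y is) \<partial>\<mu>)\<bar> < d} \<in> sets ?P"
    using measurable_kappa_monomial
    by (intro sets.sets_Collect_finite_All finite_index_lists borel_measurable_less borel_measurable_abs
        borel_measurable_diff measurable_const) auto
  have eq: "Good N m d = PiE {..<N} (\<lambda>_. cube R n) \<inter>
     {X \<in> space ?P. \<forall>is\<in>?L. \<bar>kappa N (\<lambda>j. prod_list (map (X j) is)) - (\<integral>y. prod_list (map y is) \<partial>\<mu>)\<bar> < d}"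
    unfolding Good_def using sets.sets_into_space[OF c] by blast
  show ?thesis unfolding eq by (rule sets.Int[OF c A])
qed

lemma sets_PiM_\<nu>: "sets (PiM I (\<lambda>_. \<nu>)) = sets (PiM I (\<lambda>_. \<mu>))"
  by (intro sets_PiM_cong) (auto simp: sets_\<nu>_eq)

text \<open>Hoeffding's inequality for each of the finitely many monomials and a union bound;
  membership in the cube is almost sure.\<close>

lemma prob_Good_tendsto:
  assumes d: "d > 0"
  shows "(\<lambda>N. measure (PiM {..<N} (\<lambda>_. \<mu>)) (Good N m d)) \<longlonglongrightarrow> 1"
proof -
  let ?L = "{is. set is \<subseteq> {..<n} \<and> 1 \<le> length is \<and> length is \<le> m}"
  let ?b = "\<lambda>N. 1 - (\<Sum>is\<in>?L. 2 * exp (- (real N * d\<^sup>2 / (2 * (R ^ length is)\<^sup>2))))"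
  have low: "?b N \<le> measure (PiM {..<N} (\<lambda>_. \<mu>)) (Good N m d)" if N: "N > 0" for N
  proof -
    let ?P = "PiM {..<N} (\<lambda>_. \<mu>)"
    interpret P: prob_space ?P by (intro prob_space_PiM prob_space_axioms)
    let ?B = "\<lambda>is. {X \<in> space ?P. d \<le> \<bar>kappa N (\<lambda>j. prod_list (map (X j) is)) - (\<integral>x. prod_list (map x is) \<partial>\<mu>)\<bar>}"
    have Bs: "?B is \<in> sets ?P" for "is"
      using measurable_kappa_monomial by (intro borel_measurable_le borel_measurable_abs borel_measurable_diff) auto
    have "AE X in ?P. X j \<in> cube R n" if "j < N" for j
      using that by (intro AE_PiM_component prob_space_axioms AE_cube) auto
    then have "AE X in ?P. \<forall>j\<in>{..<N}. X j \<in> cube R n"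
      by (subst AE_finite_all) auto
    then have ae: "AE X in ?P. X \<in> space ?P - Good N m d \<longrightarrow> X \<in> (\<Union>is\<in>?L. ?B is)"
    proof eventually_elim
      case (elim X)
      then show ?case by (auto simp: Good_def space_PiM PiE_iff not_less)
    qed
    have "1 - P.prob (Good N m d) = P.prob (space ?P - Good N m d)"
      by (rule P.prob_compl[symmetric]) (rule Good_sets)
    also have "\<dots> \<le> P.prob (\<Union>is\<in>?L. ?B is)"
      using ae Bs finite_index_lists by (intro P.finite_measure_mono_AE) (auto intro!: sets.finite_UN)
    also have "\<dots> \<le> (\<Sum>is\<in>?L. P.prob (?B is))"
      using Bs by (intro P.finite_measure_subadditive_finite finite_index_lists) auto
    also have "\<dots> \<le> (\<Sum>is\<in>?L. 2 * exp (- (real N * d\<^sup>2 / (2 * (R ^ length is)\<^sup>2))))"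
    proof (intro sum_mono hoeffding_PiM prob_space_axioms measurable_monomial N d)
      fix "is" assume l: "is \<in> ?L"
      show "AE x in \<mu>. \<bar>prod_list (map x is)\<bar> \<le> R ^ length is"
        using AE_cube
      proof eventually_elim
        case (elim x)
        have "\<bar>x i\<bar> \<le> R" if "i \<in> set is" for i
        proof -
          have "x i \<in> {-R..R}" using elim that l by (auto simp: cube_def PiE_iff)
          then show ?thesis by auto
        qed
        then show ?case by (rule prod_list_abs_le)
      qed
    qed (use R_pos in auto)
    finally show ?thesis by simp
  qed
  have "?b \<longlonglongrightarrow> 1 - (\<Sum>is\<in>?L. 0)"
  proof (intro tendsto_diff tendsto_const tendsto_sum)
    fix "is" :: "nat list"
    have c: "d\<^sup>2 / (2 * (R ^ length is)\<^sup>2) > 0" using d R_pos by simp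
    have "(\<lambda>N. 2 * exp (- (real N * c))) \<longlonglongrightarrow> 0" if "c > 0" for c :: real
      using that by real_asymp
    from this[OF c] show "(\<lambda>N. 2 * exp (- (real N * d\<^sup>2 / (2 * (R ^ length is)\<^sup>2)))) \<longlonglongrightarrow> 0" by simp
  qed
  then have "?b \<longlonglongrightarrow> 1" by simp
  moreover have "\<forall>\<^sub>F N in sequentially. ?b N \<le> measure (PiM {..<N} (\<lambda>_. \<mu>)) (Good N m d)"
    using eventually_gt_at_top[of 0] by eventually_elim (rule low)
  moreover have "\<forall>\<^sub>F N in sequentially. measure (PiM {..<N} (\<lambda>_. \<mu>)) (Good N m d) \<le> 1"
    by (intro always_eventually allI prob_space.prob_le_1 prob_space_PiM prob_space_axioms)
  ultimately show ?thesis by (rule tendsto_sandwich[rotated 2, OF _ tendsto_const])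
qed

subsection \<open>Rearrangements of samples\<close>

definition Idx :: "nat \<Rightarrow> (nat \<times> nat) set" where "Idx N = {..<n} \<times> {..<N}"

text \<open>Samples indexed by (coordinate, position), so that independent permutations of the positions
  in each coordinate act as a reindexing that preserves the product measure.\<close>

definition flat :: "nat \<Rightarrow> (nat \<times> nat \<Rightarrow> real) measure" where
  "flat N = PiM (Idx N) (\<lambda>p. marg \<mu> (fst p))"

definition flatten :: "nat \<Rightarrow> (nat \<Rightarrow> nat \<Rightarrow> real) \<Rightarrow> nat \<times> nat \<Rightarrow> real" where
  "flatten N X = (\<lambda>p\<in>Idx N. X (snd p) (fst p))"

definition unflatten :: "nat \<Rightarrow> (nat \<times> nat \<Rightarrow> real) \<Rightarrow> nat \<Rightarrow> nat \<Rightarrow> real" where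
  "unflatten N w = (\<lambda>j\<in>{..<N}. \<lambda>i\<in>{..<n}. w (i, j))"

lemma finite_Idx: "finite (Idx N)" by (simp add: Idx_def)

lemma prob_space_flat: "prob_space (flat N)"
  unfolding flat_def by (intro prob_space_PiM prob_space_marg)

lemma measurable_flatten: "flatten N \<in> measurable (PiM {..<N} (\<lambda>_. \<nu>)) (flat N)"
  unfolding flat_def flatten_def[abs_def]
proof (rule measurable_restrict)
  fix p assume p: "p \<in> Idx N"
  have 1: "(\<lambda>X. X (snd p)) \<in> measurable (PiM {..<N} (\<lambda>_. \<nu>)) \<nu>"
    using p by (intro measurable_component_singleton) (auto simp: Idx_def)
  have 2: "(\<lambda>x. x (fst p)) \<in> measurable \<nu> (marg \<mu> (fst p))"
    unfolding \<nu>_def using p by (intro measurable_component_singleton) (auto simp: Idx_def)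
  show "(\<lambda>X. X (snd p) (fst p)) \<in> measurable (PiM {..<N} (\<lambda>_. \<nu>)) (marg \<mu> (fst p))"
    by (rule measurable_compose[OF 1 2])
qed

text \<open>A finite product measure is determined by its boxes, and on boxes the claim is an
  exchange of two products.\<close>

lemma distr_flatten: "distr (PiM {..<N} (\<lambda>_. \<nu>)) (flat N) (flatten N) = flat N"
proof -
  interpret F: product_prob_space "\<lambda>p. marg \<mu> (fst p)" "Idx N"
    by (intro product_prob_space.intro product_sigma_finite.intro product_prob_space_axioms.intro
      prob_space_marg prob_space_imp_sigma_finite)
  interpret V: product_prob_space "\<lambda>_. \<nu>" "{..<N}"
    by (intro product_prob_space.intro product_sigma_finite.intro product_prob_space_axioms.intro
      prob_space_\<nu> prob_space_imp_sigma_finite)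
  let ?P = "PiM {..<N} (\<lambda>_. \<nu>)"
  have "distr ?P (flat N) (flatten N) = PiM (Idx N) (\<lambda>p. marg \<mu> (fst p))"
  proof (rule F.PiM_eqI[OF finite_Idx])
    fix A assume A: "\<And>p. p \<in> Idx N \<Longrightarrow> A p \<in> sets (marg \<mu> (fst p))"
    have A': "A (i, j) \<in> sets (marg \<mu> i)" if "i < n" "j < N" for i j
      using A[of "(i, j)"] that by (simp add: Idx_def)
    have "PiE (Idx N) A \<in> sets (flat N)"
      unfolding flat_def using A by (intro sets_PiM_I_finite finite_Idx) auto
    then have "emeasure (distr ?P (flat N) (flatten N)) (PiE (Idx N) A) = emeasure ?P (flatten N -` PiE (Idx N) A \<inter> space ?P)"
      by (intro emeasure_distr measurable_flatten)
    also have "flatten N -` PiE (Idx N) A \<inter> space ?P = PiE {..<N} (\<lambda>j. PiE {..<n} (\<lambda>i. A (i, j)))"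
    proof (intro set_eqI iffI)
      fix X assume X: "X \<in> flatten N -` PiE (Idx N) A \<inter> space ?P"
      then have Xs: "X \<in> PiE {..<N} (\<lambda>_. PiE {..<n} (\<lambda>_. UNIV))" by (simp add: space_PiM \<nu>.space_M)
      have "flatten N X (i, j) \<in> A (i, j)" if "i < n" "j < N" for i j
        using X that by (auto simp: PiE_iff Idx_def)
      then have XA: "X j i \<in> A (i, j)" if "i < n" "j < N" for i j
        using that by (simp add: flatten_def Idx_def)
      show "X \<in> PiE {..<N} (\<lambda>j. PiE {..<n} (\<lambda>i. A (i, j)))"
      proof (rule PiE_I)
        fix j assume j: "j \<in> {..<N}"
        show "X j \<in> PiE {..<n} (\<lambda>i. A (i, j))"
          using XA j PiE_arb[OF PiE_mem[OF Xs j]] by (intro PiE_I) auto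
      qed (use PiE_arb[OF Xs] in auto)
    next
      fix X assume X: "X \<in> PiE {..<N} (\<lambda>j. PiE {..<n} (\<lambda>i. A (i, j)))"
      have "X j i \<in> A (i, j)" if "i < n" "j < N" for i j
        using PiE_mem[OF PiE_mem[OF X, of j], of i] that by simp
      then have "flatten N X \<in> PiE (Idx N) A"
        unfolding flatten_def by (intro restrict_PiE_iff[THEN iffD2]) (auto simp: Idx_def)
      moreover have "X \<in> space ?P"
        unfolding space_PiM \<nu>.space_M
      proof (rule PiE_I)
        fix j assume j: "j \<in> {..<N}"
        show "X j \<in> PiE {..<n} (\<lambda>_. UNIV)" using PiE_arb[OF PiE_mem[OF X j]] by (intro PiE_I) auto
      qed (use PiE_arb[OF X] in auto)
      ultimately show "X \<in> flatten N -` PiE (Idx N) A \<inter> space ?P" by simp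
    qed
    also have "emeasure ?P (PiE {..<N} (\<lambda>j. PiE {..<n} (\<lambda>i. A (i, j)))) = (\<Prod>j<N. emeasure \<nu> (PiE {..<n} (\<lambda>i. A (i, j))))"
      using A' by (intro V.emeasure_PiM) (auto simp: \<nu>_def intro!: sets_PiM_I_finite)
    also have "\<dots> = (\<Prod>j<N. \<Prod>i<n. emeasure (marg \<mu> i) (A (i, j)))"
      unfolding \<nu>_def using A' by (intro prod.cong marg.emeasure_PiM) auto
    also have "\<dots> = (\<Prod>i<n. \<Prod>j<N. emeasure (marg \<mu> i) (A (i, j)))" by (rule prod.swap)
    also have "\<dots> = (\<Prod>p\<in>Idx N. emeasure (marg \<mu> (fst p)) (A p))"
      unfolding Idx_def by (simp add: prod.cartesian_product split_beta)
    finally show "emeasure (distr ?P (flat N) (flatten N)) (PiE (Idx N) A) = (\<Prod>p\<in>Idx N. emeasure (marg \<mu> (fst p)) (A p))" .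
  qed (simp add: flat_def)
  then show ?thesis by (simp add: flat_def)
qed

definition GoodF :: "nat \<Rightarrow> nat \<Rightarrow> real \<Rightarrow> (nat \<times> nat \<Rightarrow> real) set" where
  "GoodF N m d = {w \<in> space (flat N). unflatten N w \<in> Good N m d}"

lemma space_flat: "space (flat N) = PiE (Idx N) (\<lambda>_. UNIV)"
  by (simp add: flat_def space_PiM)

lemma measurable_unflatten: "unflatten N \<in> measurable (flat N) (PiM {..<N} (\<lambda>_. \<mu>))"
proof -
  have "unflatten N \<in> measurable (flat N) (PiM {..<N} (\<lambda>_. \<nu>))"
    unfolding unflatten_def[abs_def]
  proof (rule measurable_restrict)
    fix j assume j: "j \<in> {..<N}"
    show "(\<lambda>w. \<lambda>i\<in>{..<n}. w (i, j)) \<in> measurable (flat N) \<nu>"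
      unfolding \<nu>_def
    proof (rule measurable_restrict)
      fix i assume i: "i \<in> {..<n}"
      have "(\<lambda>w. w (i, j)) \<in> measurable (flat N) (marg \<mu> (fst (i, j)))"
        unfolding flat_def using i j by (intro measurable_component_singleton) (auto simp: Idx_def)
      then show "(\<lambda>w. w (i, j)) \<in> measurable (flat N) (marg \<mu> i)" by simp
    qed
  qed
  then show ?thesis by (simp only: measurable_cong_sets[OF refl sets_PiM_\<nu>])
qed

lemma GoodF_sets: "GoodF N m d \<in> sets (flat N)"
proof -
  have "GoodF N m d = unflatten N -` Good N m d \<inter> space (flat N)" by (auto simp: GoodF_def)
  then show ?thesis using measurable_sets[OF measurable_unflatten Good_sets] by simp
qed

lemma measure_GoodF: "measure (flat N) (GoodF N m d) = measure (PiM {..<N} (\<lambda>_. \<nu>)) (Good N m d)"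
proof -
  let ?P = "PiM {..<N} (\<lambda>_. \<nu>)"
  have un: "unflatten N (flatten N X) = X" if X: "X \<in> space ?P" for X
  proof (intro ext)
    fix j i
    have Xs: "X \<in> PiE {..<N} (\<lambda>_. PiE {..<n} (\<lambda>_. UNIV))" using X by (simp add: space_PiM \<nu>.space_M)
    show "unflatten N (flatten N X) j i = X j i"
      using PiE_arb[OF Xs, of j] PiE_arb[OF PiE_mem[OF Xs, of j], of i]
      by (simp add: unflatten_def flatten_def Idx_def)
  qed
  have "measure (flat N) (GoodF N m d) = measure (distr ?P (flat N) (flatten N)) (GoodF N m d)"
    by (simp add: distr_flatten)
  also have "\<dots> = measure ?P (flatten N -` GoodF N m d \<inter> space ?P)"
    by (rule measure_distr[OF measurable_flatten GoodF_sets])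
  also have "flatten N -` GoodF N m d \<inter> space ?P = Good N m d"
  proof -
    have "Good N m d \<subseteq> space ?P"
      using sets.sets_into_space[OF Good_sets] sets_eq_imp_space_eq[OF sets_PiM_\<nu>] by blast
    moreover have "flatten N X \<in> space (flat N)" if "X \<in> space ?P" for X
      using measurable_space[OF measurable_flatten that] .
    ultimately show ?thesis using un by (auto simp: GoodF_def)
  qed
  finally show ?thesis .
qed

definition permute :: "nat \<Rightarrow> (nat \<Rightarrow> nat \<Rightarrow> nat) \<Rightarrow> (nat \<times> nat \<Rightarrow> real) \<Rightarrow> nat \<times> nat \<Rightarrow> real" where
  "permute N s w = (\<lambda>p\<in>Idx N. w (fst p, inv (s (fst p)) (snd p)))"

lemma distr_permute:
  assumes s: "s \<in> PiE {..<n} (\<lambda>_. perms N)"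
  shows "distr (flat N) (flat N) (permute N s) = flat N"
proof -
  define f where "f p = (fst p, inv (s (fst p)) (snd p))" for p
  have p: "inv (s i) permutes {..<N}" if "i < n" for i
    using s that by (auto simp: PiE_iff perms_def intro: permutes_inv)
  have inj: "inj_on f (Idx N)"
  proof (rule inj_onI)
    fix a b assume a: "a \<in> Idx N" and b: "b \<in> Idx N" and eq: "f a = f b"
    have 1: "fst a = fst b" using eq by (simp add: f_def)
    have 2: "inv (s (fst a)) (snd a) = inv (s (fst a)) (snd b)" using eq 1 unfolding f_def by (metis snd_conv)
    have "inj (inv (s (fst a)))" using p[of "fst a"] a by (intro permutes_inj) (auto simp: Idx_def)
    then have "snd a = snd b" using 2 by (rule injD)
    with 1 show "a = b" by (simp add: prod_eq_iff)
  qed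
  have into: "f \<in> Idx N \<rightarrow> Idx N"
  proof
    fix a assume a: "a \<in> Idx N"
    then have "inv (s (fst a)) (snd a) < N"
      using permutes_in_image[OF p[of "fst a"], of "snd a"] by (auto simp: Idx_def)
    then show "f a \<in> Idx N" using a by (auto simp: f_def Idx_def)
  qed
  have "distr (PiM (Idx N) (\<lambda>p. marg \<mu> (fst p))) (PiM (Idx N) (\<lambda>p. marg \<mu> (fst (f p)))) (\<lambda>\<omega>. \<lambda>p\<in>Idx N. \<omega> (f p))
    = PiM (Idx N) (\<lambda>p. marg \<mu> (fst (f p)))"
    using inj into by (intro distr_PiM_reindex prob_space_marg) auto
  \<comment> \<open>The reindexing stays within each coordinate, so the factors of the product
    measure are unchanged.\<close>
  moreover have "fst (f p) = fst p" for p by (simp add: f_def)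
  ultimately show ?thesis by (simp add: flat_def permute_def[abs_def] f_def)
qed

lemma measurable_permute:
  assumes s: "s \<in> PiE {..<n} (\<lambda>_. perms N)"
  shows "permute N s \<in> measurable (flat N) (flat N)"
  unfolding permute_def[abs_def] flat_def
proof (rule measurable_restrict)
  fix p assume p: "p \<in> Idx N"
  have f: "fst p \<in> {..<n}" and "snd p < N" using p by (auto simp: Idx_def)
  then have "inv (s (fst p)) (snd p) < N" using act_xi_vec(2) PiE_mem[OF s f] by blast
  then have "(\<lambda>w. w (fst p, inv (s (fst p)) (snd p))) \<in> measurable (PiM (Idx N) (\<lambda>p. marg \<mu> (fst p))) (marg \<mu> (fst (fst p, inv (s (fst p)) (snd p))))"
    using p by (intro measurable_component_singleton) (auto simp: Idx_def)
  then show "(\<lambda>w. w (fst p, inv (s (fst p)) (snd p))) \<in> measurable (PiM (Idx N) (\<lambda>p. marg \<mu> (fst p))) (marg \<mu> (fst p))" by simp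
qed

text \<open>By invariance the mean number of good rearrangements is the left-hand side of the
  inequality, and some point reaches at least the mean.\<close>

lemma ex_many_good_rearrangements:
  obtains w where "w \<in> space (flat N)"
    "fact N ^ n * measure (flat N) (GoodF N m d) \<le> real (card {s \<in> PiE {..<n} (\<lambda>_. perms N). permute N s w \<in> GoodF N m d})"
proof -
  interpret F: prob_space "flat N" by (rule prob_space_flat)
  let ?S = "PiE {..<n} (\<lambda>_. perms N)"
  let ?c = "\<lambda>w. card {s \<in> ?S. permute N s w \<in> GoodF N m d}"
  have c_eq: "real (?c w) = (\<Sum>s\<in>?S. indicator (permute N s -` GoodF N m d \<inter> space (flat N)) w)" if "w \<in> space (flat N)" for w
    using that finite_perms_PiE[of N] by (simp add: indicator_def sum.If_cases Int_def)
  have set: "permute N s -` GoodF N m d \<inter> space (flat N) \<in> sets (flat N)" if "s \<in> ?S" for s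
    by (rule measurable_sets[OF measurable_permute[OF that] GoodF_sets])
  have "(\<integral>w. real (?c w) \<partial>flat N) = (\<integral>w. (\<Sum>s\<in>?S. indicator (permute N s -` GoodF N m d \<inter> space (flat N)) w) \<partial>flat N)"
    using c_eq by (intro Bochner_Integration.integral_cong) auto
  also have "\<dots> = (\<Sum>s\<in>?S. \<integral>w. indicator (permute N s -` GoodF N m d \<inter> space (flat N)) w \<partial>flat N)"
    using set by (intro Bochner_Integration.integral_sum) (auto simp: F.emeasure_eq_measure)
  also have "\<dots> = (\<Sum>s\<in>?S. measure (flat N) (permute N s -` GoodF N m d \<inter> space (flat N)))"
    using set by (intro sum.cong) auto
  also have "\<dots> = (\<Sum>s\<in>?S. measure (flat N) (GoodF N m d))"
  proof (intro sum.cong refl)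
    fix s assume s: "s \<in> ?S"
    have "measure (flat N) (permute N s -` GoodF N m d \<inter> space (flat N)) = measure (distr (flat N) (flat N) (permute N s)) (GoodF N m d)"
      by (rule measure_distr[OF measurable_permute[OF s] GoodF_sets, symmetric])
    then show "measure (flat N) (permute N s -` GoodF N m d \<inter> space (flat N)) = measure (flat N) (GoodF N m d)"
      by (simp add: distr_permute[OF s])
  qed
  also have "\<dots> = fact N ^ n * measure (flat N) (GoodF N m d)"
    by (simp add: card_PiE card_perms)
  finally have int: "(\<integral>w. real (?c w) \<partial>flat N) = fact N ^ n * measure (flat N) (GoodF N m d)" .
  have bd: "?c w \<le> card ?S" for w using finite_perms_PiE by (intro card_mono) auto
  obtain w0 where w0: "w0 \<in> space (flat N)" using F.not_empty by blast
  \<comment> \<open>The count is a bounded natural number, so its maximum is attained, and the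
    maximum is at least the mean.\<close>
  have "\<exists>w. w \<in> space (flat N) \<and> (\<forall>v. v \<in> space (flat N) \<longrightarrow> ?c v \<le> ?c w)"
    by (rule ex_has_greatest_nat[of _ w0 _ "Suc (card ?S)"]) (use w0 bd in \<open>auto simp: less_Suc_eq_le\<close>)
  then obtain w where w: "w \<in> space (flat N)" "\<And>v. v \<in> space (flat N) \<Longrightarrow> ?c v \<le> ?c w" by blast
  have "(\<integral>v. real (?c v) \<partial>flat N) \<le> (\<integral>v. real (?c w) \<partial>flat N)"
    by (rule integral_mono') (use w in auto)
  also have "\<dots> = real (?c w)" by (simp add: F.prob_space)
  finally show ?thesis using that[OF w(1)] int by simp
qed

lemma integral_marg_power: "(\<integral>t. t ^ k \<partial>marg \<mu> i) = (\<integral>y. prod_list (map y (replicate k i)) \<partial>\<mu>)"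
proof -
  have "(\<integral>t. t ^ k \<partial>marg \<mu> i) = (\<integral>y. y i ^ k \<partial>\<mu>)"
    unfolding marg_def by (subst integral_distr[OF measurable_coord']) auto
  then show ?thesis by (simp add: prod_list_replicate)
qed

lemma sum_inv_perm:
  assumes "\<sigma> \<in> perms N"
  shows "(\<Sum>j<N. g (inv \<sigma> j)) = (\<Sum>j<N. g j :: real)"
proof -
  have "inv \<sigma> permutes {..<N}" using assms by (auto simp: perms_def intro: permutes_inv)
  from sum.permute[OF this, of g] show ?thesis by (simp add: o_def)
qed

lemma approx_moments_eventually:
  assumes "d > 0"
  shows "\<forall>\<^sub>F N in sequentially. \<forall>i<n. \<forall>k\<le>m. \<bar>kappa N (\<lambda>j. \<Xi> i N j ^ k) - (\<integral>t. t ^ k \<partial>marg \<mu> i)\<bar> < d"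
proof -
  have "\<forall>\<^sub>F N in sequentially. \<bar>kappa N (\<lambda>j. \<Xi> i N j ^ k) - (\<integral>t. t ^ k \<partial>marg \<mu> i)\<bar> < d" if "i < n" for i k
  proof -
    have "(\<lambda>N. kappa N (\<lambda>j. \<Xi> i N j ^ k)) \<longlonglongrightarrow> (\<integral>t. t ^ k \<partial>marg \<mu> i)"
      using approx that by (auto simp: approx_seq_def)
    from tendstoD[OF this assms] show ?thesis by (simp add: dist_real_def)
  qed
  then have "\<forall>\<^sub>F N in sequentially. \<forall>i\<in>{..<n}. \<forall>k\<in>{..m}. \<bar>kappa N (\<lambda>j. \<Xi> i N j ^ k) - (\<integral>t. t ^ k \<partial>marg \<mu> i)\<bar> < d"
    by (intro eventually_ball_finite ballI) auto
  then show ?thesis by eventually_elim auto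
qed

subsection \<open>Counting microstates\<close>

text \<open>If a rearrangement of \<open>w\<close> has almost the moments of \<open>\<mu>\<close>, then sorting the rows of \<open>w\<close> gives
  vectors close in mean to the \<open>\<xi>\<^sub>i(N)\<close>; composing with the sorting permutations thus sends good
  rearrangements of \<open>w\<close> injectively into \<open>\<Delta>\<^sub>s\<^sub>y\<^sub>m\<close>.\<close>

lemma card_good_rearrangements_le:
  assumes N: "N > 0" and \<eta>: "\<eta> \<ge> 0" and R1: "R1 = max 1 R"
    and C: "real m * R1 ^ m * (real n * \<eta>) + d \<le> \<delta>" and mm: "m \<le> m'" "m0 \<le> m'" and dd: "d + d0 \<le> \<delta>0"
    and close: "\<And>x y. (\<And>j. j < N \<Longrightarrow> x j \<in> {-R..R}) \<Longrightarrow> (\<And>j k. j \<le> k \<Longrightarrow> k < N \<Longrightarrow> x j \<le> x k) \<Longrightarrow>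
       (\<And>j. j < N \<Longrightarrow> y j \<in> {-R..R}) \<Longrightarrow> (\<And>j k. j \<le> k \<Longrightarrow> k < N \<Longrightarrow> y j \<le> y k) \<Longrightarrow>
       (\<And>k. 1 \<le> k \<Longrightarrow> k \<le> m0 \<Longrightarrow> \<bar>kappa N (\<lambda>j. x j ^ k) - kappa N (\<lambda>j. y j ^ k)\<bar> < \<delta>0) \<Longrightarrow>
       kappa N (\<lambda>j. \<bar>x j - y j\<bar>) \<le> \<eta>"
    and mom: "\<forall>i<n. \<forall>k\<le>m0. \<bar>kappa N (\<lambda>j. \<Xi> i N j ^ k) - (\<integral>t. t ^ k \<partial>marg \<mu> i)\<bar> < d0"
  shows "card {s \<in> PiE {..<n} (\<lambda>_. perms N). permute N s w \<in> GoodF N m' d} \<le> card (Delta_sym R \<mu> \<Xi> n N m \<delta>)"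
proof -
  let ?A = "{s \<in> PiE {..<n} (\<lambda>_. perms N). permute N s w \<in> GoodF N m' d}"
  have "\<exists>\<tau>. \<tau> permutes {..<N} \<and> (\<forall>j k. j \<le> k \<longrightarrow> k < N \<longrightarrow> w (i, \<tau> j) \<le> w (i, \<tau> k))" for i
    using ex_sorting_permutation[of N "\<lambda>j. w (i, j)"] by metis
  then obtain \<tau> where \<tau>: "\<And>i. \<tau> i permutes {..<N}" "\<And>i j k. j \<le> k \<Longrightarrow> k < N \<Longrightarrow> w (i, \<tau> i j) \<le> w (i, \<tau> i k)"
    by metis
  \<comment> \<open>The sorted rows of \<open>w\<close>, to be compared with the sorted vectors
    \<open>\<Xi> i N\<close>.\<close>
  define y where "y i j = w (i, \<tau> i j)" for i j
  define \<Phi> where "\<Phi> s = (\<lambda>i\<in>{..<n}. s i \<circ> \<tau> i)" for s :: "nat \<Rightarrow> nat \<Rightarrow> nat"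
  have \<Phi>_perm: "\<Phi> s i permutes {..<N}" if "s \<in> ?A" "i < n" for s i
    using that \<tau>(1)[of i] by (auto simp: \<Phi>_def perms_def PiE_iff intro!: permutes_compose)
  have s_perm: "s i permutes {..<N}" if "s \<in> ?A" "i < n" for s i
    using that by (auto simp: perms_def PiE_iff)
  have inj: "inj_on \<Phi> ?A"
  proof (rule inj_onI, rule ext)
    fix s t i assume s: "s \<in> ?A" and t: "t \<in> ?A" and eq: "\<Phi> s = \<Phi> t"
    show "s i = t i"
    proof (cases "i < n")
      case True
      have "\<Phi> s i = \<Phi> t i" using eq by simp
      then have "(s i \<circ> \<tau> i) \<circ> inv (\<tau> i) = (t i \<circ> \<tau> i) \<circ> inv (\<tau> i)" using True by (simp add: \<Phi>_def)
      then show ?thesis by (simp only: comp_assoc permutes_inv_o(1)[OF \<tau>(1)] comp_id)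
    next
      case False
      have "s \<in> PiE {..<n} (\<lambda>_. perms N)" "t \<in> PiE {..<n} (\<lambda>_. perms N)" using s t by blast+
      then show ?thesis using False PiE_arb[of s] PiE_arb[of t] by (metis lessThan_iff)
    qed
  qed
  have sub: "\<Phi> ` ?A \<subseteq> Delta_sym R \<mu> \<Xi> n N m \<delta>"
  proof (rule image_subsetI)
    fix s assume s: "s \<in> ?A"
    have sP: "s i \<in> perms N" if "i < n" for i using s_perm[OF s that] by (simp add: perms_def)
    have \<Phi>P: "\<Phi> s i \<in> perms N" if "i < n" for i using \<Phi>_perm[OF s that] by (simp add: perms_def)
    define l where "l i j = inv (\<Phi> s i) j" for i j
    have lN: "l i j < N" if "i < n" "j < N" for i j
      using act_xi_vec(2)[OF \<Phi>P[OF that(1)] that(2)] by (simp add: l_def)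
    have invN: "inv (s i) j < N" if "i < n" "j < N" for i j
      by (rule act_xi_vec(2)[OF sP[OF that(1)] that(2)])
    \<comment> \<open>Rearranging the sorted row by \<open>\<Phi> s\<close> reproduces the row of
      \<open>w\<close> rearranged by \<open>s\<close>.\<close>
    have yl: "y i (l i j) = w (i, inv (s i) j)" if "i < n" for i j
    proof -
      have "inv (\<Phi> s i) = inv (\<tau> i) \<circ> inv (s i)"
        using that permutes_bij[OF s_perm[OF s that]] permutes_bij[OF \<tau>(1)[of i]] by (simp add: \<Phi>_def o_inv_distrib)
      then show ?thesis by (simp add: l_def y_def permutes_inverses(1)[OF \<tau>(1)])
    qed
    define X where "X j = (\<lambda>i\<in>{..<n}. w (i, inv (s i) j))" for j
    have G: "unflatten N (permute N s w) \<in> Good N m' d" using s by (simp add: GoodF_def)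
    have Xeq: "unflatten N (permute N s w) j = X j" if "j < N" for j
      using that unfolding X_def unflatten_def permute_def by (auto simp: Idx_def intro!: restrict_ext)
    have Xcube: "X j \<in> cube R n" if "j < N" for j
    proof -
      have "unflatten N (permute N s w) \<in> PiE {..<N} (\<lambda>_. cube R n)" using G by (simp add: Good_def)
      from PiE_mem[OF this, of j] show ?thesis using Xeq[OF that] that by simp
    qed
    have Xmom: "\<bar>kappa N (\<lambda>j. prod_list (map (X j) is)) - (\<integral>y. prod_list (map y is) \<partial>\<mu>)\<bar> < d"
      if "set is \<subseteq> {..<n}" "1 \<le> length is" "length is \<le> m'" for "is"
    proof -
      have "\<bar>kappa N (\<lambda>j. prod_list (map (unflatten N (permute N s w) j) is)) - (\<integral>y. prod_list (map y is) \<partial>\<mu>)\<bar> < d"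
        using G that unfolding Good_def by blast
      then show ?thesis unfolding kappa_def using Xeq by simp
    qed
    have wR: "w (i, inv (s i) j) \<in> {-R..R}" if "i < n" "j < N" for i j
      using PiE_mem[OF Xcube[OF that(2), unfolded cube_def], of i] that by (simp add: X_def)
    \<comment> \<open>The range is known for the good rearrangement only; as \<open>s i\<close> is a
      bijection, it passes to the sorted row.\<close>
    have yR: "y i j \<in> {-R..R}" if "i < n" "j < N" for i j
    proof -
      have "\<tau> i j < N" using permutes_in_image[OF \<tau>(1), of i j] that by simp
      then have "s i (\<tau> i j) < N" using permutes_in_image[OF s_perm[OF s that(1)], of "\<tau> i j"] by simp
      from wR[OF that(1) this] show ?thesis
        unfolding y_def permutes_inverses(2)[OF s_perm[OF s that(1)]] .
    qed
    \<comment> \<open>Means over a row ignore its order, so the one-coordinate moments of the good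
      sample, given by the index lists \<open>replicate k i\<close>, are those of
      \<open>y i\<close>. These and the moments of \<open>\<Xi> i N\<close> are both close to the
      moments of the marginal.\<close>
    have ymom: "\<bar>kappa N (\<lambda>j. y i j ^ k) - kappa N (\<lambda>j. \<Xi> i N j ^ k)\<bar> < \<delta>0" if i: "i < n" and k: "1 \<le> k" "k \<le> m0" for i k
    proof -
      have "kappa N (\<lambda>j. prod_list (map (X j) (replicate k i))) = kappa N (\<lambda>j. w (i, inv (s i) j) ^ k)"
        using i by (simp add: X_def prod_list_replicate)
      also have "\<dots> = kappa N (\<lambda>j. y i j ^ k)"
        unfolding kappa_def yl[OF i, symmetric] l_def using sum_inv_perm[OF \<Phi>P[OF i], of "\<lambda>j. y i j ^ k"] by simp
      finally have "\<bar>kappa N (\<lambda>j. y i j ^ k) - (\<integral>t. t ^ k \<partial>marg \<mu> i)\<bar> < d"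
        unfolding integral_marg_power using Xmom[of "replicate k i"] i k mm by (simp add: set_replicate_conv_if)
      moreover have "\<bar>kappa N (\<lambda>j. \<Xi> i N j ^ k) - (\<integral>t. t ^ k \<partial>marg \<mu> i)\<bar> < d0" using mom i k by blast
      ultimately show ?thesis using dd by linarith
    qed
    have Xi: "\<Xi> i N j \<in> {-R..R}" if "i < n" "j < N" for i j
      using approx that by (auto simp: approx_seq_def)
    have Ximono: "\<Xi> i N j \<le> \<Xi> i N k" if "i < n" "j \<le> k" "k < N" for i j k
      using approx that by (auto simp: approx_seq_def)
    have yclose: "kappa N (\<lambda>j. \<bar>y i j - \<Xi> i N j\<bar>) \<le> \<eta>" if i: "i < n" for i
      using yR[OF i] Xi[OF i] Ximono[OF i] ymom[OF i] \<tau>(2)[of _ _ i] by (intro close) (auto simp: y_def)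
    \<comment> \<open>\<open>V\<close> and \<open>X\<close> are \<open>\<Xi>\<close> and
      \<open>y\<close> rearranged by the same permutations, so their mean distance is that of the
      sorted rows.\<close>
    define V where "V j = (\<lambda>i\<in>{..<n}. \<Xi> i N (l i j))" for j
    have VXclose: "kappa N (\<lambda>j. \<bar>V j i - X j i\<bar>) \<le> \<eta>" if i: "i < n" for i
    proof -
      have "kappa N (\<lambda>j. \<bar>V j i - X j i\<bar>) = kappa N (\<lambda>j. \<bar>y i (l i j) - \<Xi> i N (l i j)\<bar>)"
        using i yl[OF i] by (simp add: V_def X_def abs_minus_commute)
      also have "\<dots> = kappa N (\<lambda>j. \<bar>y i j - \<Xi> i N j\<bar>)"
        unfolding kappa_def l_def using sum_inv_perm[OF \<Phi>P[OF i], of "\<lambda>j. \<bar>y i j - \<Xi> i N j\<bar>"] by simp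
      finally show ?thesis using yclose[OF i] by simp
    qed
    have act_eq: "act (\<Phi> s i) (xi_vec \<Xi> i N) j = V j i" if "i < n" "j < N" for i j
      using act_xi_vec(1)[OF \<Phi>P[OF that(1)] that(2)] that by (simp add: V_def l_def)
    have Vmom: "\<bar>kappa N (\<lambda>j. prod_list (map (V j) is)) - (\<integral>y. prod_list (map y is) \<partial>\<mu>)\<bar> < \<delta>"
      if l: "set is \<subseteq> {..<n}" "1 \<le> length is" "length is \<le> m" for "is"
    proof -
      \<comment> \<open>With \<open>R1 \<ge> 1\<close> powers increase with the exponent, so the
        constant for length \<open>m\<close> serves all shorter monomials.\<close>
      have R1': "R1 \<ge> 1" "R \<le> R1" using R1 by auto
      have "\<bar>(\<Sum>j<N. prod_list (map (V j) is)) - (\<Sum>j<N. prod_list (map (X j) is))\<bar>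
        \<le> (\<Sum>j<N. \<bar>prod_list (map (V j) is) - prod_list (map (X j) is)\<bar>)"
        unfolding sum_subtractf[symmetric] by (rule sum_abs)
      also have "\<dots> \<le> (\<Sum>j<N. real m * R1 ^ m * (\<Sum>i<n. \<bar>V j i - X j i\<bar>))"
      proof (rule sum_mono)
        fix j assume "j \<in> {..<N}"
        then have j: "j < N" by simp
        have "\<bar>prod_list (map (V j) is) - prod_list (map (X j) is)\<bar> \<le> real (length is) * R1 ^ length is * (\<Sum>i<n. \<bar>V j i - X j i\<bar>)"
        proof (rule prod_list_diff_le[OF _ _ l(1) R1'(1)])
          fix i assume "i \<in> set is"
          then have i: "i < n" using l(1) by auto
          have "\<bar>V j i\<bar> \<le> R" using Xi[OF i lN[OF i j]] i by (auto simp: V_def)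
          then show "\<bar>V j i\<bar> \<le> R1" using R1' by simp
          have "\<bar>X j i\<bar> \<le> R" using wR[OF i j] i by (auto simp: X_def)
          then show "\<bar>X j i\<bar> \<le> R1" using R1' by simp
        qed
        also have "\<dots> \<le> real m * R1 ^ m * (\<Sum>i<n. \<bar>V j i - X j i\<bar>)"
          using l(3) R1' by (intro mult_right_mono mult_mono power_increasing sum_nonneg) auto
        finally show "\<bar>prod_list (map (V j) is) - prod_list (map (X j) is)\<bar> \<le> real m * R1 ^ m * (\<Sum>i<n. \<bar>V j i - X j i\<bar>)" .
      qed
      also have "\<dots> = real m * R1 ^ m * (\<Sum>i<n. \<Sum>j<N. \<bar>V j i - X j i\<bar>)"
        unfolding sum_distrib_left[symmetric] by (subst sum.swap) (rule refl)
      finally have "\<bar>(\<Sum>j<N. prod_list (map (V j) is)) - (\<Sum>j<N. prod_list (map (X j) is))\<bar> / real N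
        \<le> real m * R1 ^ m * (\<Sum>i<n. \<Sum>j<N. \<bar>V j i - X j i\<bar>) / real N"
        by (rule divide_right_mono) simp
      also have "\<dots> = real m * R1 ^ m * (\<Sum>i<n. kappa N (\<lambda>j. \<bar>V j i - X j i\<bar>))"
        by (simp add: kappa_def flip: sum_divide_distrib)
      also have "\<dots> \<le> real m * R1 ^ m * (\<Sum>i<n. \<eta>)"
        using R1' VXclose by (intro mult_left_mono sum_mono) auto
      finally have "\<bar>kappa N (\<lambda>j. prod_list (map (V j) is)) - kappa N (\<lambda>j. prod_list (map (X j) is))\<bar> \<le> real m * R1 ^ m * (real n * \<eta>)"
        unfolding kappa_def diff_divide_distrib[symmetric] by (simp add: abs_divide)
      then show ?thesis using Xmom[OF l(1,2)] l(3) mm C by linarith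
    qed
    show "\<Phi> s \<in> Delta_sym R \<mu> \<Xi> n N m \<delta>"
      unfolding Delta_sym_def
    proof (intro CollectI conjI)
      show "\<Phi> s \<in> PiE {..<n} (\<lambda>_. perms N)"
        using \<Phi>P by (intro PiE_I) (auto simp: \<Phi>_def)
      show "(\<lambda>i\<in>{..<n}. act (\<Phi> s i) (xi_vec \<Xi> i N)) \<in> Delta_R R \<mu> n N m \<delta>"
        unfolding Delta_R_def
      proof (intro CollectI conjI allI impI)
        show "(\<lambda>i\<in>{..<n}. act (\<Phi> s i) (xi_vec \<Xi> i N)) \<in> PiE {..<n} (\<lambda>_. PiE {..<N} (\<lambda>_. {-R..R}))"
        proof (rule restrict_PiE_iff[THEN iffD2], intro ballI)
          fix i assume "i \<in> {..<n}"
          then have i: "i < n" by simp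
          show "act (\<Phi> s i) (xi_vec \<Xi> i N) \<in> PiE {..<N} (\<lambda>_. {-R..R})"
          proof (rule PiE_I)
            fix j assume "j \<in> {..<N}"
            then have j: "j < N" by simp
            show "act (\<Phi> s i) (xi_vec \<Xi> i N) j \<in> {-R..R}"
              unfolding act_eq[OF i j] using Xi[OF i lN[OF i j]] i by (simp add: V_def)
          next
            fix j assume j: "j \<notin> {..<N}"
            \<comment> \<open>Off \<open>{..<N}\<close> the permutation is the identity and
              \<open>xi_vec\<close> is \<open>undefined\<close>, which gives extensionality.\<close>
            have "inv (\<Phi> s i) j = j"
              using permutes_inv[OF \<Phi>_perm[OF s i]] j by (rule permutes_not_in)
            then show "act (\<Phi> s i) (xi_vec \<Xi> i N) j = undefined"
              using j by (simp add: act_def xi_vec_def)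
          qed
        qed
        fix "is" assume l: "set is \<subseteq> {..<n} \<and> 1 \<le> length is \<and> length is \<le> m"
        have *: "map (\<lambda>i. (\<lambda>i\<in>{..<n}. act (\<Phi> s i) (xi_vec \<Xi> i N)) i j) is = map (V j) is" if "j < N" for j
          using l act_eq[OF _ that] by (intro map_cong) auto
        have "kappa N (\<lambda>j. prod_list (map (\<lambda>i. (\<lambda>i\<in>{..<n}. act (\<Phi> s i) (xi_vec \<Xi> i N)) i j) is)) = kappa N (\<lambda>j. prod_list (map (V j) is))"
          unfolding kappa_def by (intro arg_cong2[of _ _ _ _ "(/)"] sum.cong refl) (simp only: * lessThan_iff)
        then show "\<bar>kappa N (\<lambda>j. prod_list (map (\<lambda>i. (\<lambda>i\<in>{..<n}. act (\<Phi> s i) (xi_vec \<Xi> i N)) i j) is)) - (\<integral>y. prod_list (map (\<lambda>i. y i) is) \<partial>\<mu>)\<bar> < \<delta>"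
          using Vmom l by (simp only:)
      qed
    qed
  qed
  show ?thesis by (rule card_inj_on_le[OF inj sub finite_Delta_sym])
qed

lemma Delta_sym_ratio_ge:
  assumes \<delta>: "\<delta> > 0"
  obtains m' d where "d > 0" "\<forall>\<^sub>F N in sequentially.
     measure (PiM {..<N} (\<lambda>_. \<nu>)) (Good N m' d) \<le> real (card (Delta_sym R \<mu> \<Xi> n N m \<delta>)) / fact N ^ n"
proof -
  define R1 where "R1 = max 1 R"
  define C where "C = real m * R1 ^ m * real n"
  have C: "C \<ge> 0" by (simp add: C_def R1_def)
  \<comment> \<open>Half of \<delta> is reserved for replacing the sample by the approximating
    sequence, the other half for the moment error \<open>d\<close> of the sample.\<close>
  define \<eta> where "\<eta> = \<delta> / (2 * (C + 1))"
  have \<eta>: "\<eta> > 0" using C \<delta> by (simp add: \<eta>_def)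
  show ?thesis
  proof (rule sorted_moments_close[OF R_pos \<eta>])
    fix m0 \<delta>0 assume m0: "\<delta>0 > 0"
      "\<And>N x y. N > 0 \<Longrightarrow> (\<And>j. j < N \<Longrightarrow> x j \<in> {-R..R}) \<Longrightarrow> (\<And>j k. j \<le> k \<Longrightarrow> k < N \<Longrightarrow> x j \<le> x k) \<Longrightarrow>
         (\<And>j. j < N \<Longrightarrow> y j \<in> {-R..R}) \<Longrightarrow> (\<And>j k. j \<le> k \<Longrightarrow> k < N \<Longrightarrow> y j \<le> y k) \<Longrightarrow>
         (\<And>k. 1 \<le> k \<Longrightarrow> k \<le> m0 \<Longrightarrow> \<bar>kappa N (\<lambda>j. x j ^ k) - kappa N (\<lambda>j. y j ^ k)\<bar> < \<delta>0) \<Longrightarrow>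
         kappa N (\<lambda>j. \<bar>x j - y j\<bar>) \<le> \<eta>"
    \<comment> \<open>The tolerance \<open>\<delta>0\<close> is shared equally by the sample and the
      approximating sequence, each compared with the moments of the marginals.\<close>
    define d where "d = min (\<delta> / 2) (\<delta>0 / 2)"
    have d: "d > 0" using \<delta> m0 by (simp add: d_def)
    show ?thesis
    proof (rule that[OF d, of "max m m0"])
      show "\<forall>\<^sub>F N in sequentially. measure (PiM {..<N} (\<lambda>_. \<nu>)) (Good N (max m m0) d)
         \<le> real (card (Delta_sym R \<mu> \<Xi> n N m \<delta>)) / fact N ^ n"
        using approx_moments_eventually[of "\<delta>0 / 2" m0, OF half_gt_zero[OF m0(1)]] eventually_gt_at_top[of 0]
      proof eventually_elim
        case (elim N)
        obtain w where w: "fact N ^ n * measure (flat N) (GoodF N (max m m0) d) \<le>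
           real (card {s \<in> PiE {..<n} (\<lambda>_. perms N). permute N s w \<in> GoodF N (max m m0) d})"
          using ex_many_good_rearrangements by blast
        have "real m * R1 ^ m * (real n * \<eta>) = C * \<eta>" by (simp add: C_def)
        also have "\<dots> \<le> \<delta> / 2" using C \<delta> by (simp add: \<eta>_def field_simps)
        finally have "real m * R1 ^ m * (real n * \<eta>) + d \<le> \<delta>" by (simp add: d_def)
        then have "card {s \<in> PiE {..<n} (\<lambda>_. perms N). permute N s w \<in> GoodF N (max m m0) d} \<le> card (Delta_sym R \<mu> \<Xi> n N m \<delta>)"
          by (intro card_good_rearrangements_le[of N \<eta> R1 m d \<delta> "max m m0" m0 "\<delta>0 / 2" \<delta>0 w] m0(2) elim)
            (use \<eta> in \<open>auto simp: R1_def d_def\<close>)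
        with w have "fact N ^ n * measure (flat N) (GoodF N (max m m0) d) \<le> real (card (Delta_sym R \<mu> \<Xi> n N m \<delta>))"
          by linarith
        then show ?case unfolding measure_GoodF by (simp add: field_simps)
      qed
    qed
  qed
qed

text \<open>Since \<open>Isym\<close> is minus an infimum, each pair \<open>m\<close>, \<delta> is
  treated alone, with its own set of good samples.\<close>

lemma Isym_le_rel_entropy: "Isym R n \<mu> \<Xi> \<le> rel_entropy \<mu> \<nu>"
proof (cases "rel_entropy \<mu> \<nu> = \<infinity>")
  case False
  then have fin: "rel_entropy \<mu> \<nu> < \<infinity>" by simp
  obtain f :: "(nat \<Rightarrow> real) \<Rightarrow> real" where f: "f \<in> borel_measurable \<nu>" "\<And>x. 0 \<le> f x" "\<mu> = density \<nu> f"
    "integrable \<mu> (\<lambda>x. ln (f x))" "rel_entropy \<mu> \<nu> = ereal (\<integral>x. ln (f x) \<partial>\<mu>)"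
    by (rule rel_entropy_finite_density[OF prob_space_\<nu> prob_space_axioms fin]) (rule that)
  define S where "S = (\<integral>x. ln (f x) \<partial>\<mu>)"
  have "ereal (- S) \<le> limsup (Delta_log m \<delta>)" if \<delta>: "\<delta> > 0" for m \<delta>
  proof -
    obtain m' d where d: "d > 0" and ev: "\<forall>\<^sub>F N in sequentially.
       measure (PiM {..<N} (\<lambda>_. \<nu>)) (Good N m' d) \<le> real (card (Delta_sym R \<mu> \<Xi> n N m \<delta>)) / fact N ^ n"
      using Delta_sym_ratio_ge[OF \<delta>] by blast
    define p where "p N = measure (PiM {..<N} (\<lambda>_. \<mu>)) (Good N m' d)" for N
    have p_lim: "p \<longlonglongrightarrow> 1" unfolding p_def by (rule prob_Good_tendsto[OF d])
    then have p_pos: "\<forall>\<^sub>F N in sequentially. p N > 0" by (rule order_tendstoD) simp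
    \<comment> \<open>The lower bound for the exponent per position that
      \<open>tensor_event_bound\<close> provides; it tends to \<open>- S\<close> because
      \<open>p N\<close> tends to 1.\<close>
    let ?b = "\<lambda>N. - ((S + ln 2 * (1 / real N)) / p N)"
    have "(\<lambda>N. 1 / real N) \<longlonglongrightarrow> 0" by (rule lim_1_over_n)
    then have "?b \<longlonglongrightarrow> - ((S + ln 2 * 0) / 1)"
      using p_lim by (intro tendsto_intros) auto
    then have "(\<lambda>N. ereal (?b N)) \<longlonglongrightarrow> ereal (- S)" by simp
    then have "ereal (- S) = limsup (\<lambda>N. ereal (?b N))" by (rule lim_imp_Limsup[symmetric, rotated]) simp
    also have "\<dots> \<le> limsup (Delta_log m \<delta>)"
    proof (rule Limsup_mono)
      show "\<forall>\<^sub>F N in sequentially. ereal (?b N) \<le> Delta_log m \<delta> N"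
        using ev p_pos eventually_gt_at_top[of 0]
      proof eventually_elim
        case (elim N)
        let ?q = "measure (PiM {..<N} (\<lambda>_. \<nu>)) (Good N m' d)"
        let ?r = "real (card (Delta_sym R \<mu> \<Xi> n N m \<delta>)) / fact N ^ n"
        have E: "Good N m' d \<in> sets (PiM {..<N} (\<lambda>_. \<nu>))" using Good_sets sets_PiM_\<nu> by blast
        have P: "prob_space (density \<nu> f)" and ln: "integrable (density \<nu> f) (\<lambda>x. ln (f x))"
          using f(3,4) prob_space_axioms by auto
        have p': "measure (PiM {..<N} (\<lambda>_. density \<nu> f)) (Good N m' d) > 0"
          using elim(2) f(3) by (simp add: p_def)
        have q: "?q > 0" by (rule tensor_event_bound(1)[OF prob_space_\<nu> f(1,2) P ln _ E p']) simp
        have "- measure (PiM {..<N} (\<lambda>_. density \<nu> f)) (Good N m' d) * ln ?q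
            \<le> real (card {..<N}) * (\<integral>x. ln (f x) \<partial>density \<nu> f) + ln 2"
          by (rule tensor_event_bound(2)[OF prob_space_\<nu> f(1,2) P ln _ E p']) simp
        then have "- p N * ln ?q \<le> real N * S + ln 2"
          by (simp add: p_def S_def flip: f(3))
        then have "- ln ?q \<le> (real N * S + ln 2) / p N"
          using elim(2) by (simp add: pos_le_divide_eq mult.commute)
        then have "- ((real N * S + ln 2) / p N) / real N \<le> ln ?q / real N"
          by (intro divide_right_mono) auto
        also have "- ((real N * S + ln 2) / p N) / real N = ?b N"
          using elim by (simp add: field_simps)
        also have "ln ?q / real N \<le> ln ?r / real N"
          using q elim by (intro divide_right_mono ln_mono) auto
        finally have "?b N \<le> ln ?r / real N" .
        \<comment> \<open>Positivity of the proportion keeps \<open>elog\<close> away from its value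
          \<open>-\<infinity>\<close>.\<close>
        moreover have "Delta_log m \<delta> N = ereal (ln ?r / real N)"
          using less_le_trans[OF q elim(1)] unfolding Delta_log_def elog_def by simp
        ultimately show ?case by simp
      qed
    qed
    finally show ?thesis .
  qed
  then have "ereal (- S) \<le> (INF m. INF \<delta>\<in>{0<..}. limsup (Delta_log m \<delta>))"
    by (intro INF_greatest) auto
  then have "Isym R n \<mu> \<Xi> \<le> - ereal (- S)" unfolding Isym_eq by (simp only: ereal_minus_le_minus)
  then show ?thesis using f(5) by (simp add: S_def)
qed simp

end

subsection \<open>Entropy of densities\<close>

text \<open>Densities agree almost everywhere, so the value does not depend on the choice made by
  \<open>SOME\<close>.\<close>

lemma bg_entropy_density:
  fixes p :: "'a \<Rightarrow> real"
  assumes L: "sigma_finite_measure L" and p[measurable]: "p \<in> borel_measurable L" "\<And>x. 0 \<le> p x"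
  shows "bg_entropy L (density L p) = (if integrable L (\<lambda>x. p x * ln (p x))
     then ereal (- (\<integral>x. p x * ln (p x) \<partial>L)) else -\<infinity>)"
proof -
  let ?Q = "\<lambda>q. q \<in> borel_measurable L \<and> (\<forall>x. 0 \<le> q x) \<and> density L p = density L (\<lambda>x. ennreal (q x))"
  define q where "q = (SOME q. ?Q q)"
  have ex: "\<exists>q. ?Q q" using p by (intro exI[of _ p]) auto
  then have "?Q q" unfolding q_def by (rule someI_ex)
  then have q[measurable]: "q \<in> borel_measurable L" and q0: "\<And>x. 0 \<le> q x"
    and eq: "density L p = density L q" by auto
  have "AE x in L. ennreal (p x) = ennreal (q x)"
    using eq by (subst sigma_finite_measure.density_unique_iff[OF L, symmetric]) auto
  then have ae: "AE x in L. q x * ln (q x) = p x * ln (p x)"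
    by eventually_elim (use p(2) q0 in \<open>auto simp: ennreal_inj\<close>)
  have 1: "integrable L (\<lambda>x. q x * ln (q x)) \<longleftrightarrow> integrable L (\<lambda>x. p x * ln (p x))"
    by (intro integrable_cong_AE ae) auto
  have 2: "(\<integral>x. q x * ln (q x) \<partial>L) = (\<integral>x. p x * ln (p x) \<partial>L)"
    by (intro integral_cong_AE ae) auto
  show ?thesis unfolding bg_entropy_def Let_def q_def[symmetric] 1 2 if_P[OF ex] ..
qed

lemma bg_entropy_not_PInf: "bg_entropy L M \<noteq> \<infinity>"
  by (auto simp: bg_entropy_def Let_def)

lemma bg_entropy_finite_density:
  assumes L: "sigma_finite_measure L" and fin: "bg_entropy L M > -\<infinity>"
  obtains p :: "'a \<Rightarrow> real" where "p \<in> borel_measurable L" "\<And>x. 0 \<le> p x" "M = density L p"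
    "integrable L (\<lambda>x. p x * ln (p x))" "bg_entropy L M = ereal (- (\<integral>x. p x * ln (p x) \<partial>L))"
proof -
  have "\<exists>p. p \<in> borel_measurable L \<and> (\<forall>x. 0 \<le> p x) \<and> M = density L (\<lambda>x. ennreal (p x))"
    using fin by (auto simp: bg_entropy_def split: if_splits)
  then obtain p where p: "p \<in> borel_measurable L" "\<And>x. 0 \<le> p x" "M = density L (\<lambda>x. ennreal (p x))" by blast
  have eq: "bg_entropy L M = (if integrable L (\<lambda>x. p x * ln (p x))
     then ereal (- (\<integral>x. p x * ln (p x) \<partial>L)) else -\<infinity>)"
    unfolding p(3) by (rule bg_entropy_density[OF L p(1,2)])
  then have "integrable L (\<lambda>x. p x * ln (p x))" using fin by (auto split: if_splits)
  then show ?thesis using that[of p] p eq by simp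
qed

lemma rel_entropy_not_MInf: "rel_entropy M N \<noteq> -\<infinity>"
  by (auto simp: rel_entropy_def Let_def)

text \<open>Chain rule for \<open>p = \<pi> * f\<close>: the term \<open>p * ln \<pi>\<close> is
  integrable by \<open>int\<close>, so \<open>p * ln p\<close> and \<open>\<pi> * (f * ln f)\<close>
  are integrable together. It is applied with \<pi> the product of the marginal densities and with
  uniform densities.\<close>

lemma bg_entropy_eq_minus_rel_entropy:
  fixes \<pi> :: "'a \<Rightarrow> real"
  assumes L: "sigma_finite_measure L" and \<pi>[measurable]: "\<pi> \<in> borel_measurable L" "\<And>x. 0 \<le> \<pi> x"
    and N: "prob_space (density L \<pi>)" and M: "prob_space M" and sM: "sets M = sets L"
    and pos: "AE x in M. \<pi> x > 0" and int: "integrable M (\<lambda>x. ln (\<pi> x))"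
  shows "bg_entropy L M = - rel_entropy M (density L \<pi>) + ereal (- (\<integral>x. ln (\<pi> x) \<partial>M))"
proof (cases "absolutely_continuous (density L \<pi>) M")
  case True
  let ?N = "density L \<pi>"
  have s: "sets M = sets ?N" using sM by simp
  define f where "f x = enn2real (RN_deriv ?N M x)" for x
  have M_eq: "density ?N f = M" unfolding f_def by (rule density_enn2real_RN_deriv[OF N M s True])
  have f: "f \<in> borel_measurable L" "\<And>x. 0 \<le> f x"
  proof -
    have "f \<in> borel_measurable ?N" by (auto simp: f_def[abs_def])
    then show "f \<in> borel_measurable L" by simp
    show "\<And>x. 0 \<le> f x" by (simp add: f_def)
  qed
  note [measurable] = f(1)
  define p where "p x = \<pi> x * f x" for x
  have p: "p \<in> borel_measurable L" "\<And>x. 0 \<le> p x" unfolding p_def using f(2) \<pi>(2) by auto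
  note [measurable] = p(1)
  have M_p: "M = density L p"
    unfolding M_eq[symmetric] p_def using \<pi>(2) f(2) by (subst density_density_eq) (auto simp: ennreal_mult)
  have pw: "p x * ln (p x) = \<pi> x * (f x * ln (f x)) + p x * ln (\<pi> x)" for x
  proof (cases "p x = 0")
    case False
    then have "\<pi> x > 0" "f x > 0" using \<pi>(2)[of x] f(2)[of x] by (auto simp: p_def less_le)
    then show ?thesis by (simp add: p_def ln_mult algebra_simps)
  qed (auto simp: p_def)
  have i1: "integrable L (\<lambda>x. p x * ln (\<pi> x))" and v1: "(\<integral>x. p x * ln (\<pi> x) \<partial>L) = (\<integral>x. ln (\<pi> x) \<partial>M)"
    using int p(2) unfolding M_p by (auto simp: integrable_real_density integral_real_density)
  have i2: "integrable L (\<lambda>x. \<pi> x * (f x * ln (f x))) \<longleftrightarrow> integrable ?N (\<lambda>x. f x * ln (f x))"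
    and v2: "(\<integral>x. \<pi> x * (f x * ln (f x)) \<partial>L) = (\<integral>x. f x * ln (f x) \<partial>?N)"
    using \<pi>(2) by (auto simp: integrable_real_density integral_real_density)
  have i3: "integrable L (\<lambda>x. p x * ln (p x)) \<longleftrightarrow> integrable L (\<lambda>x. \<pi> x * (f x * ln (f x)))"
  proof
    assume "integrable L (\<lambda>x. p x * ln (p x))"
    from Bochner_Integration.integrable_diff[OF this i1] show "integrable L (\<lambda>x. \<pi> x * (f x * ln (f x)))"
      unfolding pw by simp
  next
    assume "integrable L (\<lambda>x. \<pi> x * (f x * ln (f x)))"
    from Bochner_Integration.integrable_add[OF this i1] show "integrable L (\<lambda>x. p x * ln (p x))"
      unfolding pw .
  qed
  have rel: "rel_entropy M ?N = (if integrable ?N (\<lambda>x. f x * ln (f x)) then ereal (\<integral>x. f x * ln (f x) \<partial>?N) else \<infinity>)"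
    using s True by (simp add: rel_entropy_def f_def Let_def)
  have bg: "bg_entropy L M = (if integrable L (\<lambda>x. p x * ln (p x)) then ereal (- (\<integral>x. p x * ln (p x) \<partial>L)) else -\<infinity>)"
    unfolding M_p by (rule bg_entropy_density[OF L p])
  show ?thesis
  proof (cases "integrable ?N (\<lambda>x. f x * ln (f x))")
    case I: True
    have "(\<integral>x. p x * ln (p x) \<partial>L) = (\<integral>x. f x * ln (f x) \<partial>?N) + (\<integral>x. ln (\<pi> x) \<partial>M)"
      unfolding pw v1[symmetric] v2[symmetric] using I i1 i2 by (intro Bochner_Integration.integral_add) auto
    then show ?thesis using I i2 i3 by (simp add: rel bg)
  next
    case False
    then show ?thesis using i2 i3 by (simp add: rel bg)
  qed
next
  case False
  \<comment> \<open>A density of \<open>M\<close> with respect to \<open>L\<close> would give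
    absolute continuity, since \<pi> is positive almost everywhere for \<open>M\<close>. Hence both
    sides are \<open>-\<infinity>\<close>.\<close>
  have "\<not> (\<exists>p. p \<in> borel_measurable L \<and> (\<forall>x. 0 \<le> p x) \<and> M = density L (\<lambda>x. ennreal (p x)))"
  proof
    assume "\<exists>p. p \<in> borel_measurable L \<and> (\<forall>x. 0 \<le> p x) \<and> M = density L (\<lambda>x. ennreal (p x))"
    then obtain p where p: "p \<in> borel_measurable L" "M = density L (\<lambda>x. ennreal (p x))" by blast
    have "absolutely_continuous (density L \<pi>) M"
      unfolding absolutely_continuous_def
    proof
      fix A assume A: "A \<in> null_sets (density L \<pi>)"
      then have As: "A \<in> sets L" "AE x in L. x \<in> A \<longrightarrow> ennreal (\<pi> x) = 0"
        by (auto simp: null_sets_density_iff)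
      have "AE x in M. x \<in> A \<longrightarrow> ennreal (\<pi> x) = 0"
        unfolding p(2) using p(1) As(2) by (subst AE_density) auto
      with pos have "AE x in M. x \<notin> A"
        by eventually_elim (auto simp: ennreal_eq_0_iff)
      then show "A \<in> null_sets M" using As(1) sM by (subst (asm) AE_iff_null_sets[symmetric]) auto
    qed
    with False show False by simp
  qed
  then have "bg_entropy L M = -\<infinity>" unfolding bg_entropy_def by (rule if_not_P)
  moreover have "rel_entropy M (density L \<pi>) = \<infinity>" using False by (simp add: rel_entropy_def)
  ultimately show ?thesis by simp
qed

text \<open>Data processing, in the form of finiteness: test functions on the image pull back along
  \<open>T\<close>, so the bound of \<open>donsker_varadhan_le\<close> is inherited.\<close>

lemma rel_entropy_distr_le:
  assumes N: "prob_space N" and M: "prob_space M" and T: "T \<in> measurable N K"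
    and fin: "rel_entropy M N < \<infinity>"
  shows "rel_entropy (distr M K T) (distr N K T) < \<infinity>"
proof -
  obtain f :: "'a \<Rightarrow> real" where f: "f \<in> borel_measurable N" "\<And>x. 0 \<le> f x" "M = density N f"
    "integrable M (\<lambda>x. ln (f x))"
    by (rule rel_entropy_finite_density[OF N M fin]) (rule that)
  have TM: "T \<in> measurable M K" using T by (simp add: f(3))
  have "rel_entropy (distr M K T) (distr N K T) \<le> ereal (\<integral>x. ln (f x) \<partial>M)"
  proof (rule rel_entropy_le_of_gibbs_bound)
    fix h :: "'b \<Rightarrow> real" and B assume "h \<in> borel_measurable (distr N K T)" and hB: "\<And>x. \<bar>h x\<bar> \<le> B"
    then have h[measurable]: "h \<in> borel_measurable K" by simp
    have "(\<lambda>x. h (T x)) \<in> borel_measurable N" by (rule measurable_compose[OF T h])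
    then have "(\<integral>x. h (T x) \<partial>density N f) - ln (\<integral>x. exp (h (T x)) \<partial>N) \<le> (\<integral>x. ln (f x) \<partial>density N f)"
      using M f hB by (intro donsker_varadhan_le[OF N f(1,2)]) auto
    then show "(\<integral>x. h x \<partial>distr M K T) - ln (\<integral>x. exp (h x) \<partial>distr N K T) \<le> (\<integral>x. ln (f x) \<partial>M)"
      using TM T by (simp add: integral_distr flip: f(3))
  qed (auto intro: prob_space.prob_space_distr[OF M TM] prob_space.prob_space_distr[OF N T])
  then show ?thesis by (rule le_less_trans) simp
qed

section \<open>Entropy of \<mu> and of its marginals\<close>

context approximated
begin

definition unif :: "real \<Rightarrow> real" where "unif t = indicator {-R..R} t / (2 * R)"

lemma unif_measurable [measurable]: "unif \<in> borel_measurable lborel"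
  unfolding unif_def by simp

lemma unif_nonneg: "0 \<le> unif t" using R_pos by (simp add: unif_def)

lemma prob_space_unif: "prob_space (density lborel unif)"
proof
  have "emeasure (density lborel unif) (space (density lborel unif)) = (\<integral>\<^sup>+t. ennreal (unif t) \<partial>lborel)"
    by (simp add: emeasure_density)
  also have "\<dots> = (\<integral>\<^sup>+t. ennreal (1 / (2 * R)) * indicator {-R..R} t \<partial>lborel)"
    by (intro nn_integral_cong) (auto simp: unif_def split: split_indicator)
  also have "\<dots> = ennreal (1 / (2 * R)) * ennreal (2 * R)"
    using R_pos by (subst nn_integral_cmult_indicator) auto
  also have "\<dots> = 1" using R_pos by (subst ennreal_mult[symmetric]) auto
  finally show "emeasure (density lborel unif) (space (density lborel unif)) = 1" .
qed

lemma sigma_finite_lebn: "sigma_finite_measure (lebn n)"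
proof -
  interpret product_sigma_finite "\<lambda>_ :: nat. lborel :: real measure"
    by (intro product_sigma_finite.intro sigma_finite_lborel)
  show ?thesis unfolding lebn_def by (intro sigma_finite) simp
qed

text \<open>The uniform density is constant on its support, so entropy and minus the relative
  entropy to the uniform law differ by a finite constant, on the cube as well as on one coordinate.
  Finiteness descends to the coordinate by data processing.\<close>

lemma bg_entropy_marg_finite:
  assumes fin: "bg_entropy (lebn n) \<mu> > -\<infinity>" and i: "i < n"
  shows "bg_entropy lborel (marg \<mu> i) > -\<infinity>"
proof -
  let ?u = "density lborel unif"
  let ?U = "PiM {..<n} (\<lambda>_. ?u)"
  let ?\<pi> = "\<lambda>x. \<Prod>i<n. unif (x i)"
  have U: "?U = density (lebn n) ?\<pi>"
    unfolding lebn_def using prob_space_unif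
    by (intro PiM_density) (auto intro: sigma_finite_lborel prob_space_imp_sigma_finite unif_nonneg)
  have pU: "prob_space ?U" by (intro prob_space_PiM prob_space_unif)
  have \<pi>: "?\<pi> \<in> borel_measurable (lebn n)" "\<And>x. 0 \<le> ?\<pi> x"
    unfolding lebn_def by (auto intro!: prod_nonneg unif_nonneg)
  have sM: "sets \<mu> = sets (lebn n)" using sets_M by (simp add: lebn_def)
  have \<pi>c: "AE x in \<mu>. ?\<pi> x = (1 / (2 * R)) ^ n"
    using AE_cube by eventually_elim (auto simp: unif_def cube_def PiE_iff)
  have \<pi>m: "?\<pi> \<in> borel_measurable \<mu>" using \<pi>(1) sM by (simp cong: measurable_cong_sets)
  have int: "integrable \<mu> (\<lambda>x. ln (?\<pi> x))"
  proof (rule integrable_cong_AE_imp)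
    show "integrable \<mu> (\<lambda>x. ln ((1 / (2 * R)) ^ n))" by simp
    show "(\<lambda>x. ln (?\<pi> x)) \<in> borel_measurable \<mu>" using \<pi>m by (rule borel_measurable_ln)
    show "AE x in \<mu>. ln ((1 / (2 * R)) ^ n) = ln (?\<pi> x)" using \<pi>c by eventually_elim simp
  qed
  have "AE x in \<mu>. ?\<pi> x > 0" using \<pi>c by eventually_elim (use R_pos in simp)
  then have "bg_entropy (lebn n) \<mu> = - rel_entropy \<mu> ?U + ereal (- (\<integral>x. ln (?\<pi> x) \<partial>\<mu>))"
    unfolding U using pU U
    by (intro bg_entropy_eq_minus_rel_entropy[OF sigma_finite_lebn \<pi> _ prob_space_axioms sM _ int]) auto
  then have "rel_entropy \<mu> ?U < \<infinity>" using fin by (cases "rel_entropy \<mu> ?U") auto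
  then have "rel_entropy (distr \<mu> lborel (\<lambda>x. x i)) (distr ?U lborel (\<lambda>x. x i)) < \<infinity>"
  proof (rule rel_entropy_distr_le[OF pU prob_space_axioms, rotated])
    have "(\<lambda>x. x i) \<in> measurable ?U ?u" using i by (intro measurable_component_singleton) auto
    then show "(\<lambda>x. x i) \<in> measurable ?U lborel" by simp
  qed
  moreover have "distr ?U lborel (\<lambda>x. x i) = ?u"
  proof -
    have "distr ?U lborel (\<lambda>x. x i) = distr ?U ?u (\<lambda>x. x i)" by (intro distr_cong) auto
    also have "\<dots> = ?u" using i prob_space_unif by (intro distr_PiM_component) auto
    finally show ?thesis .
  qed
  ultimately have fin1: "rel_entropy (marg \<mu> i) ?u < \<infinity>" by (simp add: marg_def)
  have c1: "AE t in marg \<mu> i. unif t = 1 / (2 * R)"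
    using AE_marg[OF i] by eventually_elim (auto simp: unif_def)
  have um: "unif \<in> borel_measurable (marg \<mu> i)" using unif_measurable by (simp cong: measurable_cong_sets)
  have int1: "integrable (marg \<mu> i) (\<lambda>t. ln (unif t))"
  proof (rule integrable_cong_AE_imp)
    show "integrable (marg \<mu> i) (\<lambda>t. ln (1 / (2 * R)))"
      using prob_space.finite_measure[OF prob_space_marg] by (intro finite_measure.integrable_const) auto
    show "(\<lambda>t. ln (unif t)) \<in> borel_measurable (marg \<mu> i)" using um by (rule borel_measurable_ln)
    show "AE t in marg \<mu> i. ln (1 / (2 * R)) = ln (unif t)" using c1 by eventually_elim simp
  qed
  have "AE t in marg \<mu> i. unif t > 0" using c1 by eventually_elim (use R_pos in simp)
  then have "bg_entropy lborel (marg \<mu> i) = - rel_entropy (marg \<mu> i) ?u + ereal (- (\<integral>t. ln (unif t) \<partial>marg \<mu> i))"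
    by (intro bg_entropy_eq_minus_rel_entropy[OF sigma_finite_lborel unif_measurable unif_nonneg prob_space_unif prob_space_marg _ _ int1]) auto
  then show ?thesis using fin1 rel_entropy_not_MInf[of "marg \<mu> i" ?u]
    by (cases "rel_entropy (marg \<mu> i) ?u") auto
qed

text \<open>\<open>ln\<close> of the product density is a sum of functions of one coordinate each,
  so its integral under \<mu> sees the marginals only and equals minus the sum of their
  entropies.\<close>

lemma bg_entropy_finite_marginals:
  assumes fin: "\<And>i. i < n \<Longrightarrow> bg_entropy lborel (marg \<mu> i) > -\<infinity>"
  shows "bg_entropy (lebn n) \<mu> = - rel_entropy \<mu> \<nu> + (\<Sum>i<n. bg_entropy lborel (marg \<mu> i))"
proof -
  \<comment> \<open>\<open>PiM_density\<close> asks for measurable nonnegative densities of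
    sigma-finite measures at every index; from \<open>n\<close> on, the constant 1 serves.\<close>
  define Q where "Q i p \<longleftrightarrow> p \<in> borel_measurable lborel \<and> (\<forall>t. 0 \<le> p t) \<and> (i < n \<longrightarrow> marg \<mu> i = density lborel (\<lambda>t. ennreal (p t)) \<and>
     integrable lborel (\<lambda>t. p t * ln (p t)) \<and> bg_entropy lborel (marg \<mu> i) = ereal (- (\<integral>t. p t * ln (p t) \<partial>lborel)))
     \<and> sigma_finite_measure (density lborel (\<lambda>t. ennreal (p t)))" for i and p :: "real \<Rightarrow> real"
  have "\<exists>p. Q i p" for i
  proof (cases "i < n")
    case True
    obtain p :: "real \<Rightarrow> real" where p: "p \<in> borel_measurable lborel" "\<And>x. 0 \<le> p x" "marg \<mu> i = density lborel p"
      "integrable lborel (\<lambda>x. p x * ln (p x))" "bg_entropy lborel (marg \<mu> i) = ereal (- (\<integral>x. p x * ln (p x) \<partial>lborel))"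
      by (rule bg_entropy_finite_density[OF sigma_finite_lborel fin[OF True]]) (rule that)
    have "sigma_finite_measure (density lborel (\<lambda>t. ennreal (p t)))"
      using prob_space_imp_sigma_finite[OF prob_space_marg[of i]] p(3) by simp
    then show ?thesis unfolding Q_def using p by (intro exI[of _ p]) blast
  next
    case False
    then show ?thesis unfolding Q_def
      by (intro exI[of _ "\<lambda>_. 1"]) (auto simp: density_1 intro: sigma_finite_lborel)
  qed
  then obtain p where "\<And>i. Q i (p i)" by metis
  then have p: "\<And>i. p i \<in> borel_measurable lborel" "\<And>i t. 0 \<le> p i t"
    "\<And>i. i < n \<Longrightarrow> marg \<mu> i = density lborel (\<lambda>t. ennreal (p i t))"
    "\<And>i. i < n \<Longrightarrow> integrable lborel (\<lambda>t. p i t * ln (p i t))"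
    "\<And>i. i < n \<Longrightarrow> bg_entropy lborel (marg \<mu> i) = ereal (- (\<integral>t. p i t * ln (p i t) \<partial>lborel))"
    "\<And>i. sigma_finite_measure (density lborel (\<lambda>t. ennreal (p i t)))"
    unfolding Q_def by blast+
  let ?\<pi> = "\<lambda>x. \<Prod>i<n. p i (x i)"
  have "\<nu> = PiM {..<n} (\<lambda>i. density lborel (\<lambda>t. ennreal (p i t)))"
    unfolding \<nu>_def using p(3) by (intro PiM_cong) auto
  also have "\<dots> = density (lebn n) ?\<pi>"
    unfolding lebn_def by (intro PiM_density p sigma_finite_lborel finite_lessThan)
  finally have \<nu>_eq: "\<nu> = density (lebn n) ?\<pi>" .
  have pm: "(\<lambda>x. p i (x i)) \<in> borel_measurable (lebn n)" if "i < n" for i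
    unfolding lebn_def using that p(1)[of i]
    by (intro measurable_compose[OF measurable_component_singleton[of i "{..<n}" "\<lambda>_. lborel"]]) auto
  have \<pi>: "?\<pi> \<in> borel_measurable (lebn n)" "\<And>x. 0 \<le> ?\<pi> x"
    using pm p(2) by (auto intro!: prod_nonneg borel_measurable_prod)
  have sM: "sets \<mu> = sets (lebn n)" using sets_M by (simp add: lebn_def)
  have plog: "(\<lambda>t. ln (p i t)) \<in> borel_measurable lborel" for i using p(1) by (rule borel_measurable_ln)
  have "AE x in \<mu>. p i (x i) > 0" if i: "i < n" for i
  proof -
    have "AE t in marg \<mu> i. p i t > 0"
      unfolding p(3)[OF i] using p(1,2) by (subst AE_density) (auto simp: less_le)
    then show ?thesis unfolding marg_def by (rule AE_distrD[OF measurable_coord'])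
  qed
  then have all_pos: "AE x in \<mu>. \<forall>i\<in>{..<n}. p i (x i) > 0" by (subst AE_finite_all) auto
  then have pos: "AE x in \<mu>. ?\<pi> x > 0" by eventually_elim (auto intro: prod_pos)
  from all_pos have lnsum: "AE x in \<mu>. (\<Sum>i<n. ln (p i (x i))) = ln (?\<pi> x)"
    by eventually_elim (metis finite_lessThan ln_prod less_irrefl)
  have im: "integrable \<mu> (\<lambda>x. ln (p i (x i)))" and vm: "(\<integral>x. ln (p i (x i)) \<partial>\<mu>) = (\<integral>t. p i t * ln (p i t) \<partial>lborel)"
    if i: "i < n" for i
  proof -
    have "integrable (marg \<mu> i) (\<lambda>t. ln (p i t))"
      unfolding p(3)[OF i] using p(1,2,4)[of i] i plog by (subst integrable_real_density) auto
    then show "integrable \<mu> (\<lambda>x. ln (p i (x i)))"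
      unfolding marg_def by (subst (asm) integrable_distr_eq[OF measurable_coord']) (use plog in auto)
    have "(\<integral>x. ln (p i (x i)) \<partial>\<mu>) = (\<integral>t. ln (p i t) \<partial>marg \<mu> i)"
      unfolding marg_def by (rule integral_distr[OF measurable_coord', symmetric]) (use plog in auto)
    also have "\<dots> = (\<integral>t. p i t * ln (p i t) \<partial>lborel)"
      unfolding p(3)[OF i] using p(1,2)[of i] plog by (subst integral_real_density) auto
    finally show "(\<integral>x. ln (p i (x i)) \<partial>\<mu>) = (\<integral>t. p i t * ln (p i t) \<partial>lborel)" .
  qed
  have \<pi>m: "?\<pi> \<in> borel_measurable \<mu>" using \<pi>(1) sM by (simp cong: measurable_cong_sets)
  have isum: "integrable \<mu> (\<lambda>x. \<Sum>i<n. ln (p i (x i)))" using im by (intro Bochner_Integration.integrable_sum) auto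
  have int: "integrable \<mu> (\<lambda>x. ln (?\<pi> x))"
    by (rule integrable_cong_AE_imp[OF isum borel_measurable_ln[OF \<pi>m] lnsum])
  have "(\<integral>x. ln (?\<pi> x) \<partial>\<mu>) = (\<integral>x. (\<Sum>i<n. ln (p i (x i))) \<partial>\<mu>)"
    using lnsum isum \<pi>m by (intro integral_cong_AE) auto
  also have "\<dots> = (\<Sum>i<n. \<integral>t. p i t * ln (p i t) \<partial>lborel)"
    using im vm by (subst Bochner_Integration.integral_sum) auto
  finally have val: "- (\<integral>x. ln (?\<pi> x) \<partial>\<mu>) = (\<Sum>i<n. - (\<integral>t. p i t * ln (p i t) \<partial>lborel))"
    by (simp add: sum_negf)
  have "bg_entropy (lebn n) \<mu> = - rel_entropy \<mu> \<nu> + ereal (- (\<integral>x. ln (?\<pi> x) \<partial>\<mu>))"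
    unfolding \<nu>_eq using prob_space_\<nu> \<nu>_eq
    by (intro bg_entropy_eq_minus_rel_entropy[OF sigma_finite_lebn \<pi> _ prob_space_axioms sM pos int]) auto
  also have "ereal (- (\<integral>x. ln (?\<pi> x) \<partial>\<mu>)) = (\<Sum>i<n. bg_entropy lborel (marg \<mu> i))"
    unfolding val using p(5) by simp
  finally show ?thesis .
qed

lemma Isym_cal_eq: "Isym_cal R n \<mu> \<Xi> = rel_entropy \<mu> \<nu>"
  using rel_entropy_le_Isym_cal Isym_cal_le_Isym Isym_le_rel_entropy by (meson antisym order_trans)

lemma Isym_eq_rel_entropy: "Isym R n \<mu> \<Xi> = rel_entropy \<mu> \<nu>"
  using rel_entropy_le_Isym_cal Isym_cal_le_Isym Isym_le_rel_entropy by (meson antisym order_trans)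

text \<open>If some marginal entropy is \<open>-\<infinity>\<close>, the right-hand side is
  \<open>-\<infinity>\<close> as well, because neither \<open>- rel_entropy\<close> nor any other
  summand can be \<open>\<infinity>\<close>.\<close>

lemma bg_entropy_eq:
  "bg_entropy (lebn n) \<mu> = - rel_entropy \<mu> \<nu> + (\<Sum>i<n. bg_entropy lborel (marg \<mu> i))"
proof (cases "\<forall>i<n. bg_entropy lborel (marg \<mu> i) > -\<infinity>")
  case True
  then show ?thesis by (intro bg_entropy_finite_marginals) auto
next
  case False
  then obtain i where i: "i < n" "bg_entropy lborel (marg \<mu> i) = -\<infinity>" by auto
  have "bg_entropy (lebn n) \<mu> = -\<infinity>"
    using bg_entropy_marg_finite[of i] i by force
  moreover have "(\<Sum>i<n. bg_entropy lborel (marg \<mu> i)) = -\<infinity>"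
  proof -
    have "\<bar>\<Sum>i<n. bg_entropy lborel (marg \<mu> i)\<bar> = \<infinity>"
      unfolding sum_Inf using i by (intro conjI finite_lessThan bexI[of _ i]) auto
    moreover have "(\<Sum>i<n. bg_entropy lborel (marg \<mu> i)) \<noteq> \<infinity>"
      by (simp add: sum_Pinfty bg_entropy_not_PInf)
    ultimately show ?thesis by auto
  qed
  ultimately show ?thesis
    using rel_entropy_not_MInf[of \<mu> \<nu>] by (cases "rel_entropy \<mu> \<nu>") auto
qed

end

theorem theorem3p5:
  fixes R :: real and n :: nat and \<mu> :: "(nat \<Rightarrow> real) measure"
    and \<Xi> :: "nat \<Rightarrow> nat \<Rightarrow> nat \<Rightarrow> real"
  assumes "R > 0"
    and "\<mu> \<in> Prob_cube R n"
    and "approx_seq R n \<mu> \<Xi>"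
  shows "bg_entropy (lebn n) \<mu> = - Isym_cal R n \<mu> \<Xi> + (\<Sum>i<n. bg_entropy lborel (marg \<mu> i)) \<and>
         ((\<forall>i<n. bg_entropy lborel (marg \<mu> i) > -\<infinity>) \<longrightarrow>
           Isym_cal R n \<mu> \<Xi> = Isym R n \<mu> \<Xi> \<and>
           Isym R n \<mu> \<Xi> = rel_entropy \<mu> (PiM {..<n} (\<lambda>i. marg \<mu> i)) \<and>
           (Isym_cal R n \<mu> \<Xi> = 0 \<longleftrightarrow> \<mu> = PiM {..<n} (\<lambda>i. marg \<mu> i)))"
proof -
  interpret approximated \<mu> R n \<Xi>
    using assms by (intro approximated.intro cube_prob.intro approximated_axioms.intro cube_prob_axioms.intro)
      (auto simp: Prob_cube_def lebn_def)
  show ?thesis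
    using bg_entropy_eq rel_entropy_eq_0_iff[OF prob_space_\<nu> prob_space_axioms]
    unfolding Isym_cal_eq Isym_eq_rel_entropy \<nu>_def by simp
qed

end
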